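(* Let $f$, the partition $J_1,\dots,J_N$, $X=\prod_jX_j$, $X_T=\prod_jX_{j,T}$ (compact basic semialgebraic sets each including a ball constraint $R^2-\|x\|^2\ge0$) be as in the setting of the context, with acyclic sparsity graph having leafs $x_{i_1},\dots,x_{i_l}$, and let $R_T$ be the ROA. For $k\in\mathbb{N}$ let $S^{(k)}=\{x\in X: w^r_k(x_{I_r})\ge1,\ r=1,\dots,l\}$ be the decoupled SDP outer approximation (context), and let $Y^{(k)}=\{x\in X:\sum_{r=1}^l\tilde w^r(x_{I_r})\ge l\}$ where $(\tilde w^r,\tilde v^r)_{r=1,\dots,l}$ is an optimal point of the degree-$k$ sparse SDP tightening (context) of the sparse LP. Then $S^{(k)}\cap Y^{(k)}\supset R_T$ and $\lambda\big((S^{(k)}\cap Y^{(k)})\,\Delta\,R_T\big)\to0$ as $k\to\infty$, and the largest sum-of-squares multiplier occurring acts on $\omega$ (state) variables, $\omega=\max_i\sum_{x_j\in\mathbf{P}(x_i)}n_j$.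
   Context: Setting: $f:\mathbb{R}^n\to\mathbb{R}^n$ polynomial; blocks $x_j=(x_i)_{i\in J_j}\in\mathbb{R}^{n_j}$. Sparsity graph: edge $(x_i,x_j)$ if $f_j$ depends on $x_i$; past $\mathbf{P}(x_j)$ = $x_j$ and all nodes with a directed path to $x_j$; leaf = node without successor. $I_r$ indexes the blocks of $\mathbf{P}(x_{i_r})$, $X_{I_r}=\prod_{j\in I_r}X_j\subset\mathbb{R}^{n_r}$, $f_{I_r}$ the corresponding components of $f$, $\mathcal{L}_rv=\partial_tv+\nabla_{x_{I_r}}v\cdot f_{I_r}$. ROA: $R_T=\{x_0\in X$: solution stays in $X$ on $[0,T]$, $x(T)\in X_T\}$. Decoupled SDP: for each $r$, $w^r_k$ is optimal for the degree-$k$ SOS tightening of $\inf\int_{X_{I_r}}w\,d\lambda$ s.t. $\mathcal{L}_rv\le0$ on $[0,T]\times X_{I_r}$, $v(T,\cdot)\ge0$ on $\prod_{j\in I_r}X_{j,T}$, $w\ge0$ and $w\ge v(0,\cdot)+1$ on $X_{I_r}$, where each constraint "$h\ge0$ on $K=\{p_1\ge0,\dots,p_m\ge0\}$" is replaced by $h=\sigma_0+\sum_j\sigma_jp_j$ (plus $\sigma\,t(T-t)$ for constraints on $[0,T]\times K$) with SOS $\sigma$'s and all degrees $\le k$. Sparse LP: $\inf\sum_r\int_{X_{I_r}}w^r\,d\lambda$ over $v^r\in C^1([0,T]\times\mathbb{R}^{n_r})$, $w^r\in C(X_{I_r})$ s.t. $\sum_r\mathcal{L}_rv^r(t,x_{I_r})\le0$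 on $[0,T]\times X$, $\sum_rv^r(T,x_{I_r})\ge0$ on $X_T$, $\sum_rw^r(x_{I_r})\ge0$ on $X$, $\sum_r(w^r(x_{I_r})-v^r(0,x_{I_r}))\ge l$ on $X$. Its degree-$k$ sparse SDP tightening restricts to polynomials of degree $\le k$ and replaces each nonnegativity constraint by a certificate that is a sum over $r$ of terms $\sigma^r_0+\sum_j\sigma^r_jg^r_j$, where the SOS polynomials $\sigma^r$ depend only on the variables $x_{I_r}$ (and $t$) and the $g^r_j$ are the polynomials defining the factors $X_j$, $j\in I_r$ (resp. $X_{j,T}$, and $t(T-t)$). $\lambda$ is Lebesgue measure, $\Delta$ symmetric difference. *)

theory Defs
  imports "HOL-Analysis.Analysis"
begin

text \<open>States are functions nat => real; a function of the state "in variables V"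
depends only on the coordinates in V.  Multivariate polynomials are rendered as
functions that are finite linear combinations of monomials.\<close>

definition supp :: "(nat \<Rightarrow> nat) \<Rightarrow> nat set" where
  "supp \<alpha> = {i. \<alpha> i \<noteq> 0}"

definition mdeg :: "(nat \<Rightarrow> nat) \<Rightarrow> nat" where
  "mdeg \<alpha> = (\<Sum>i\<in>supp \<alpha>. \<alpha> i)"

definition mono :: "(nat \<Rightarrow> nat) \<Rightarrow> (nat \<Rightarrow> real) \<Rightarrow> real" where
  "mono \<alpha> x = (\<Prod>i\<in>supp \<alpha>. x i ^ \<alpha> i)"

definition poly_on :: "nat set \<Rightarrow> nat \<Rightarrow> ((nat \<Rightarrow> real) \<Rightarrow> real) \<Rightarrow> bool" where
  "poly_on V d p \<longleftrightarrow> (\<exists>A c. finite A \<and>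
      (\<forall>\<alpha>\<in>A. finite (supp \<alpha>) \<and> supp \<alpha> \<subseteq> V \<and> mdeg \<alpha> \<le> d) \<and>
      (\<forall>x. p x = (\<Sum>\<alpha>\<in>A. c \<alpha> * mono \<alpha> x)))"

definition tpoly_on :: "nat set \<Rightarrow> nat \<Rightarrow> (real \<Rightarrow> (nat \<Rightarrow> real) \<Rightarrow> real) \<Rightarrow> bool" where
  "tpoly_on V d p \<longleftrightarrow> (\<exists>A c. finite A \<and>
      (\<forall>(a,\<alpha>)\<in>A. finite (supp \<alpha>) \<and> supp \<alpha> \<subseteq> V \<and> a + mdeg \<alpha> \<le> d) \<and>
      (\<forall>t x. p t x = (\<Sum>(a,\<alpha>)\<in>A. c (a,\<alpha>) * t ^ a * mono \<alpha> x)))"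

definition pdeg :: "nat set \<Rightarrow> ((nat \<Rightarrow> real) \<Rightarrow> real) \<Rightarrow> nat" where
  "pdeg V p = (LEAST d. poly_on V d p)"

definition sos_on :: "nat set \<Rightarrow> nat \<Rightarrow> ((nat \<Rightarrow> real) \<Rightarrow> real) \<Rightarrow> bool" where
  "sos_on V d s \<longleftrightarrow> (\<exists>qs. (\<forall>q\<in>set qs. poly_on V (d div 2) q) \<and>
      (\<forall>x. s x = (\<Sum>q\<leftarrow>qs. (q x)^2)))"

definition tsos_on :: "nat set \<Rightarrow> nat \<Rightarrow> (real \<Rightarrow> (nat \<Rightarrow> real) \<Rightarrow> real) \<Rightarrow> bool" where
  "tsos_on V d s \<longleftrightarrow> (\<exists>qs. (\<forall>q\<in>set qs. tpoly_on V (d div 2) q) \<and>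
      (\<forall>t x. s t x = (\<Sum>q\<leftarrow>qs. (q t x)^2)))"

text \<open>degree-k Putinar-type certificate of "h >= 0 on {gs >= 0}" in variables V\<close>
definition cert :: "nat set \<Rightarrow> nat \<Rightarrow> ((nat \<Rightarrow> real) \<Rightarrow> real) list \<Rightarrow>
    ((nat \<Rightarrow> real) \<Rightarrow> real) \<Rightarrow> bool" where
  "cert V k gs h \<longleftrightarrow> (\<exists>s0 ss. sos_on V k s0 \<and> length ss = length gs \<and>
      (\<forall>i<length gs. sos_on V (k - pdeg V (gs!i)) (ss!i)) \<and>
      (\<forall>x. h x = s0 x + (\<Sum>i<length gs. (ss!i) x * (gs!i) x)))"

definition tcert :: "nat set \<Rightarrow> nat \<Rightarrow> real \<Rightarrow> ((nat \<Rightarrow> real) \<Rightarrow> real) list \<Rightarrow>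
    (real \<Rightarrow> (nat \<Rightarrow> real) \<Rightarrow> real) \<Rightarrow> bool" where
  "tcert V k T gs h \<longleftrightarrow> (\<exists>s0 s1 ss. tsos_on V k s0 \<and> tsos_on V (k - 2) s1 \<and>
      length ss = length gs \<and>
      (\<forall>i<length gs. tsos_on V (k - pdeg V (gs!i)) (ss!i)) \<and>
      (\<forall>t x. h t x = s0 t x + s1 t x * (t * (T - t)) + (\<Sum>i<length gs. (ss!i) t x * (gs!i) x)))"

definition scert :: "nat set \<Rightarrow> (nat \<Rightarrow> nat set) \<Rightarrow> nat \<Rightarrow>
    (nat \<Rightarrow> ((nat \<Rightarrow> real) \<Rightarrow> real) list) \<Rightarrow> ((nat \<Rightarrow> real) \<Rightarrow> real) \<Rightarrow> bool" where
  "scert L V k gs h \<longleftrightarrow> (\<exists>hs. (\<forall>r\<in>L. cert (V r) k (gs r) (hs r)) \<and>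
      (\<forall>x. h x = (\<Sum>r\<in>L. hs r x)))"

definition stcert :: "nat set \<Rightarrow> (nat \<Rightarrow> nat set) \<Rightarrow> nat \<Rightarrow> real \<Rightarrow>
    (nat \<Rightarrow> ((nat \<Rightarrow> real) \<Rightarrow> real) list) \<Rightarrow> (real \<Rightarrow> (nat \<Rightarrow> real) \<Rightarrow> real) \<Rightarrow> bool" where
  "stcert L V k T gs h \<longleftrightarrow> (\<exists>hs. (\<forall>r\<in>L. tcert (V r) k T (gs r) (hs r)) \<and>
      (\<forall>t x. h t x = (\<Sum>r\<in>L. hs r t x)))"

text \<open>Sparsity graph on the blocks 0..N-1 (block j has coordinates J j)\<close>
definition depends_on :: "((nat \<Rightarrow> real) \<Rightarrow> real) \<Rightarrow> nat \<Rightarrow> bool" where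
  "depends_on p b \<longleftrightarrow> (\<exists>x s. p (x(b := s)) \<noteq> p x)"

definition sp_edges :: "nat \<Rightarrow> (nat \<Rightarrow> nat set) \<Rightarrow> (nat \<Rightarrow> (nat \<Rightarrow> real) \<Rightarrow> real) \<Rightarrow> (nat \<times> nat) set" where
  "sp_edges N J f = {(i,j). i < N \<and> j < N \<and> i \<noteq> j \<and> (\<exists>a\<in>J j. \<exists>b\<in>J i. depends_on (f a) b)}"

definition past :: "nat \<Rightarrow> (nat \<Rightarrow> nat set) \<Rightarrow> (nat \<Rightarrow> (nat \<Rightarrow> real) \<Rightarrow> real) \<Rightarrow> nat \<Rightarrow> nat set" where
  "past N J f i = insert i {j. (j,i) \<in> (sp_edges N J f)\<^sup>+}"

definition leaves :: "nat \<Rightarrow> (nat \<Rightarrow> nat set) \<Rightarrow> (nat \<Rightarrow> (nat \<Rightarrow> real) \<Rightarrow> real) \<Rightarrow> nat set" where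
  "leaves N J f = {i. i < N \<and> (\<forall>j. (i,j) \<notin> sp_edges N J f)}"

definition vars :: "(nat \<Rightarrow> nat set) \<Rightarrow> nat set \<Rightarrow> nat set" where
  "vars J I = \<Union>(J ` I)"

definition glist :: "(nat \<Rightarrow> 'a list) \<Rightarrow> nat set \<Rightarrow> 'a list" where
  "glist g I = concat (map g (sorted_list_of_set I))"

definition semialg :: "nat set \<Rightarrow> ((nat \<Rightarrow> real) \<Rightarrow> real) list \<Rightarrow> (nat \<Rightarrow> real) set" where
  "semialg V gs = {x \<in> PiE V (\<lambda>_. UNIV). \<forall>g\<in>set gs. 0 \<le> g x}"

definition Lop :: "(nat \<Rightarrow> (nat \<Rightarrow> real) \<Rightarrow> real) \<Rightarrow> nat set \<Rightarrow>
    (real \<Rightarrow> (nat \<Rightarrow> real) \<Rightarrow> real) \<Rightarrow> real \<Rightarrow> (nat \<Rightarrow> real) \<Rightarrow> real" where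
  "Lop f U v t x = deriv (\<lambda>s. v s x) t + (\<Sum>i\<in>U. deriv (\<lambda>s. v t (x(i := s))) (x i) * f i x)"

abbreviation lebV :: "nat set \<Rightarrow> (nat \<Rightarrow> real) measure" where
  "lebV V \<equiv> PiM V (\<lambda>_. lborel)"

definition intg :: "nat set \<Rightarrow> (nat \<Rightarrow> real) set \<Rightarrow> ((nat \<Rightarrow> real) \<Rightarrow> real) \<Rightarrow> real" where
  "intg V S w = integral\<^sup>L (lebV V) (\<lambda>x. indicator S x * w x)"

definition dec_feas where
  "dec_feas N J f gX gT T k r v w \<longleftrightarrow>
    (let Ib = past N J f r; U = vars J Ib in
      tpoly_on U k v \<and> poly_on U k w \<and>
      tcert U k T (glist gX Ib) (\<lambda>t x. - Lop f U v t x) \<and>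
      cert U k (glist gT Ib) (\<lambda>x. v T x) \<and>
      cert U k (glist gX Ib) w \<and>
      cert U k (glist gX Ib) (\<lambda>x. w x - v 0 x - 1))"

definition dec_obj where
  "dec_obj N J f gX r w =
    (let Ib = past N J f r; U = vars J Ib in intg U (semialg U (glist gX Ib)) w)"

definition dec_opt where
  "dec_opt N J f gX gT T k r w \<longleftrightarrow>
    (\<exists>v. dec_feas N J f gX gT T k r v w) \<and>
    (\<forall>v' w'. dec_feas N J f gX gT T k r v' w' \<longrightarrow> dec_obj N J f gX r w \<le> dec_obj N J f gX r w')"

definition sp_feas where
  "sp_feas N J f gX gT T k v w \<longleftrightarrow>
    (let L = leaves N J f; Ib = past N J f; U = (\<lambda>r. vars J (Ib r)) in
      (\<forall>r\<in>L. tpoly_on (U r) k (v r) \<and> poly_on (U r) k (w r)) \<and>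
      stcert L U k T (\<lambda>r. glist gX (Ib r)) (\<lambda>t x. - (\<Sum>r\<in>L. Lop f (U r) (v r) t x)) \<and>
      scert L U k (\<lambda>r. glist gT (Ib r)) (\<lambda>x. \<Sum>r\<in>L. v r T x) \<and>
      scert L U k (\<lambda>r. glist gX (Ib r)) (\<lambda>x. \<Sum>r\<in>L. w r x) \<and>
      scert L U k (\<lambda>r. glist gX (Ib r)) (\<lambda>x. (\<Sum>r\<in>L. w r x - v r 0 x) - real (card L)))"

definition sp_obj where
  "sp_obj N J f gX w =
    (let L = leaves N J f; Ib = past N J f; U = (\<lambda>r. vars J (Ib r)) in
      (\<Sum>r\<in>L. intg (U r) (semialg (U r) (glist gX (Ib r))) (w r)))"

definition sp_opt where
  "sp_opt N J f gX gT T k v w \<longleftrightarrow> sp_feas N J f gX gT T k v w \<and>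
    (\<forall>v' w'. sp_feas N J f gX gT T k v' w' \<longrightarrow> sp_obj N J f gX w \<le> sp_obj N J f gX w')"

definition ROA :: "nat \<Rightarrow> (nat \<Rightarrow> (nat \<Rightarrow> real) \<Rightarrow> real) \<Rightarrow> real \<Rightarrow>
    (nat \<Rightarrow> real) set \<Rightarrow> (nat \<Rightarrow> real) set \<Rightarrow> (nat \<Rightarrow> real) set" where
  "ROA n f T X XT = {x0 \<in> X. \<exists>x. x 0 = x0 \<and> (\<forall>t\<in>{0..T}. x t \<in> X) \<and> x T \<in> XT \<and>
      (\<forall>i<n. \<forall>t\<in>{0..T}. ((\<lambda>s. x s i) has_real_derivative f i (x t)) (at t within {0..T}))}"

end

theory Submission
  imports Defs
begin

text \<open>
  Inclusion: along a trajectory that stays in \<open>X\<close> and ends in \<open>X\<^sub>T\<close>, the function \<open>v\<close> (respectively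
  \<open>\<Sum>\<^sub>r v\<^sup>r\<close>) is nonincreasing with nonnegative final value, so it is nonnegative at time \<open>0\<close>, and the
  last constraint bounds \<open>w\<close> from below.  As \<open>S \<inter> Y - R\<^sub>T \<subseteq> S - R\<^sub>T\<close>, the sparse program plays no role in
  the convergence.  The region \<open>R\<^sub>T\<close> is the intersection over the leaves of the cylinders over the regions of
  the subsystems (solutions agree on common pasts by uniqueness), so it suffices that the optimal values
  of each decoupled program converge to the volume of its region.

  For one subsystem, near-optimal polynomials are constructed directly.  Were \<open>\<phi>\<close> the flow of \<open>f\<close>, clipped
  far outside \<open>X\<close>, and \<open>P\<close>, \<open>Q\<close> large penalties for leaving \<open>X\<close> and for missing \<open>X\<^sub>T\<close>, then
  \<open>v(t,x) = - Q(\<phi>(T-t,x)) - \<integral>\<^sub>0\<^sup>T\<^sup>-\<^sup>t P(\<phi>(s,x)) ds\<close> would satisfy \<open>\<L>v = P = 0\<close> on \<open>X\<close>, vanish at time \<open>0\<close> on the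
  region and be very negative off it.  With a polynomial approximation \<open>F\<close> of the clipped field and polynomial
  penalties, the Picard iterates \<open>\<phi>\<^sub>k\<close> are polynomials in \<open>(s,x)\<close>, and the defects
  \<open>E\<^sub>k = \<partial>\<^sub>s\<phi>\<^sub>k - \<nabla>\<phi>\<^sub>k f\<close> satisfy \<open>\<partial>\<^sub>s E\<^sub>k\<^sub>+\<^sub>1 = DF(\<phi>\<^sub>k) E\<^sub>k\<close> with \<open>E\<^sub>k\<^sub>+\<^sub>1(0) = F - f\<close>, so they become small
  without any differentiability theory for flows.  A small affine correction in \<open>t\<close> makes the constraints
  strict, and Putinar's Positivstellensatz provides the certificates for all large degrees.
\<close>

section \<open>Polynomial functions\<close>

text \<open>The clipping answers an obstacle: solutions of \<open>f\<close> may blow up outside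
  \<open>X\<close>, but a trajectory that has left \<open>X\<close> must exist up to time
  \<open>T\<close> for the penalties to be evaluated on it. The clipped field is not polynomial, and
  its replacement \<open>F\<close> is accurate only on a box; radius \<open>R + B * T\<close>
  suffices because every Picard iterate started in \<open>X\<close> stays there. The recursion for
  the defects rests on two facts: the time derivative commutes with the transport operator, whose
  coefficients are independent of time, and \<open>F - f\<close> is small where clipping is the
  identity. The defects enter \<open>v\<close> multiplied by gradients of the penalties, which are
  fixed before the accuracy of \<open>F\<close> and the number of iterations. The Positivstellensatz
  is proved for characters of an algebra of functions; when coordinates generate the algebra these
  are point evaluations, and the ball constraints make the module archimedean. The overestimate of
  one leaf lives in that leaf's variables and is lifted by cutting its cylinder off with a
  box.\<close>

lemma mono_superset:
  assumes "finite S" "supp \<alpha> \<subseteq> S"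
  shows "mono \<alpha> x = (\<Prod>i\<in>S. x i ^ \<alpha> i)"
  unfolding mono_def using assms by (intro prod.mono_neutral_left) (auto simp: supp_def)

lemma mdeg_superset:
  assumes "finite S" "supp \<alpha> \<subseteq> S"
  shows "mdeg \<alpha> = (\<Sum>i\<in>S. \<alpha> i)"
  unfolding mdeg_def using assms by (intro sum.mono_neutral_left) (auto simp: supp_def)

lemma supp_add: "supp (\<lambda>i. \<alpha> i + \<beta> i) = supp \<alpha> \<union> supp \<beta>"
  by (auto simp: supp_def)

lemma mono_mult:
  assumes "finite (supp \<alpha>)" "finite (supp \<beta>)"
  shows "mono \<alpha> x * mono \<beta> x = mono (\<lambda>i. \<alpha> i + \<beta> i) x"
  using assms
  by (simp add: mono_superset[of "supp \<alpha> \<union> supp \<beta>"] supp_add power_add prod.distrib)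

lemma mdeg_add:
  assumes "finite (supp \<alpha>)" "finite (supp \<beta>)"
  shows "mdeg (\<lambda>i. \<alpha> i + \<beta> i) = mdeg \<alpha> + mdeg \<beta>"
  using assms
  by (simp add: mdeg_superset[of "supp \<alpha> \<union> supp \<beta>"] supp_add sum.distrib)

text \<open>Puts two linear combinations of monomials over a common index set: each coefficient
  family is extended by zero to the union.\<close>

lemma sum_restrict_Un:
  fixes c e m :: "'b \<Rightarrow> real"
  assumes "finite A" "finite B"
  shows "(\<Sum>\<alpha>\<in>A \<union> B. ((if \<alpha> \<in> A then c \<alpha> else 0) + (if \<alpha> \<in> B then e \<alpha> else 0)) * m \<alpha>) =
    (\<Sum>\<alpha>\<in>A. c \<alpha> * m \<alpha>) + (\<Sum>\<alpha>\<in>B. e \<alpha> * m \<alpha>)"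
proof -
  have "(\<Sum>\<alpha>\<in>A \<union> B. (if \<alpha> \<in> A then c \<alpha> else 0) * m \<alpha>) = (\<Sum>\<alpha>\<in>A. c \<alpha> * m \<alpha>)"
    using assms by (intro sum.mono_neutral_cong_right) auto
  moreover have "(\<Sum>\<alpha>\<in>A \<union> B. (if \<alpha> \<in> B then e \<alpha> else 0) * m \<alpha>) = (\<Sum>\<alpha>\<in>B. e \<alpha> * m \<alpha>)"
    using assms by (intro sum.mono_neutral_cong_right) auto
  ultimately show ?thesis by (simp add: distrib_right sum.distrib)
qed

lemma poly_on_mono: "poly_on V d p \<Longrightarrow> d \<le> e \<Longrightarrow> poly_on V e p"
  unfolding poly_on_def by (meson order_trans)

text \<open>Degree-free form of \<open>poly_on\<close>: the algebra generated by constants and the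
  coordinates in \<open>V\<close>. Closure properties and estimates then go by induction, and
  degrees come back only through \<open>polys_iff\<close>.\<close>

inductive_set polys :: "nat set \<Rightarrow> ((nat \<Rightarrow> real) \<Rightarrow> real) set" for V where
  const: "(\<lambda>x. c) \<in> polys V"
| var: "i \<in> V \<Longrightarrow> (\<lambda>x. x i) \<in> polys V"
| add: "p \<in> polys V \<Longrightarrow> q \<in> polys V \<Longrightarrow> (\<lambda>x. p x + q x) \<in> polys V"
| mult: "p \<in> polys V \<Longrightarrow> q \<in> polys V \<Longrightarrow> (\<lambda>x. p x * q x) \<in> polys V"

lemma polys_sum:
  "finite I \<Longrightarrow> (\<And>i. i \<in> I \<Longrightarrow> p i \<in> polys V) \<Longrightarrow> (\<lambda>x. \<Sum>i\<in>I. p i x) \<in> polys V"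
  by (induction I rule: finite_induct) (auto intro: polys.intros)

lemma polys_prod:
  "finite I \<Longrightarrow> (\<And>i. i \<in> I \<Longrightarrow> p i \<in> polys V) \<Longrightarrow> (\<lambda>x. \<Prod>i\<in>I. p i x) \<in> polys V"
  by (induction I rule: finite_induct) (auto intro: polys.intros)

lemma polys_power: "p \<in> polys V \<Longrightarrow> (\<lambda>x. p x ^ k) \<in> polys V"
  by (induction k) (auto intro: polys.intros)

lemma polys_uminus: "p \<in> polys V \<Longrightarrow> (\<lambda>x. - p x) \<in> polys V"
  using polys.mult[OF polys.const[of "-1"]] by simp

lemma polys_diff: "p \<in> polys V \<Longrightarrow> q \<in> polys V \<Longrightarrow> (\<lambda>x. p x - q x) \<in> polys V"
  using polys.add[OF _ polys_uminus] by simp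

lemma polys_sum_list:
  "(\<And>p. p \<in> set ps \<Longrightarrow> h p \<in> polys V) \<Longrightarrow> (\<lambda>x. \<Sum>p\<leftarrow>ps. h p x) \<in> polys V"
  by (induction ps) (auto intro: polys.intros)

lemma mono_in_polys: "finite (supp \<alpha>) \<Longrightarrow> supp \<alpha> \<subseteq> V \<Longrightarrow> mono \<alpha> \<in> polys V"
  unfolding mono_def[abs_def] by (intro polys_prod polys_power polys.var) auto

lemma mono_zero: "mono (\<lambda>_. 0) x = 1"
  by (simp add: mono_def supp_def)

lemma supp_zero: "supp (\<lambda>_. 0) = {}"
  by (simp add: supp_def)

lemma mdeg_zero: "mdeg (\<lambda>_. 0) = 0"
  by (simp add: mdeg_def)

lemma supp_single: "supp (\<lambda>j. if j = i then 1 else 0) = {i}"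
  by (auto simp: supp_def)

lemma polys_subset: "p \<in> polys V \<Longrightarrow> V \<subseteq> W \<Longrightarrow> p \<in> polys W"
  by (induction rule: polys.induct) (auto intro: polys.intros)

lemma polys_cong: "p \<in> polys V \<Longrightarrow> (\<And>i. i \<in> V \<Longrightarrow> x i = y i) \<Longrightarrow> p x = p y"
  by (induction rule: polys.induct) auto

lemma polys_comp:
  "p \<in> polys V \<Longrightarrow> (\<And>i. i \<in> V \<Longrightarrow> q i \<in> polys W) \<Longrightarrow> (\<lambda>x. p (\<lambda>i. q i x)) \<in> polys W"
  by (induction rule: polys.induct) (auto intro: polys.intros)

lemma polys_bounded:
  assumes "p \<in> polys V"
  shows "\<exists>B\<ge>0. \<forall>x. (\<forall>i\<in>V. \<bar>x i\<bar> \<le> R) \<longrightarrow> \<bar>p x\<bar> \<le> B"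
  using assms
proof induction
  case (const c)
  show ?case by (rule exI[of _ "\<bar>c\<bar>"]) auto
next
  case (var i)
  then show ?case by (intro exI[of _ "\<bar>R\<bar>"]) force
next
  case (add p q)
  then obtain B C where "B \<ge> 0" "C \<ge> 0" "\<forall>x. (\<forall>i\<in>V. \<bar>x i\<bar> \<le> R) \<longrightarrow> \<bar>p x\<bar> \<le> B"
    "\<forall>x. (\<forall>i\<in>V. \<bar>x i\<bar> \<le> R) \<longrightarrow> \<bar>q x\<bar> \<le> C" by blast
  then show ?case by (intro exI[of _ "B + C"]) (force intro: order_trans[OF abs_triangle_ineq])
next
  case (mult p q)
  then obtain B C where "B \<ge> 0" "C \<ge> 0" "\<forall>x. (\<forall>i\<in>V. \<bar>x i\<bar> \<le> R) \<longrightarrow> \<bar>p x\<bar> \<le> B"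
    "\<forall>x. (\<forall>i\<in>V. \<bar>x i\<bar> \<le> R) \<longrightarrow> \<bar>q x\<bar> \<le> C" by blast
  then show ?case by (intro exI[of _ "B * C"]) (auto simp: abs_mult intro!: mult_mono)
qed

text \<open>The sup distance over \<open>V\<close> enters as a bound \<open>b\<close> on the
  coordinates, so that no norm on \<open>nat \<Rightarrow> real\<close> is needed.\<close>

lemma polys_lipschitz:
  assumes "p \<in> polys V"
  shows "\<exists>L\<ge>0. \<forall>x y b. (\<forall>i\<in>V. \<bar>x i\<bar> \<le> R) \<longrightarrow> (\<forall>i\<in>V. \<bar>y i\<bar> \<le> R) \<longrightarrow> 0 \<le> b \<longrightarrow>
    (\<forall>i\<in>V. \<bar>x i - y i\<bar> \<le> b) \<longrightarrow> \<bar>p x - p y\<bar> \<le> L * b"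
  using assms
proof induction
  case (const c)
  show ?case by (rule exI[of _ 0]) auto
next
  case (var i)
  then show ?case by (intro exI[of _ 1]) auto
next
  case (add p q)
  then obtain B C where *: "B \<ge> 0" "C \<ge> 0" 
    "\<forall>x y b. (\<forall>i\<in>V. \<bar>x i\<bar> \<le> R) \<longrightarrow> (\<forall>i\<in>V. \<bar>y i\<bar> \<le> R) \<longrightarrow> 0 \<le> b \<longrightarrow> (\<forall>i\<in>V. \<bar>x i - y i\<bar> \<le> b) \<longrightarrow> \<bar>p x - p y\<bar> \<le> B * b"
    "\<forall>x y b. (\<forall>i\<in>V. \<bar>x i\<bar> \<le> R) \<longrightarrow> (\<forall>i\<in>V. \<bar>y i\<bar> \<le> R) \<longrightarrow> 0 \<le> b \<longrightarrow> (\<forall>i\<in>V. \<bar>x i - y i\<bar> \<le> b) \<longrightarrow> \<bar>q x - q y\<bar> \<le> C * b"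
    by blast
  show ?case
  proof (intro exI[of _ "B + C"] conjI allI impI)
    fix x y b assume a: "\<forall>i\<in>V. \<bar>x i\<bar> \<le> R" "\<forall>i\<in>V. \<bar>y i\<bar> \<le> R" "0 \<le> b" "\<forall>i\<in>V. \<bar>x i - y i\<bar> \<le> b"
    have "\<bar>p x - p y\<bar> \<le> B * b" "\<bar>q x - q y\<bar> \<le> C * b" using * a by blast+
    then show "\<bar>p x + q x - (p y + q y)\<bar> \<le> (B + C) * b" by (simp add: distrib_right)
  qed (use * in auto)
next
  case (mult p q)
  then obtain B C where *: "B \<ge> 0" "C \<ge> 0" 
    "\<forall>x y b. (\<forall>i\<in>V. \<bar>x i\<bar> \<le> R) \<longrightarrow> (\<forall>i\<in>V. \<bar>y i\<bar> \<le> R) \<longrightarrow> 0 \<le> b \<longrightarrow> (\<forall>i\<in>V. \<bar>x i - y i\<bar> \<le> b) \<longrightarrow> \<bar>p x - p y\<bar> \<le> B * b"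
    "\<forall>x y b. (\<forall>i\<in>V. \<bar>x i\<bar> \<le> R) \<longrightarrow> (\<forall>i\<in>V. \<bar>y i\<bar> \<le> R) \<longrightarrow> 0 \<le> b \<longrightarrow> (\<forall>i\<in>V. \<bar>x i - y i\<bar> \<le> b) \<longrightarrow> \<bar>q x - q y\<bar> \<le> C * b"
    by blast
  obtain P Q where PQ: "P \<ge> 0" "Q \<ge> 0" "\<forall>x. (\<forall>i\<in>V. \<bar>x i\<bar> \<le> R) \<longrightarrow> \<bar>p x\<bar> \<le> P"
    "\<forall>x. (\<forall>i\<in>V. \<bar>x i\<bar> \<le> R) \<longrightarrow> \<bar>q x\<bar> \<le> Q"
    using polys_bounded[OF mult.hyps(1)] polys_bounded[OF mult.hyps(2)] by blast
  show ?case
  proof (intro exI[of _ "P * C + B * Q"] conjI allI impI)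
    fix x y b assume a: "\<forall>i\<in>V. \<bar>x i\<bar> \<le> R" "\<forall>i\<in>V. \<bar>y i\<bar> \<le> R" "0 \<le> b" "\<forall>i\<in>V. \<bar>x i - y i\<bar> \<le> b"
    have 1: "\<bar>p x - p y\<bar> \<le> B * b" "\<bar>q x - q y\<bar> \<le> C * b" using * a by blast+
    have 2: "\<bar>p x\<bar> \<le> P" "\<bar>q y\<bar> \<le> Q" using PQ a by blast+
    have "p x * q x - p y * q y = p x * (q x - q y) + (p x - p y) * q y" by (simp add: algebra_simps)
    also have "\<bar>\<dots>\<bar> \<le> \<bar>p x\<bar> * \<bar>q x - q y\<bar> + \<bar>p x - p y\<bar> * \<bar>q y\<bar>"
      by (metis abs_mult abs_triangle_ineq)
    also have "\<dots> \<le> P * (C * b) + (B * b) * Q"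
      using 1 2 PQ * a(3) by (intro add_mono mult_mono) auto
    finally show "\<bar>p x * q x - p y * q y\<bar> \<le> (P * C + B * Q) * b" by (simp add: algebra_simps)
  qed (use * PQ in auto)
qed

text \<open>The way in which Weierstrass approximants on an interval become polynomials in the
  state.\<close>

lemma polys_real_poly:
  "real_polynomial_function \<psi> \<Longrightarrow> g \<in> polys V \<Longrightarrow> (\<lambda>x. \<psi> (g x)) \<in> polys V" for \<psi> :: "real \<Rightarrow> real"
proof (induction rule: real_polynomial_function.induct)
  case (linear f)
  then obtain c where "f = (\<lambda>x. x * c)" using real_bounded_linear by auto
  then show ?case using linear by (auto intro: polys.intros)
qed (auto intro: polys.intros)

lemma polys_measurable:
  assumes "p \<in> polys V"
  shows "p \<in> borel_measurable (PiM V (\<lambda>_. lborel))"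
  using assms by induction auto

section \<open>Polynomials in time and state\<close>

inductive_set tpolys :: "nat set \<Rightarrow> (real \<Rightarrow> (nat \<Rightarrow> real) \<Rightarrow> real) set" for V where
  const: "(\<lambda>t x. c) \<in> tpolys V"
| time: "(\<lambda>t x. t) \<in> tpolys V"
| var: "i \<in> V \<Longrightarrow> (\<lambda>t x. x i) \<in> tpolys V"
| add: "p \<in> tpolys V \<Longrightarrow> q \<in> tpolys V \<Longrightarrow> (\<lambda>t x. p t x + q t x) \<in> tpolys V"
| mult: "p \<in> tpolys V \<Longrightarrow> q \<in> tpolys V \<Longrightarrow> (\<lambda>t x. p t x * q t x) \<in> tpolys V"

lemma tpolys_sum:
  "finite I \<Longrightarrow> (\<And>i. i \<in> I \<Longrightarrow> p i \<in> tpolys V) \<Longrightarrow> (\<lambda>t x. \<Sum>i\<in>I. p i t x) \<in> tpolys V"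
  by (induction I rule: finite_induct) (auto intro: tpolys.intros)

lemma tpolys_power: "p \<in> tpolys V \<Longrightarrow> (\<lambda>t x. p t x ^ k) \<in> tpolys V"
  by (induction k) (auto intro: tpolys.intros)

lemma tpolys_uminus: "p \<in> tpolys V \<Longrightarrow> (\<lambda>t x. - p t x) \<in> tpolys V"
  using tpolys.mult[OF tpolys.const[of "-1"]] by simp

lemma tpolys_diff: "p \<in> tpolys V \<Longrightarrow> q \<in> tpolys V \<Longrightarrow> (\<lambda>t x. p t x - q t x) \<in> tpolys V"
  using tpolys.add[OF _ tpolys_uminus] by simp

lemma tpolys_of_polys: "p \<in> polys V \<Longrightarrow> (\<lambda>t x. p x) \<in> tpolys V"
  by (induction rule: polys.induct) (auto intro: tpolys.intros)

lemma tpolys_comp: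
  "p \<in> polys V \<Longrightarrow> (\<And>i. i \<in> V \<Longrightarrow> q i \<in> tpolys W) \<Longrightarrow> (\<lambda>t x. p (\<lambda>i. q i t x)) \<in> tpolys W"
  by (induction rule: polys.induct) (auto intro: tpolys.intros)

lemma tpolys_time_comp:
  "p \<in> tpolys V \<Longrightarrow> s \<in> tpolys V \<Longrightarrow> (\<lambda>t x. p (s t x) x) \<in> tpolys V"
  by (induction rule: tpolys.induct) (auto intro: tpolys.intros)

lemma tpolys_at: "p \<in> tpolys V \<Longrightarrow> p t \<in> polys V"
  by (induction rule: tpolys.induct) (auto intro: polys.intros)

lemma tpoly_on_mono: "tpoly_on V d p \<Longrightarrow> d \<le> e \<Longrightarrow> tpoly_on V e p"
  unfolding tpoly_on_def by (fastforce elim!: ex_forward)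

lemma tpoly_on_monom:
  assumes "finite (supp \<alpha>)" "supp \<alpha> \<subseteq> V" "a + mdeg \<alpha> \<le> d"
  shows "tpoly_on V d (\<lambda>t x. c * t ^ a * mono \<alpha> x)"
  unfolding tpoly_on_def using assms by (intro exI[of _ "{(a, \<alpha>)}"] exI[of _ "\<lambda>_. c"]) auto

lemma tpoly_on_add:
  assumes "tpoly_on V d p" "tpoly_on V d q"
  shows "tpoly_on V d (\<lambda>t x. p t x + q t x)"
proof -
  obtain A c where A: "finite A" "\<forall>(a,\<alpha>)\<in>A. finite (supp \<alpha>) \<and> supp \<alpha> \<subseteq> V \<and> a + mdeg \<alpha> \<le> d"
    "\<And>t x. p t x = (\<Sum>(a,\<alpha>)\<in>A. c (a,\<alpha>) * t ^ a * mono \<alpha> x)" using assms(1) unfolding tpoly_on_def by blast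
  obtain B e where B: "finite B" "\<forall>(a,\<alpha>)\<in>B. finite (supp \<alpha>) \<and> supp \<alpha> \<subseteq> V \<and> a + mdeg \<alpha> \<le> d"
    "\<And>t x. q t x = (\<Sum>(a,\<alpha>)\<in>B. e (a,\<alpha>) * t ^ a * mono \<alpha> x)" using assms(2) unfolding tpoly_on_def by blast
  have "p t x + q t x = (\<Sum>z\<in>A \<union> B. ((if z \<in> A then c z else 0) + (if z \<in> B then e z else 0)) *
      (t ^ fst z * mono (snd z) x))" for t x
    unfolding sum_restrict_Un[OF A(1) B(1)] by (simp add: A(3) B(3) case_prod_unfold mult.assoc)
  then show ?thesis unfolding tpoly_on_def
    by (intro exI[of _ "A \<union> B"] exI[of _ "\<lambda>z. (if z \<in> A then c z else 0) + (if z \<in> B then e z else 0)"])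
      (use A(1,2) B(1,2) in \<open>auto simp only: case_prod_unfold mult.assoc prod.collapse finite_Un\<close>)
qed

lemma tpoly_on_sum:
  assumes "finite I" "\<And>i. i \<in> I \<Longrightarrow> tpoly_on V d (p i)"
  shows "tpoly_on V d (\<lambda>t x. \<Sum>i\<in>I. p i t x)"
  using assms
proof (induction I rule: finite_induct)
  case empty
  show ?case unfolding tpoly_on_def by (rule exI[of _ "{}"]) auto
next
  case (insert i I)
  then show ?case by (simp add: tpoly_on_add)
qed

lemma tpoly_on_mult:
  assumes "tpoly_on V d p" "tpoly_on V e q"
  shows "tpoly_on V (d + e) (\<lambda>t x. p t x * q t x)"
proof -
  obtain A c where A: "finite A" "\<forall>(a,\<alpha>)\<in>A. finite (supp \<alpha>) \<and> supp \<alpha> \<subseteq> V \<and> a + mdeg \<alpha> \<le> d"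
    "\<And>t x. p t x = (\<Sum>(a,\<alpha>)\<in>A. c (a,\<alpha>) * t ^ a * mono \<alpha> x)" using assms(1) unfolding tpoly_on_def by blast
  obtain B k where B: "finite B" "\<forall>(a,\<alpha>)\<in>B. finite (supp \<alpha>) \<and> supp \<alpha> \<subseteq> V \<and> a + mdeg \<alpha> \<le> e"
    "\<And>t x. q t x = (\<Sum>(a,\<alpha>)\<in>B. k (a,\<alpha>) * t ^ a * mono \<alpha> x)" using assms(2) unfolding tpoly_on_def by blast
  have AB: "z \<in> A \<Longrightarrow> finite (supp (snd z)) \<and> supp (snd z) \<subseteq> V \<and> fst z + mdeg (snd z) \<le> d"
    "z \<in> B \<Longrightarrow> finite (supp (snd z)) \<and> supp (snd z) \<subseteq> V \<and> fst z + mdeg (snd z) \<le> e" for z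
    using A(2) B(2) by (auto simp: case_prod_unfold)
  have "(\<lambda>t x. p t x * q t x) = (\<lambda>t x. \<Sum>z\<in>A. \<Sum>u\<in>B. (c z * k u) * t ^ (fst z + fst u) *
      mono (\<lambda>i. snd z i + snd u i) x)"
  proof (intro ext)
    fix t x
    have "p t x * q t x = (\<Sum>z\<in>A. \<Sum>u\<in>B. (c z * t ^ fst z * mono (snd z) x) * (k u * t ^ fst u * mono (snd u) x))"
      by (simp add: A(3) B(3) sum_product case_prod_unfold)
    also have "\<dots> = (\<Sum>z\<in>A. \<Sum>u\<in>B. (c z * k u) * t ^ (fst z + fst u) * mono (\<lambda>i. snd z i + snd u i) x)"
      using AB by (intro sum.cong refl) (simp add: mono_mult[symmetric] power_add mult_ac)
    finally show "p t x * q t x = \<dots>" .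
  qed
  moreover have "tpoly_on V (d + e) \<dots>"
    by (intro tpoly_on_sum tpoly_on_monom A(1) B(1)) (use AB in \<open>fastforce simp: supp_add mdeg_add\<close>)+
  ultimately show ?thesis by simp
qed

lemma tpolys_iff: "p \<in> tpolys V \<longleftrightarrow> (\<exists>d. tpoly_on V d p)"
proof
  show "\<exists>d. tpoly_on V d p" if "p \<in> tpolys V" using that
  proof induction
    case (const c)
    show ?case using tpoly_on_monom[of "\<lambda>_. 0" V 0 0 c] by (auto simp: mono_zero supp_zero mdeg_zero)
  next
    case time
    show ?case using tpoly_on_monom[of "\<lambda>_. 0" V 1 1 1] by (auto simp: mono_zero supp_zero mdeg_zero)
  next
    case (var i)
    then show ?case using tpoly_on_monom[of "\<lambda>j. if j = i then 1 else 0" V 0 1 1]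
      by (auto simp: mono_def mdeg_def supp_single)
  next
    case (add p q)
    then obtain d e where "tpoly_on V d p" "tpoly_on V e q" by blast
    then have "tpoly_on V (max d e) (\<lambda>t x. p t x + q t x)"
      by (intro tpoly_on_add) (auto elim: tpoly_on_mono)
    then show ?case by blast
  next
    case (mult p q)
    then show ?case using tpoly_on_mult by blast
  qed
  assume "\<exists>d. tpoly_on V d p"
  then obtain A c where "finite A" "\<And>z. z \<in> A \<Longrightarrow> finite (supp (snd z)) \<and> supp (snd z) \<subseteq> V"
    and p: "p = (\<lambda>t x. \<Sum>z\<in>A. c z * t ^ fst z * mono (snd z) x)"
    unfolding tpoly_on_def fun_eq_iff case_prod_unfold
    by (simp only: prod.collapse) blast
  then show "p \<in> tpolys V" unfolding p
    by (intro tpolys_sum tpolys.mult tpolys.const tpolys_power tpolys.time tpolys_of_polys)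
      (auto intro: mono_in_polys)
qed

text \<open>The representation holds for every \<open>t\<close>, and at \<open>t = 0\<close> only
  the terms with time exponent 0 survive; they form a time-free representation of no larger degree.
  Facts proved for \<open>tpoly_on\<close> thereby pass to \<open>poly_on\<close>.\<close>

lemma poly_on_of_tpoly_on:
  assumes "tpoly_on V d (\<lambda>t. p)"
  shows "poly_on V d p"
proof -
  obtain A c where A: "finite A" "\<forall>(a,\<alpha>)\<in>A. finite (supp \<alpha>) \<and> supp \<alpha> \<subseteq> V \<and> a + mdeg \<alpha> \<le> d"
    and p: "\<And>t x. p x = (\<Sum>(a,\<alpha>)\<in>A. c (a,\<alpha>) * t ^ a * mono \<alpha> x)"
    using assms unfolding tpoly_on_def by blast
  let ?B = "{z \<in> A. fst z = 0}"
  have "p x = (\<Sum>\<alpha>\<in>snd ` ?B. c (0, \<alpha>) * mono \<alpha> x)" for x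
  proof -
    have "p x = (\<Sum>z\<in>A. c z * 0 ^ fst z * mono (snd z) x)" using p[of x 0] by (simp add: case_prod_unfold)
    also have "\<dots> = (\<Sum>z\<in>?B. c z * 0 ^ fst z * mono (snd z) x)"
      using A(1) by (intro sum.mono_neutral_right) auto
    also have "\<dots> = (\<Sum>z\<in>?B. c (0, snd z) * mono (snd z) x)" by (intro sum.cong) auto
    also have "\<dots> = (\<Sum>\<alpha>\<in>snd ` ?B. c (0, \<alpha>) * mono \<alpha> x)"
      by (subst sum.reindex) (auto simp: inj_on_def prod_eq_iff)
    finally show ?thesis .
  qed
  then show ?thesis unfolding poly_on_def
    by (intro exI[of _ "snd ` ?B"] exI[of _ "\<lambda>\<alpha>. c (0, \<alpha>)"]) (use A in fastforce)
qed

lemma polys_iff: "p \<in> polys V \<longleftrightarrow> (\<exists>d. poly_on V d p)"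
proof
  show "\<exists>d. poly_on V d p" if "p \<in> polys V"
    using tpolys_of_polys[OF that] poly_on_of_tpoly_on unfolding tpolys_iff by blast
  assume "\<exists>d. poly_on V d p"
  then obtain A c where "finite A" "\<forall>\<alpha>\<in>A. finite (supp \<alpha>) \<and> supp \<alpha> \<subseteq> V"
    and p: "p = (\<lambda>x. \<Sum>\<alpha>\<in>A. c \<alpha> * mono \<alpha> x)" unfolding poly_on_def fun_eq_iff by blast
  then show "p \<in> polys V" unfolding p
    by (intro polys_sum polys.mult polys.const) (auto intro: mono_in_polys)
qed

text \<open>Termwise integration in time, normalised to vanish at time 0. It keeps Picard iterates
  and time integrals of penalties among the polynomials.\<close>

lemma tpolys_antiderivative:
  assumes "q \<in> tpolys V"
  shows "\<exists>Q\<in>tpolys V. (\<forall>x. Q 0 x = 0) \<and> (\<forall>t x. ((\<lambda>s. Q s x) has_real_derivative q t x) (at t))"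
proof -
  obtain A c where A: "finite A" "\<And>z. z \<in> A \<Longrightarrow> finite (supp (snd z)) \<and> supp (snd z) \<subseteq> V"
    and q: "q = (\<lambda>t x. \<Sum>z\<in>A. c z * t ^ fst z * mono (snd z) x)"
    using assms unfolding tpolys_iff tpoly_on_def fun_eq_iff case_prod_unfold
    by (simp only: prod.collapse) blast
  let ?Q = "\<lambda>t x. \<Sum>z\<in>A. c z / real (Suc (fst z)) * t ^ Suc (fst z) * mono (snd z) x"
  have "?Q \<in> tpolys V" using A
    by (intro tpolys_sum tpolys.mult tpolys.const tpolys_power tpolys.time tpolys_of_polys)
      (auto intro: mono_in_polys)
  moreover have "((\<lambda>s. ?Q s x) has_real_derivative q t x) (at t)" for t x
  proof -
    have "((\<lambda>s. c z / real (Suc (fst z)) * s ^ Suc (fst z) * mono (snd z) x)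
        has_real_derivative c z * t ^ fst z * mono (snd z) x) (at t)" for z
    proof -
      have "((\<lambda>s. s ^ Suc (fst z)) has_real_derivative real (Suc (fst z)) * t ^ fst z) (at t)"
        using DERIV_pow[of "Suc (fst z)" t] by simp
      then have "((\<lambda>s. (c z / real (Suc (fst z)) * mono (snd z) x) * s ^ Suc (fst z)) has_real_derivative
        (c z / real (Suc (fst z)) * mono (snd z) x) * (real (Suc (fst z)) * t ^ fst z)) (at t)"
        by (rule DERIV_cmult)
      then show ?thesis by (simp add: mult_ac del: of_nat_Suc power_Suc)
    qed
    then show ?thesis unfolding q by (intro DERIV_sum) auto
  qed
  ultimately show ?thesis by (intro bexI[of _ ?Q]) auto
qed

section \<open>Putinar's Positivstellensatz\<close>

text \<open>The representation theorem is proved once for an algebra of real functions and used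
  twice: for polynomials in \<open>x\<close> and for polynomials in \<open>(t, x)\<close>.\<close>

locale fun_algebra =
  fixes A :: "('a \<Rightarrow> real) set"
  assumes A_const: "(\<lambda>z. c) \<in> A"
    and A_add: "a \<in> A \<Longrightarrow> b \<in> A \<Longrightarrow> (\<lambda>z. a z + b z) \<in> A"
    and A_mult: "a \<in> A \<Longrightarrow> b \<in> A \<Longrightarrow> (\<lambda>z. a z * b z) \<in> A"
begin

lemma A_uminus: "a \<in> A \<Longrightarrow> (\<lambda>z. - a z) \<in> A"
  using A_mult[OF A_const[of "-1"]] by simp

lemma A_diff: "a \<in> A \<Longrightarrow> b \<in> A \<Longrightarrow> (\<lambda>z. a z - b z) \<in> A"
  using A_add[OF _ A_uminus] by simp

definition quadratic_module :: "('a \<Rightarrow> real) set \<Rightarrow> bool" where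
  "quadratic_module Q \<longleftrightarrow> Q \<subseteq> A \<and> (\<lambda>z. 1) \<in> Q \<and>
     (\<forall>p\<in>Q. \<forall>q\<in>Q. (\<lambda>z. p z + q z) \<in> Q) \<and> (\<forall>a\<in>A. \<forall>q\<in>Q. (\<lambda>z. (a z)\<^sup>2 * q z) \<in> Q)"

text \<open>A stand-in for sums of squares: it contains the squares of \<open>A\<close>, is closed
  under sums and products, and acts on every quadratic module. Defining it by that action avoids
  manipulating lists of squares.\<close>

definition multipliers :: "('a \<Rightarrow> real) set" where
  "multipliers = {s \<in> A. \<forall>Q q. quadratic_module Q \<longrightarrow> q \<in> Q \<longrightarrow> (\<lambda>z. s z * q z) \<in> Q}"

definition adjoin :: "('a \<Rightarrow> real) set \<Rightarrow> ('a \<Rightarrow> real) \<Rightarrow> ('a \<Rightarrow> real) set" where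
  "adjoin Q a = {h. \<exists>q\<in>Q. \<exists>s\<in>multipliers. h = (\<lambda>z. q z + s z * a z)}"

definition archimedean :: "('a \<Rightarrow> real) set \<Rightarrow> bool" where
  "archimedean Q \<longleftrightarrow> (\<forall>a\<in>A. \<exists>c. (\<lambda>z. c - a z) \<in> Q)"

text \<open>A unital ring homomorphism from \<open>A\<close> to the reals, unconstrained outside
  \<open>A\<close>. Compatibility with real scalars follows from the values on constants and
  multiplicativity.\<close>

definition character :: "(('a \<Rightarrow> real) \<Rightarrow> real) \<Rightarrow> bool" where
  "character \<phi> \<longleftrightarrow> (\<forall>c. \<phi> (\<lambda>z. c) = c) \<and>
     (\<forall>a\<in>A. \<forall>b\<in>A. \<phi> (\<lambda>z. a z + b z) = \<phi> a + \<phi> b \<and> \<phi> (\<lambda>z. a z * b z) = \<phi> a * \<phi> b)"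

lemma characterD:
  assumes "character \<phi>"
  shows "\<phi> (\<lambda>z. c) = c" "a \<in> A \<Longrightarrow> b \<in> A \<Longrightarrow> \<phi> (\<lambda>z. a z + b z) = \<phi> a + \<phi> b"
    "a \<in> A \<Longrightarrow> b \<in> A \<Longrightarrow> \<phi> (\<lambda>z. a z * b z) = \<phi> a * \<phi> b"
  using assms unfolding character_def by auto

lemma archimedeanD: "archimedean Q \<Longrightarrow> a \<in> A \<Longrightarrow> \<exists>c. (\<lambda>z. c - a z) \<in> Q"
  by (simp add: archimedean_def)

lemma ext_mem: "f \<in> Q \<Longrightarrow> (\<And>z. f z = g z) \<Longrightarrow> g \<in> Q"
  by (metis ext)

lemma mult_A: "s \<in> multipliers \<Longrightarrow> s \<in> A"
  by (simp add: multipliers_def)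

lemma mult_mem: "quadratic_module Q \<Longrightarrow> s \<in> multipliers \<Longrightarrow> q \<in> Q \<Longrightarrow> (\<lambda>z. s z * q z) \<in> Q"
  by (simp add: multipliers_def)

lemma mult_square: "a \<in> A \<Longrightarrow> (\<lambda>z. (a z)\<^sup>2) \<in> multipliers"
  using A_mult[of a a] by (auto simp: multipliers_def quadratic_module_def power2_eq_square)

lemma mult_const:
  assumes "c \<ge> 0" shows "(\<lambda>z. c) \<in> multipliers"
  using mult_square[OF A_const[of "sqrt c"]] assms by simp

lemma mult_times:
  assumes "s \<in> multipliers" "r \<in> multipliers" shows "(\<lambda>z. s z * r z) \<in> multipliers"
  using assms A_mult by (auto simp: multipliers_def mult.assoc)

context
  fixes Q assumes Q: "quadratic_module Q"
begin

lemma qm_A: "q \<in> Q \<Longrightarrow> q \<in> A"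
  using Q by (auto simp: quadratic_module_def)

lemma qm_add: "p \<in> Q \<Longrightarrow> q \<in> Q \<Longrightarrow> (\<lambda>z. p z + q z) \<in> Q"
  using Q by (auto simp: quadratic_module_def)

lemma qm_square_mult: "a \<in> A \<Longrightarrow> q \<in> Q \<Longrightarrow> (\<lambda>z. (a z)\<^sup>2 * q z) \<in> Q"
  using Q by (auto simp: quadratic_module_def)

lemma qm_one: "(\<lambda>z. 1) \<in> Q"
  using Q by (auto simp: quadratic_module_def)

lemma mult_in: "s \<in> multipliers \<Longrightarrow> s \<in> Q"
  using mult_mem[OF Q _ qm_one] by simp

lemma qm_scale: "c \<ge> 0 \<Longrightarrow> q \<in> Q \<Longrightarrow> (\<lambda>z. c * q z) \<in> Q"
  using mult_mem[OF Q mult_const] by simp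

lemma qm_const: "c \<ge> 0 \<Longrightarrow> (\<lambda>z. c) \<in> Q"
  using qm_scale[OF _ qm_one] by simp

end

lemma mult_add:
  assumes "s \<in> multipliers" "r \<in> multipliers" shows "(\<lambda>z. s z + r z) \<in> multipliers"
proof -
  have "(\<lambda>z. (s z + r z) * q z) \<in> Q" if "quadratic_module Q" "q \<in> Q" for Q q
    using qm_add[OF that(1) mult_mem[OF that(1) assms(1) that(2)] mult_mem[OF that(1) assms(2) that(2)]]
    by (simp add: distrib_right)
  then show ?thesis using assms A_add by (auto simp: multipliers_def)
qed

lemma adjoinI:
  "q \<in> Q \<Longrightarrow> s \<in> multipliers \<Longrightarrow> (\<And>z. h z = q z + s z * a z) \<Longrightarrow> h \<in> adjoin Q a"
  unfolding adjoin_def by blast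

lemma adjoinE:
  assumes "h \<in> adjoin Q a"
  obtains q s where "q \<in> Q" "s \<in> multipliers" "\<And>z. h z = q z + s z * a z"
  using assms unfolding adjoin_def by blast

lemma adjoin_qm:
  assumes Q: "quadratic_module Q" and a: "a \<in> A"
  shows "quadratic_module (adjoin Q a)" "Q \<subseteq> adjoin Q a" "a \<in> adjoin Q a"
proof -
  show sub: "Q \<subseteq> adjoin Q a"
    using adjoinI[OF _ mult_const[of 0]] by auto
  show "a \<in> adjoin Q a"
    by (rule adjoinI[OF qm_const[OF Q, of 0] mult_const[of 1]]) auto
  have "adjoin Q a \<subseteq> A" using a mult_A qm_A[OF Q] A_add A_mult by (auto simp: adjoin_def)
  moreover have "(\<lambda>z. p z + q z) \<in> adjoin Q a" if pq: "p \<in> adjoin Q a" "q \<in> adjoin Q a" for p q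
  proof -
    obtain u s where 1: "u \<in> Q" "s \<in> multipliers" "\<And>z. p z = u z + s z * a z"
      by (rule adjoinE[OF pq(1)]) blast
    obtain v r where 2: "v \<in> Q" "r \<in> multipliers" "\<And>z. q z = v z + r z * a z"
      by (rule adjoinE[OF pq(2)]) blast
    show ?thesis
      by (rule adjoinI[OF qm_add[OF Q 1(1) 2(1)] mult_add[OF 1(2) 2(2)]]) (simp add: 1(3) 2(3) algebra_simps)
  qed
  moreover have "(\<lambda>z. (b z)\<^sup>2 * q z) \<in> adjoin Q a" if b: "b \<in> A" and q: "q \<in> adjoin Q a" for b q
  proof -
    obtain v r where 2: "v \<in> Q" "r \<in> multipliers" "\<And>z. q z = v z + r z * a z"
      by (rule adjoinE[OF q]) blast
    show ?thesis
      by (rule adjoinI[OF qm_square_mult[OF Q b 2(1)] mult_times[OF mult_square[OF b] 2(2)]])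
        (simp add: 2(3) algebra_simps)
  qed
  ultimately show "quadratic_module (adjoin Q a)"
    using sub qm_one[OF Q] by (auto simp: quadratic_module_def)
qed

text \<open>A substitute for dividing \<open>s p \<ge> 1\<close> by \<open>s\<close> in a module
  that need not be closed under products. The archimedean property gives \<open>p + r\<close> in
  \<open>Q\<close> for some \<open>r\<close>, and weighting with \<open>(k - s)^2\<close> lowers
  \<open>r\<close> by \<open>1 / k\<close> at a time until it is negative.\<close>

lemma archimedean_pos_cancel:
  assumes Q: "quadratic_module Q" and arch: "archimedean Q"
    and p: "p \<in> A" and s: "s \<in> multipliers" and sp: "(\<lambda>z. s z * p z - 1) \<in> Q"
  shows "p \<in> Q"
proof -
  obtain c where c: "(\<lambda>z. c - s z) \<in> Q" using archimedeanD[OF arch mult_A[OF s]] by auto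
  obtain d where d: "(\<lambda>z. d - (s z * s z) * p z) \<in> Q"
    using archimedeanD[OF arch A_mult[OF A_mult[OF mult_A[OF s] mult_A[OF s]] p]] by auto
  define k where "k = max 1 (max \<bar>c\<bar> \<bar>d\<bar>)"
  have k: "k \<ge> 1" "2 * k \<ge> c" "k \<ge> d" by (auto simp: k_def)
  have 1: "(\<lambda>z. 2 * k - s z) \<in> Q"
    by (rule ext_mem[OF qm_add[OF Q c qm_const[OF Q, of "2*k - c"]]]) (use k in auto)
  have 2: "(\<lambda>z. k - (s z)\<^sup>2 * p z) \<in> Q"
    by (rule ext_mem[OF qm_add[OF Q d qm_const[OF Q, of "k - d"]]]) (use k in \<open>auto simp: power2_eq_square\<close>)
  have 3: "(\<lambda>z. s z * (2 * k - s z)) \<in> Q"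
    by (rule ext_mem[OF qm_scale[OF Q, of "1 / (2*k)", OF _ qm_add[OF Q
        mult_mem[OF Q s mult_in[OF Q mult_square[OF qm_A[OF Q 1]]]]
        qm_square_mult[OF Q mult_A[OF s] 1]]]])
      (use k in \<open>auto simp: field_simps power2_eq_square\<close>)
  \<comment> \<open>Woermann's trick: an additive slack in the membership of \<open>p\<close> can be lowered by a fixed amount.\<close>
  have step: "(\<lambda>z. p z + (r - 1 / k)) \<in> Q" if r: "r \<ge> 0" "(\<lambda>z. p z + r) \<in> Q" for r
  proof -
    have ks: "(\<lambda>z. k - s z) \<in> A" by (intro A_diff A_const mult_A s)
    have "(\<lambda>z. ((k - s z)\<^sup>2 * (p z + r) + (2 * k) * (s z * p z - 1)) + (r * (s z * (2 * k - s z)) + (k - (s z)\<^sup>2 * p z))) \<in> Q"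
      by (rule qm_add[OF Q qm_add[OF Q qm_square_mult[OF Q ks r(2)] qm_scale[OF Q _ sp]]
          qm_add[OF Q qm_scale[OF Q r(1) 3] 2]]) (use k in auto)
    then have "(\<lambda>z. (1 / k\<^sup>2) * (((k - s z)\<^sup>2 * (p z + r) + (2 * k) * (s z * p z - 1)) + (r * (s z * (2 * k - s z)) + (k - (s z)\<^sup>2 * p z)))) \<in> Q"
      by (intro qm_scale[OF Q]) auto
    then show ?thesis
    proof (rule ext_mem)
      fix z
      have "((k - s z)\<^sup>2 * (p z + r) + (2 * k) * (s z * p z - 1)) + (r * (s z * (2 * k - s z)) + (k - (s z)\<^sup>2 * p z))
        = k\<^sup>2 * (p z + r) - k" by (simp add: algebra_simps power2_eq_square)
      then show "(1 / k\<^sup>2) * (((k - s z)\<^sup>2 * (p z + r) + (2 * k) * (s z * p z - 1)) + (r * (s z * (2 * k - s z)) + (k - (s z)\<^sup>2 * p z)))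
        = p z + (r - 1 / k)" using k by (simp add: field_simps power2_eq_square)
    qed
  qed
  obtain r0 where "(\<lambda>z. r0 - - p z) \<in> Q" using archimedeanD[OF arch A_uminus[OF p]] by auto
  then have r0: "(\<lambda>z. p z + r0) \<in> Q" by (rule ext_mem) auto
  have closed: "p \<in> Q" if r: "(\<lambda>z. p z + r) \<in> Q" "r < 0" for r
    by (rule ext_mem[OF qm_add[OF Q r(1) qm_const[OF Q, of "-r"]]]) (use r in auto)
  \<comment> \<open>Since \<open>step\<close> needs a nonnegative slack, the second disjunct absorbs
    the case in which the slack is already negative.\<close>
  have "(\<lambda>z. p z + (r0 - real j / k)) \<in> Q \<or> p \<in> Q" for j
  proof (induction j)
    case (Suc j)
    show ?case
    proof (cases "p \<in> Q")
      case False
      then have *: "(\<lambda>z. p z + (r0 - real j / k)) \<in> Q" using Suc by simp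
      then have "r0 - real j / k \<ge> 0" using closed[OF *] False by force
      from step[OF this *] have "(\<lambda>z. p z + (r0 - real j / k - 1 / k)) \<in> Q" .
      moreover have "r0 - real j / k - 1 / k = r0 - real (Suc j) / k" by (simp add: add_divide_distrib)
      ultimately show ?thesis by metis
    qed simp
  qed (use r0 in auto)
  moreover obtain j :: nat where j: "real j > r0 * k" using reals_Archimedean2 by blast
  moreover have "r0 - real j / k < 0" using j k by (simp add: field_simps)
  ultimately show ?thesis using closed by blast
qed

text \<open>If neither sign of \<open>a\<close> belongs to \<open>Q\<close>, maximality gives
  \<open>-1 = q1 + s1 a\<close> and \<open>-1 = q2 - s2 a\<close>. Eliminating \<open>a\<close> puts
  \<open>- s1\<close> into \<open>Q\<close>; as \<open>s1\<close> is there too, so is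
  \<open>s1 a\<close>, and then so is \<open>-1\<close>.\<close>

lemma maximal_total:
  assumes Q: "quadratic_module Q" and proper: "(\<lambda>z. -1) \<notin> Q"
    and max: "\<And>P. quadratic_module P \<Longrightarrow> Q \<subseteq> P \<Longrightarrow> (\<lambda>z. -1) \<notin> P \<Longrightarrow> P = Q"
    and a: "a \<in> A"
  shows "a \<in> Q \<or> (\<lambda>z. - a z) \<in> Q"
proof (rule ccontr)
  assume "\<not> ?thesis"
  then have n: "a \<notin> Q" "(\<lambda>z. - a z) \<notin> Q" by auto
  have "(\<lambda>z. -1) \<in> adjoin Q a" using max adjoin_qm[OF Q a] n(1) by blast
  then obtain q1 s1 where 1: "q1 \<in> Q" "s1 \<in> multipliers" "\<And>z. -1 = q1 z + s1 z * a z"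
    by (rule adjoinE) blast
  have "(\<lambda>z. -1) \<in> adjoin Q (\<lambda>z. - a z)" using max adjoin_qm[OF Q A_uminus[OF a]] n(2) by blast
  then obtain q2 s2 where 2: "q2 \<in> Q" "s2 \<in> multipliers" "\<And>z. -1 = q2 z + s2 z * - a z"
    by (rule adjoinE) blast
  \<comment> \<open>Cross-multiplying the two relations gives
    \<open>- s1 = s2 + s2 q1 + s1 q2\<close>.\<close>
  have neg: "(\<lambda>z. - s1 z) \<in> Q"
  proof (rule ext_mem[OF qm_add[OF Q qm_add[OF Q mult_in[OF Q 2(2)] mult_mem[OF Q 2(2) 1(1)]] mult_mem[OF Q 1(2) 2(1)]]])
    fix z
    have "s2 z * (s1 z * a z) = s1 z * (s2 z * a z)" by simp
    moreover have "s1 z * a z = -1 - q1 z" "s2 z * a z = 1 + q2 z" using 1(3)[of z] 2(3)[of z] by auto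
    ultimately have "s2 z * (-1 - q1 z) = s1 z * (1 + q2 z)" by simp
    then show "s2 z + s2 z * q1 z + s1 z * q2 z = - s1 z" by (simp add: algebra_simps)
  qed
  \<comment> \<open>Polarization \<open>4 a = (a + 1)^2 - (a - 1)^2\<close>, with the minus sign
    carried by \<open>- s1\<close>.\<close>
  have "(\<lambda>z. (1/4) * ((a z + 1)\<^sup>2 * s1 z + (a z - 1)\<^sup>2 * - s1 z)) \<in> Q"
    by (intro qm_scale[OF Q] qm_add[OF Q] qm_square_mult[OF Q] neg mult_in[OF Q] 1(2) A_add A_diff A_const a) auto
  then have "(\<lambda>z. s1 z * a z) \<in> Q" by (rule ext_mem) (simp add: power2_eq_square algebra_simps)
  from qm_add[OF Q 1(1) this] have "(\<lambda>z. -1) \<in> Q" using 1(3) by simp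
  then show False using proper by simp
qed

text \<open>\<open>\<phi> a\<close> is the Dedekind cut of all \<open>r\<close> with
  \<open>a - r\<close> in \<open>Q\<close>: the archimedean property bounds it, and totality makes
  its two sides meet. Additivity is read off the cuts. Multiplicativity is reduced to squares by
  polarization, and then to squares of elements of value 0 by subtracting the value.\<close>

lemma character_of_total:
  assumes Q: "quadratic_module Q" and arch: "archimedean Q" and proper: "(\<lambda>z. -1) \<notin> Q"
    and total: "\<And>a. a \<in> A \<Longrightarrow> a \<in> Q \<or> (\<lambda>z. - a z) \<in> Q"
  shows "\<exists>\<phi>. character \<phi> \<and> (\<forall>q\<in>Q. 0 \<le> \<phi> q)"
proof -
  define \<phi> where "\<phi> a = Sup {r. (\<lambda>z. a z - r) \<in> Q}" for a
  have nonneg: "c \<ge> 0" if "(\<lambda>z. c) \<in> Q" for c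
  proof (rule ccontr)
    assume "\<not> c \<ge> 0"
    then have "(\<lambda>z. (-1/c) * c) \<in> Q" by (intro qm_scale[OF Q] that) (auto simp: divide_simps)
    with proper \<open>\<not> c \<ge> 0\<close> show False by simp
  qed
  have bdd: "\<exists>c. \<forall>r. (\<lambda>z. a z - r) \<in> Q \<longrightarrow> r \<le> c" if "a \<in> A" for a
  proof -
    obtain c where c: "(\<lambda>z. c - a z) \<in> Q" using archimedeanD[OF arch \<open>a \<in> A\<close>] by auto
    have "r \<le> c" if "(\<lambda>z. a z - r) \<in> Q" for r
      using nonneg[of "c - r"] ext_mem[OF qm_add[OF Q c that], of "\<lambda>z. c - r"] by simp
    then show ?thesis by blast
  qed
  have ne: "\<exists>r. (\<lambda>z. a z - r) \<in> Q" if a: "a \<in> A" for a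
  proof -
    obtain c where c: "(\<lambda>z. c - - a z) \<in> Q" using archimedeanD[OF arch A_uminus[OF a]] by auto
    have "(\<lambda>z. a z - (-c)) \<in> Q" by (rule ext_mem[OF c]) simp
    then show ?thesis ..
  qed
  have low: "(\<lambda>z. a z - r) \<in> Q" if ar: "a \<in> A" "r < \<phi> a" for a r
  proof -
    obtain r' where r': "r < r'" "(\<lambda>z. a z - r') \<in> Q"
      using ar(2) less_cSupD[of "{r. (\<lambda>z. a z - r) \<in> Q}"] ne[OF ar(1)] unfolding \<phi>_def by blast
    show ?thesis by (rule ext_mem[OF qm_add[OF Q r'(2) qm_const[OF Q, of "r' - r"]]]) (use r' in auto)
  qed
  have le: "r \<le> \<phi> a" if "a \<in> A" "(\<lambda>z. a z - r) \<in> Q" for a r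
    unfolding \<phi>_def using that bdd[OF that(1)] by (intro cSup_upper) (auto simp: bdd_above_def)
  have up: "(\<lambda>z. r - a z) \<in> Q" if "a \<in> A" "\<phi> a < r" for a r
  proof -
    have "(\<lambda>z. a z - r) \<notin> Q" using le[OF that(1), of r] that(2) by auto
    then have "(\<lambda>z. - (a z - r)) \<in> Q" using total[OF A_diff[OF that(1) A_const]] by blast
    then show ?thesis by simp
  qed
  have ge: "\<phi> a \<le> r" if "a \<in> A" "(\<lambda>z. r - a z) \<in> Q" for a r
  proof (rule ccontr)
    assume "\<not> ?thesis"
    then obtain r' where r': "r < r'" "r' < \<phi> a" using dense[of r "\<phi> a"] by auto
    show False
      using nonneg[of "r - r'"] ext_mem[OF qm_add[OF Q low[OF that(1) r'(2)] that(2)], of "\<lambda>z. r - r'"] r' by simp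
  qed
  have phi_const: "\<phi> (\<lambda>z. c) = c" for c
    using le[OF A_const[of c], of c] ge[OF A_const[of c], of c] qm_const[OF Q, of 0] by simp
  have phi_nonneg: "0 \<le> \<phi> q" if "q \<in> Q" for q
    using le[of q 0] that qm_A[OF Q that] by simp
  have phi_add: "\<phi> (\<lambda>z. a z + b z) = \<phi> a + \<phi> b" if ab: "a \<in> A" "b \<in> A" for a b
  proof (rule antisym)
    show "\<phi> (\<lambda>z. a z + b z) \<le> \<phi> a + \<phi> b"
    proof (rule field_le_epsilon)
      fix e :: real assume "e > 0"
      then show "\<phi> (\<lambda>z. a z + b z) \<le> \<phi> a + \<phi> b + e"
        by (intro ge A_add ab ext_mem[OF qm_add[OF Q up[OF ab(1), of "\<phi> a + e/2"] up[OF ab(2), of "\<phi> b + e/2"]]]) auto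
    qed
    show "\<phi> a + \<phi> b \<le> \<phi> (\<lambda>z. a z + b z)"
    proof (rule field_le_epsilon)
      fix e :: real assume "e > 0"
      then have "\<phi> a + \<phi> b - e \<le> \<phi> (\<lambda>z. a z + b z)"
        by (intro le A_add ab ext_mem[OF qm_add[OF Q low[OF ab(1), of "\<phi> a - e/2"] low[OF ab(2), of "\<phi> b - e/2"]]]) auto
      then show "\<phi> a + \<phi> b \<le> \<phi> (\<lambda>z. a z + b z) + e" by simp
    qed
  qed
  have phi_uminus: "\<phi> (\<lambda>z. - a z) = - \<phi> a" if "a \<in> A" for a
    using phi_add[OF that A_uminus[OF that]] phi_const[of 0] by simp
  have phi_sq0: "\<phi> (\<lambda>z. b z * b z) = 0" if b: "b \<in> A" "\<phi> b = 0" for b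
  proof (rule antisym)
    show "\<phi> (\<lambda>z. b z * b z) \<le> 0"
    proof (rule field_le_epsilon)
      fix e0 :: real assume "e0 > 0"
      \<comment> \<open>The cap at 1 keeps \<open>4 - 2 e\<close> positive and gives
        \<open>2 e / (4 - 2 e) \<le> e\<close>.\<close>
      define e where "e = min e0 1"
      have e: "0 < e" "e \<le> 1" "e \<le> e0" using \<open>e0 > 0\<close> by (auto simp: e_def)
      have "(\<lambda>z. e - b z) \<in> Q" "(\<lambda>z. b z - (-e)) \<in> Q" using low[of b "-e"] up[of b e] b e by auto
      then have "(\<lambda>z. (1 / (4 - 2 * e)) * ((1 - b z)\<^sup>2 * (b z - (-e)) + (1 + b z)\<^sup>2 * (e - b z))) \<in> Q"
        using e by (intro qm_scale[OF Q] qm_add[OF Q] qm_square_mult[OF Q] A_add A_diff A_const b) auto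
      then have "(\<lambda>z. 2 * e / (4 - 2 * e) - b z * b z) \<in> Q"
      proof (rule ext_mem)
        fix z
        have "(1 - b z)\<^sup>2 * (b z - (-e)) + (1 + b z)\<^sup>2 * (e - b z) = 2 * e - (4 - 2 * e) * (b z * b z)"
          by (simp add: algebra_simps power2_eq_square)
        then show "(1 / (4 - 2 * e)) * ((1 - b z)\<^sup>2 * (b z - (-e)) + (1 + b z)\<^sup>2 * (e - b z)) =
          2 * e / (4 - 2 * e) - b z * b z" using e by (simp add: diff_divide_distrib)
      qed
      then have "\<phi> (\<lambda>z. b z * b z) \<le> 2 * e / (4 - 2 * e)" by (intro ge A_mult b)
      also have "\<dots> \<le> e"
      proof -
        have "e * e \<le> e * 1" using e by (intro mult_left_mono) auto
        then show ?thesis using e by (simp add: divide_le_eq algebra_simps)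
      qed
      finally show "\<phi> (\<lambda>z. b z * b z) \<le> 0 + e0" using e by simp
    qed
    show "0 \<le> \<phi> (\<lambda>z. b z * b z)"
      by (intro phi_nonneg ext_mem[OF mult_in[OF Q mult_square[OF b(1)]]]) (simp add: power2_eq_square)
  qed
  have scale_pos: "\<phi> (\<lambda>z. c * b z) = 0" if b: "b \<in> A" "\<phi> b = 0" and c: "c > 0" for b c
  proof (rule antisym)
    have cb: "(\<lambda>z. c * b z) \<in> A" by (intro A_mult A_const b)
    show "\<phi> (\<lambda>z. c * b z) \<le> 0"
    proof (rule field_le_epsilon)
      fix e :: real assume "e > 0"
      then have "(\<lambda>z. c * (e / c - b z)) \<in> Q" using b c by (intro qm_scale[OF Q] up) auto
      then have "(\<lambda>z. e - c * b z) \<in> Q" by (rule ext_mem) (use c in \<open>simp add: algebra_simps\<close>)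
      then show "\<phi> (\<lambda>z. c * b z) \<le> 0 + e" using ge[OF cb] by simp
    qed
    show "0 \<le> \<phi> (\<lambda>z. c * b z)"
    proof (rule field_le_epsilon)
      fix e :: real assume "e > 0"
      then have "(\<lambda>z. c * (b z - (- (e / c)))) \<in> Q" using b c by (intro qm_scale[OF Q] low) auto
      then have "(\<lambda>z. c * b z - (-e)) \<in> Q" by (rule ext_mem) (use c in \<open>simp add: algebra_simps\<close>)
      then show "0 \<le> \<phi> (\<lambda>z. c * b z) + e" using le[OF cb, of "-e"] by simp
    qed
  qed
  have scale0: "\<phi> (\<lambda>z. c * b z) = 0" if b: "b \<in> A" "\<phi> b = 0" for b c
  proof (cases c "0 :: real" rule: linorder_cases)
    case less
    then show ?thesis using scale_pos[OF A_uminus[OF b(1)], of "-c"] phi_uminus[OF b(1)] b(2) by simp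
  next
    case equal
    then show ?thesis using phi_const[of 0] by simp
  next
    case greater
    then show ?thesis using scale_pos b by blast
  qed
  have phi_sq: "\<phi> (\<lambda>z. a z * a z) = \<phi> a * \<phi> a" if a: "a \<in> A" for a
  proof -
    define b where "b = (\<lambda>z. a z + - \<phi> a)"
    have b: "b \<in> A" "\<phi> b = 0"
      using phi_add[OF a A_const[of "- \<phi> a"]] phi_const A_add[OF a A_const[of "- \<phi> a"]] by (auto simp: b_def)
    have "(\<lambda>z. a z * a z) = (\<lambda>z. (b z * b z + (2 * \<phi> a) * b z) + \<phi> a * \<phi> a)"
      by (simp add: b_def algebra_simps)
    then have "\<phi> (\<lambda>z. a z * a z) = \<phi> (\<lambda>z. (b z * b z + (2 * \<phi> a) * b z) + \<phi> a * \<phi> a)" by simp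
    also have "\<dots> = \<phi> (\<lambda>z. b z * b z + (2 * \<phi> a) * b z) + \<phi> a * \<phi> a"
      using phi_add[OF A_add[OF A_mult[OF b(1) b(1)] A_mult[OF A_const b(1)]] A_const] phi_const by simp
    also have "\<phi> (\<lambda>z. b z * b z + (2 * \<phi> a) * b z) = 0"
      using phi_add[OF A_mult[OF b(1) b(1)] A_mult[OF A_const b(1)]] phi_sq0[OF b] scale0[OF b] by simp
    finally show ?thesis by simp
  qed
  have phi_mult: "\<phi> (\<lambda>z. a z * b z) = \<phi> a * \<phi> b" if ab: "a \<in> A" "b \<in> A" for a b
  proof -
    have m: "(\<lambda>z. a z * b z) \<in> A" "(\<lambda>z. a z * a z) \<in> A" "(\<lambda>z. b z * b z) \<in> A" "(\<lambda>z. a z + b z) \<in> A"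
      by (intro A_mult A_add ab)+
    have "(\<lambda>z. (a z + b z) * (a z + b z)) = (\<lambda>z. (a z * a z + b z * b z) + (a z * b z + a z * b z))"
      by (simp add: algebra_simps)
    then have "\<phi> (\<lambda>z. (a z + b z) * (a z + b z)) = \<phi> a * \<phi> a + \<phi> b * \<phi> b + 2 * \<phi> (\<lambda>z. a z * b z)"
      using phi_add[OF A_add[OF m(2,3)] A_add[OF m(1) m(1)]] phi_add[OF m(2,3)] phi_add[OF m(1) m(1)]
        phi_sq[OF ab(1)] phi_sq[OF ab(2)] by simp
    moreover have "\<phi> (\<lambda>z. (a z + b z) * (a z + b z)) = (\<phi> a + \<phi> b) * (\<phi> a + \<phi> b)"
      using phi_sq[OF m(4)] phi_add[OF ab] by simp
    ultimately show ?thesis by (simp add: algebra_simps)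
  qed
  show ?thesis
    by (rule exI[of _ \<phi>]) (auto simp: character_def phi_const phi_add phi_mult phi_nonneg)
qed

text \<open>Adjoin \<open>- p\<close> to \<open>M\<close>. If the result contains \<open>-1\<close>,
  cancellation gives \<open>p\<close> in \<open>M\<close>; otherwise Zorn's lemma extends it to a
  maximal proper module, whose character is nonnegative on \<open>M\<close> and on
  \<open>- p\<close>, against \<open>pos\<close>.\<close>

theorem archimedean_representation:
  assumes M: "quadratic_module M" and arch: "archimedean M" and p: "p \<in> A"
    and pos: "\<And>\<phi>. character \<phi> \<Longrightarrow> (\<forall>q\<in>M. 0 \<le> \<phi> q) \<Longrightarrow> 0 < \<phi> p"
  shows "p \<in> M"
proof (rule ccontr)
  assume np: "p \<notin> M"
  define M0 where "M0 = adjoin M (\<lambda>z. - p z)"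
  have M0: "quadratic_module M0" "M \<subseteq> M0" "(\<lambda>z. - p z) \<in> M0"
    unfolding M0_def by (intro adjoin_qm M A_uminus p)+
  have M0p: "(\<lambda>z. -1) \<notin> M0"
  proof
    assume "(\<lambda>z. -1) \<in> M0"
    then obtain q s where q: "q \<in> M" "s \<in> multipliers" "\<And>z. -1 = q z + s z * - p z"
      unfolding M0_def by (rule adjoinE) blast
    have "(\<lambda>z. s z * p z - 1) \<in> M" by (rule ext_mem[OF q(1)]) (use q(3) in \<open>simp add: algebra_simps\<close>)
    then show False using archimedean_pos_cancel[OF M arch p q(2)] np by blast
  qed
  define F where "F = {Q. quadratic_module Q \<and> M0 \<subseteq> Q \<and> (\<lambda>z. -1) \<notin> Q}"
  have "\<exists>Q\<in>F. \<forall>P\<in>F. Q \<subseteq> P \<longrightarrow> P = Q"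
  proof (rule subset_Zorn_nonempty)
    show "F \<noteq> {}" using M0 M0p by (auto simp: F_def)
    fix C assume C: "C \<noteq> {}" "subset.chain F C"
    then have CF: "\<And>Q. Q \<in> C \<Longrightarrow> quadratic_module Q \<and> M0 \<subseteq> Q \<and> (\<lambda>z. -1) \<notin> Q"
      and ch: "\<And>P Q. P \<in> C \<Longrightarrow> Q \<in> C \<Longrightarrow> P \<subseteq> Q \<or> Q \<subseteq> P"
      by (auto simp: F_def subset.chain_def)
    have "(\<lambda>z. f z + g z) \<in> \<Union>C" if fg: "f \<in> \<Union>C" "g \<in> \<Union>C" for f g
    proof -
      obtain P Q where "P \<in> C" "Q \<in> C" "f \<in> P" "g \<in> Q" using fg by blast
      then obtain R where "R \<in> C" "f \<in> R" "g \<in> R" using ch[of P Q] by blast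
      then show ?thesis using qm_add CF by blast
    qed
    moreover have "(\<lambda>z. (a z)\<^sup>2 * f z) \<in> \<Union>C" if "a \<in> A" "f \<in> \<Union>C" for a f
      using that qm_square_mult CF by blast
    moreover have "(\<lambda>z. 1) \<in> \<Union>C" using C(1) CF qm_one by blast
    moreover have "\<Union>C \<subseteq> A" using CF qm_A by blast
    ultimately have "quadratic_module (\<Union>C)" by (auto simp: quadratic_module_def)
    then show "\<Union>C \<in> F" using C(1) CF by (auto simp: F_def)
  qed
  then obtain Q where QF: "Q \<in> F" and mx: "\<And>P. P \<in> F \<Longrightarrow> Q \<subseteq> P \<Longrightarrow> P = Q" by blast
  have Q: "quadratic_module Q" "M0 \<subseteq> Q" "(\<lambda>z. -1) \<notin> Q" using QF by (auto simp: F_def)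
  have "archimedean Q" using arch M0(2) Q(2) by (fastforce simp: archimedean_def)
  moreover have "a \<in> Q \<or> (\<lambda>z. - a z) \<in> Q" if "a \<in> A" for a
    using mx Q(2) by (intro maximal_total[OF Q(1,3) _ that]) (auto simp: F_def)
  ultimately obtain \<phi> where \<phi>: "character \<phi>" "\<forall>q\<in>Q. 0 \<le> \<phi> q"
    using character_of_total[OF Q(1) _ Q(3)] by blast
  have "0 < \<phi> p" using pos \<phi> M0(2) Q(2) by blast
  moreover have "0 \<le> \<phi> (\<lambda>z. - p z)" using \<phi>(2) M0(3) Q(2) by blast
  moreover have "\<phi> (\<lambda>z. p z + - p z) = \<phi> p + \<phi> (\<lambda>z. - p z)" "\<phi> (\<lambda>z. 0) = 0"
    using characterD(2)[OF \<phi>(1) p A_uminus[OF p]] characterD(1)[OF \<phi>(1)] by auto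
  ultimately show False by simp
qed

text \<open>The elements with bounded square form a subalgebra, and a bound on the square bounds the
  element because \<open>(c + 1) / 2 - a = ((c - a^2) + (a - 1)^2) / 2\<close>. The assumption
  \<open>gen\<close> says that \<open>G\<close> generates \<open>A\<close>, in the form of an
  induction principle.\<close>

lemma archimedean_of_generators:
  assumes M: "quadratic_module M" and G: "\<And>g. g \<in> G \<Longrightarrow> g \<in> A \<and> (\<exists>c. (\<lambda>z. c - (g z)\<^sup>2) \<in> M)"
    and gen: "\<And>B. (\<And>c. (\<lambda>z. c) \<in> B) \<Longrightarrow> G \<subseteq> B \<Longrightarrow>
      (\<And>a b. a \<in> B \<Longrightarrow> b \<in> B \<Longrightarrow> (\<lambda>z. a z + b z) \<in> B) \<Longrightarrow>
      (\<And>a b. a \<in> B \<Longrightarrow> b \<in> B \<Longrightarrow> (\<lambda>z. a z * b z) \<in> B) \<Longrightarrow> A \<subseteq> B"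
  shows "archimedean M"
proof -
  define B where "B = {a \<in> A. \<exists>c. (\<lambda>z. c - (a z)\<^sup>2) \<in> M}"
  have lin: "(\<lambda>z. (c + 1) / 2 - a z) \<in> M" if "a \<in> A" "(\<lambda>z. c - (a z)\<^sup>2) \<in> M" for a c
  proof (rule ext_mem)
    show "(\<lambda>z. (1/2) * ((c - (a z)\<^sup>2) + (a z - 1)\<^sup>2)) \<in> M"
      by (intro qm_scale[OF M] qm_add[OF M] mult_in[OF M] mult_square A_diff A_const that) auto
  qed (simp add: power2_eq_square field_simps)
  \<comment> \<open>The product case multiplies a member by the bound, which therefore has to be
    nonnegative.\<close>
  have pos: "\<exists>c\<ge>0. (\<lambda>z. c - (a z)\<^sup>2) \<in> M" if "(\<lambda>z. c - (a z)\<^sup>2) \<in> M" for a c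
  proof (intro exI conjI)
    show "(\<lambda>z. (c + \<bar>c\<bar>) - (a z)\<^sup>2) \<in> M"
      by (rule ext_mem[OF qm_add[OF M that qm_const[OF M, of "\<bar>c\<bar>"]]]) auto
  qed auto
  have "A \<subseteq> B"
  proof (rule gen)
    show "(\<lambda>z. c) \<in> B" for c
      using qm_const[OF M, of 0] A_const by (auto simp: B_def intro!: exI[of _ "c\<^sup>2"])
    show "G \<subseteq> B" using G by (auto simp: B_def)
    show "(\<lambda>z. a z + b z) \<in> B" if ab: "a \<in> B" "b \<in> B" for a b
    proof -
      obtain c d where cd: "(\<lambda>z. c - (a z)\<^sup>2) \<in> M" "(\<lambda>z. d - (b z)\<^sup>2) \<in> M"
        and A: "a \<in> A" "b \<in> A" using ab by (auto simp: B_def)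
      have "(\<lambda>z. (2 * (c - (a z)\<^sup>2) + 2 * (d - (b z)\<^sup>2)) + (a z - b z)\<^sup>2) \<in> M"
        by (intro qm_add[OF M] qm_scale[OF M] cd mult_in[OF M] mult_square A_diff A) auto
      then have "(\<lambda>z. (2 * c + 2 * d) - (a z + b z)\<^sup>2) \<in> M"
        by (rule ext_mem) (simp add: power2_eq_square algebra_simps)
      then show ?thesis using A_add[OF A] by (auto simp: B_def)
    qed
    show "(\<lambda>z. a z * b z) \<in> B" if ab: "a \<in> B" "b \<in> B" for a b
    proof -
      obtain c d where cd: "c \<ge> 0" "(\<lambda>z. c - (a z)\<^sup>2) \<in> M" "(\<lambda>z. d - (b z)\<^sup>2) \<in> M"
        and A: "a \<in> A" "b \<in> A" using ab pos by (auto simp: B_def) blast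
      have "(\<lambda>z. (b z)\<^sup>2 * (c - (a z)\<^sup>2) + c * (d - (b z)\<^sup>2)) \<in> M"
        by (intro qm_add[OF M] qm_scale[OF M] qm_square_mult[OF M] cd A)
      then have "(\<lambda>z. c * d - (a z * b z)\<^sup>2) \<in> M"
        by (rule ext_mem) (simp add: power2_eq_square algebra_simps)
      then show ?thesis using A_mult[OF A] by (auto simp: B_def)
    qed
  qed
  then show ?thesis using lin unfolding archimedean_def B_def by blast
qed

section \<open>Quadratic modules with finitely many generators\<close>

definition sums_of_squares :: "('a \<Rightarrow> real) set" where
  "sums_of_squares = {s. \<exists>qs. set qs \<subseteq> A \<and> (\<forall>z. s z = (\<Sum>q\<leftarrow>qs. (q z)\<^sup>2))}"

text \<open>The shape of \<open>cert\<close> without degrees: one multiplier per position of the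
  list.\<close>

definition generated_module :: "('a \<Rightarrow> real) list \<Rightarrow> ('a \<Rightarrow> real) set" where
  "generated_module gs = {h. \<exists>s0 \<sigma>. s0 \<in> sums_of_squares \<and> (\<forall>i<length gs. \<sigma> i \<in> sums_of_squares) \<and>
     (\<forall>z. h z = s0 z + (\<Sum>i<length gs. \<sigma> i z * (gs!i) z))}"

lemma sos_add:
  assumes "s \<in> sums_of_squares" "r \<in> sums_of_squares"
  shows "(\<lambda>z. s z + r z) \<in> sums_of_squares"
proof -
  obtain ps qs where "set ps \<subseteq> A" "\<And>z. s z = (\<Sum>q\<leftarrow>ps. (q z)\<^sup>2)" "set qs \<subseteq> A" "\<And>z. r z = (\<Sum>q\<leftarrow>qs. (q z)\<^sup>2)"
    using assms unfolding sums_of_squares_def by blast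
  then show ?thesis unfolding sums_of_squares_def by (auto intro!: exI[of _ "ps @ qs"])
qed

lemma sos_const: "c \<ge> 0 \<Longrightarrow> (\<lambda>z. c) \<in> sums_of_squares"
  unfolding sums_of_squares_def using A_const by (auto intro!: exI[of _ "[\<lambda>z. sqrt c]"])

lemma sos_square_mult:
  assumes "a \<in> A" "s \<in> sums_of_squares"
  shows "(\<lambda>z. (a z)\<^sup>2 * s z) \<in> sums_of_squares"
proof -
  obtain ps where ps: "set ps \<subseteq> A" "\<And>z. s z = (\<Sum>q\<leftarrow>ps. (q z)\<^sup>2)"
    using assms unfolding sums_of_squares_def by blast
  have "set (map (\<lambda>q z. a z * q z) ps) \<subseteq> A" using ps(1) A_mult[OF assms(1)] by auto
  then show ?thesis unfolding sums_of_squares_def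
    by (intro CollectI exI[of _ "map (\<lambda>q z. a z * q z) ps"])
      (simp add: ps(2) sum_list_const_mult[symmetric] comp_def power_mult_distrib)
qed

lemma sos_A: "s \<in> sums_of_squares \<Longrightarrow> s \<in> A"
proof -
  assume "s \<in> sums_of_squares"
  then obtain ps where ps: "set ps \<subseteq> A" "s = (\<lambda>z. \<Sum>q\<leftarrow>ps. (q z)\<^sup>2)"
    unfolding sums_of_squares_def fun_eq_iff by blast
  have "(\<lambda>z. \<Sum>q\<leftarrow>ps. (q z)\<^sup>2) \<in> A" using ps(1)
    by (induction ps) (auto intro: A_const A_add A_mult simp: power2_eq_square)
  then show ?thesis using ps by simp
qed

lemma generated_module_qm:
  assumes gs: "set gs \<subseteq> A"
  shows "quadratic_module (generated_module gs)"
  unfolding quadratic_module_def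
proof (intro conjI ballI subsetI)
  fix h assume "h \<in> generated_module gs"
  then obtain s0 \<sigma> where *: "s0 \<in> sums_of_squares" "\<And>i. i < length gs \<Longrightarrow> \<sigma> i \<in> sums_of_squares"
     and h: "h = (\<lambda>z. s0 z + (\<Sum>i<length gs. \<sigma> i z * (gs!i) z))"
    unfolding generated_module_def fun_eq_iff by blast
  have "(\<lambda>z. \<Sum>i<n. \<sigma> i z * (gs!i) z) \<in> A" if "n \<le> length gs" for n using that
  proof (induction n)
    case (Suc n)
    have "\<sigma> n \<in> A" "gs ! n \<in> A" using *(2)[of n] gs sos_A Suc.prems by auto
    then show ?case using Suc by (simp add: A_add A_mult)
  qed (simp add: A_const)
  then show "h \<in> A" unfolding h using sos_A[OF *(1)] by (intro A_add) auto
next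
  show "(\<lambda>z. 1) \<in> generated_module gs" unfolding generated_module_def
    using sos_const[of 1] sos_const[of 0] by (intro CollectI exI[of _ "\<lambda>z. 1"] exI[of _ "\<lambda>i z. 0"]) auto
next
  fix f h assume "f \<in> generated_module gs" "h \<in> generated_module gs"
  then obtain s \<sigma> r \<rho> where *: "s \<in> sums_of_squares" "\<And>i. i < length gs \<Longrightarrow> \<sigma> i \<in> sums_of_squares"
      "r \<in> sums_of_squares" "\<And>i. i < length gs \<Longrightarrow> \<rho> i \<in> sums_of_squares"
     and h: "\<And>z. f z = s z + (\<Sum>i<length gs. \<sigma> i z * (gs!i) z)" "\<And>z. h z = r z + (\<Sum>i<length gs. \<rho> i z * (gs!i) z)"
    unfolding generated_module_def by blast
  show "(\<lambda>z. f z + h z) \<in> generated_module gs" unfolding generated_module_def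
    by (intro CollectI exI[of _ "\<lambda>z. s z + r z"] exI[of _ "\<lambda>i z. \<sigma> i z + \<rho> i z"])
      (use * h in \<open>auto simp: sos_add distrib_right sum.distrib\<close>)
next
  fix a h assume a: "a \<in> A" and "h \<in> generated_module gs"
  then obtain s \<sigma> where *: "s \<in> sums_of_squares" "\<And>i. i < length gs \<Longrightarrow> \<sigma> i \<in> sums_of_squares"
     and h: "\<And>z. h z = s z + (\<Sum>i<length gs. \<sigma> i z * (gs!i) z)"
    unfolding generated_module_def by blast
  show "(\<lambda>z. (a z)\<^sup>2 * h z) \<in> generated_module gs" unfolding generated_module_def
    by (intro CollectI exI[of _ "\<lambda>z. (a z)\<^sup>2 * s z"] exI[of _ "\<lambda>i z. (a z)\<^sup>2 * \<sigma> i z"])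
      (use * a h in \<open>auto simp: sos_square_mult distrib_left sum_distrib_left mult.assoc\<close>)
qed

lemma generators_in_module:
  assumes "g \<in> set gs"
  shows "g \<in> generated_module gs"
proof -
  obtain j where j: "j < length gs" "gs ! j = g" using assms by (auto simp: in_set_conv_nth)
  have "(\<Sum>i<length gs. (if i = j then 1 else 0) * (gs!i) z) = g z" for z
    using j by (simp add: if_distrib[of "\<lambda>c. c * _"] cong: if_cong)
  then show ?thesis unfolding generated_module_def
    using sos_const[of 1] sos_const[of 0]
    by (intro CollectI exI[of _ "\<lambda>z. 0"] exI[of _ "\<lambda>i z. if i = j then 1 else 0"]) auto
qed

text \<open>The other squares are added back to the ball polynomial, which leaves only the square of
  the chosen coordinate.\<close>

lemma square_bound_of_ball:
  assumes Q: "quadratic_module Q" and W: "finite W" "i \<in> W" "\<And>j. j \<in> W \<Longrightarrow> X j \<in> A"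
    and ball: "(\<lambda>z. c - (\<Sum>j\<in>W. (X j z)\<^sup>2)) \<in> Q"
  shows "(\<lambda>z. c - (X i z)\<^sup>2) \<in> Q"
proof -
  have "(\<lambda>z. \<Sum>j\<in>S. (X j z)\<^sup>2) \<in> Q" if "finite S" "S \<subseteq> W" for S using that
  proof (induction S rule: finite_induct)
    case empty
    show ?case using qm_const[OF Q, of 0] by simp
  next
    case (insert j S)
    then show ?case using qm_add[OF Q mult_in[OF Q mult_square[OF W(3)[of j]]]] by simp
  qed
  then have "(\<lambda>z. \<Sum>j\<in>W - {i}. (X j z)\<^sup>2) \<in> Q" using W(1) by blast
  from qm_add[OF Q ball this] show ?thesis
    by (rule ext_mem) (simp add: sum.remove[OF W(1,2)])
qed

theorem positive_representation:
  assumes gs: "set gs \<subseteq> A" and p: "p \<in> A"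
    and G: "\<And>g. g \<in> G \<Longrightarrow> g \<in> A \<and> (\<exists>c. (\<lambda>z. c - (g z)\<^sup>2) \<in> generated_module gs)"
    and gen: "\<And>B. (\<And>c. (\<lambda>z. c) \<in> B) \<Longrightarrow> G \<subseteq> B \<Longrightarrow>
      (\<And>a b. a \<in> B \<Longrightarrow> b \<in> B \<Longrightarrow> (\<lambda>z. a z + b z) \<in> B) \<Longrightarrow>
      (\<And>a b. a \<in> B \<Longrightarrow> b \<in> B \<Longrightarrow> (\<lambda>z. a z * b z) \<in> B) \<Longrightarrow> A \<subseteq> B"
    and pos: "\<And>\<phi>. character \<phi> \<Longrightarrow> (\<forall>g\<in>set gs. 0 \<le> \<phi> g) \<Longrightarrow> 0 < \<phi> p"
  shows "\<exists>s0 \<sigma>. s0 \<in> sums_of_squares \<and> (\<forall>i<length gs. \<sigma> i \<in> sums_of_squares) \<and>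
     (\<forall>z. p z = s0 z + (\<Sum>i<length gs. \<sigma> i z * (gs!i) z))"
proof -
  have M: "quadratic_module (generated_module gs)" by (rule generated_module_qm[OF gs])
  have "archimedean (generated_module gs)" by (rule archimedean_of_generators[OF M G gen])
  then have "p \<in> generated_module gs"
    using pos generators_in_module by (intro archimedean_representation[OF M _ p]) blast+
  then show ?thesis by (simp add: generated_module_def)
qed

end

text \<open>Each coordinate only has to occur in some ball constraint on a set \<open>W\<close> of
  coordinates: the sets in question are products described by one ball per block, not by a single
  ball.\<close>

definition ball_bounded :: "nat set \<Rightarrow> ((nat \<Rightarrow> real) \<Rightarrow> real) list \<Rightarrow> bool" where
  "ball_bounded U gs \<longleftrightarrow> (\<forall>i\<in>U. \<exists>W R. finite W \<and> i \<in> W \<and> W \<subseteq> U \<and> (\<lambda>x. R\<^sup>2 - (\<Sum>i\<in>W. (x i)\<^sup>2)) \<in> set gs)"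

section \<open>Certificates in the state variables\<close>

interpretation polys: fun_algebra "polys U" for U
  by standard (auto intro: polys.intros)

text \<open>A character is determined by its values on the coordinates, and these values are the
  coordinates of the point.\<close>

lemma polys_character:
  assumes "polys.character U \<phi>"
  shows "\<exists>x. \<forall>p\<in>polys U. \<phi> p = p x"
proof -
  define x where "x i = \<phi> (\<lambda>y. y i)" for i
  have "\<phi> p = p x" if "p \<in> polys U" for p
    using that by induction (auto simp: polys.characterD[OF assms] x_def)
  then show ?thesis by blast
qed

text \<open>Degrees are subtracted in the naturals: the square of a polynomial of degree
  \<open>d\<close> fits as soon as \<open>k \<ge> 2 d + c\<close>. The shift \<open>c\<close> is
  used for the degree of the constraint that is multiplied.\<close>

lemma sos_on_eventually:
  assumes "s \<in> polys.sums_of_squares U"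
  shows "\<forall>\<^sub>F k in sequentially. sos_on U (k - c) s"
proof -
  obtain qs where qs: "set qs \<subseteq> polys U" "\<forall>z. s z = (\<Sum>q\<leftarrow>qs. (q z)\<^sup>2)"
    using assms unfolding polys.sums_of_squares_def by blast
  have "\<forall>q\<in>set qs. \<forall>\<^sub>F k in sequentially. poly_on U ((k - c) div 2) q"
  proof
    fix q assume "q \<in> set qs"
    then obtain d where d: "poly_on U d q" using qs(1) polys_iff by blast
    show "\<forall>\<^sub>F k in sequentially. poly_on U ((k - c) div 2) q"
      unfolding eventually_sequentially by (rule exI[of _ "2 * d + c"]) (auto intro: poly_on_mono[OF d])
  qed
  then have "\<forall>\<^sub>F k in sequentially. \<forall>q\<in>set qs. poly_on U ((k - c) div 2) q"
    by (simp add: eventually_ball_finite)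
  then show ?thesis by eventually_elim (use qs(2) in \<open>auto simp: sos_on_def\<close>)
qed

text \<open>The representation is one fixed identity, so it fits every sufficiently large degree.
  The points come from characters and are not extensional; therefore \<open>pos\<close> is stated
  for all \<open>x\<close> and not on \<open>semialg U gs\<close>.\<close>

theorem putinar_cert:
  assumes gs: "set gs \<subseteq> polys U" and ball: "ball_bounded U gs" and p: "p \<in> polys U"
    and pos: "\<And>x. (\<forall>g\<in>set gs. 0 \<le> g x) \<Longrightarrow> 0 < p x"
  shows "\<forall>\<^sub>F k in sequentially. cert U k gs p"
proof -
  have "\<exists>s0 \<sigma>. s0 \<in> polys.sums_of_squares U \<and> (\<forall>i<length gs. \<sigma> i \<in> polys.sums_of_squares U) \<and>
    (\<forall>z. p z = s0 z + (\<Sum>i<length gs. \<sigma> i z * (gs!i) z))"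
  proof (rule polys.positive_representation[OF gs p, of "(\<lambda>i x. x i) ` U"])
    fix g :: "(nat \<Rightarrow> real) \<Rightarrow> real" assume "g \<in> (\<lambda>i x. x i) ` U"
    then obtain i where i: "i \<in> U" "g = (\<lambda>x. x i)" by blast
    obtain W R where W: "finite W" "i \<in> W" "W \<subseteq> U" "(\<lambda>x. R\<^sup>2 - (\<Sum>i\<in>W. (x i)\<^sup>2)) \<in> set gs"
      using ball i(1) by (auto simp: ball_bounded_def)
    have "(\<lambda>x. R\<^sup>2 - (x i)\<^sup>2) \<in> polys.generated_module U gs"
      by (rule polys.square_bound_of_ball[where X = "\<lambda>i x. x i", OF polys.generated_module_qm[OF gs] W(1,2) _
          polys.generators_in_module[OF W(4)]]) (use W(3) in \<open>auto intro: polys.var\<close>)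
    then show "g \<in> polys U \<and> (\<exists>c. (\<lambda>z. c - (g z)\<^sup>2) \<in> polys.generated_module U gs)"
      using i polys.var by blast
  next
    fix B :: "((nat \<Rightarrow> real) \<Rightarrow> real) set"
    assume *: "\<And>c. (\<lambda>z. c) \<in> B" "(\<lambda>i x. x i) ` U \<subseteq> B"
      "\<And>a b. a \<in> B \<Longrightarrow> b \<in> B \<Longrightarrow> (\<lambda>z. a z + b z) \<in> B" "\<And>a b. a \<in> B \<Longrightarrow> b \<in> B \<Longrightarrow> (\<lambda>z. a z * b z) \<in> B"
    have "a \<in> B" if "a \<in> polys U" for a using that by induction (use * in auto)
    then show "polys U \<subseteq> B" by blast
  next
    fix \<phi> assume c: "polys.character U \<phi>" "\<forall>g\<in>set gs. 0 \<le> \<phi> g"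
    obtain x where x: "\<forall>p\<in>polys U. \<phi> p = p x" using polys_character[OF c(1)] by blast
    have "0 \<le> g x" if "g \<in> set gs" for g
    proof -
      have "\<phi> g = g x" using x gs that by blast
      then show ?thesis using c(2) that by force
    qed
    then show "0 < \<phi> p" using pos x p by auto
  qed
  then obtain s0 \<sigma> where s: "s0 \<in> polys.sums_of_squares U" "\<forall>i<length gs. \<sigma> i \<in> polys.sums_of_squares U"
    "\<forall>z. p z = s0 z + (\<Sum>i<length gs. \<sigma> i z * (gs!i) z)" by blast
  have "\<forall>\<^sub>F k in sequentially. sos_on U k s0" using sos_on_eventually[OF s(1), of 0] by simp
  moreover have "\<forall>\<^sub>F k in sequentially. \<forall>i\<in>{..<length gs}. sos_on U (k - pdeg U (gs!i)) (\<sigma> i)"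
    using s(2) by (intro eventually_ball_finite ballI sos_on_eventually) auto
  ultimately show ?thesis
  proof eventually_elim
    case (elim k)
    then show ?case unfolding cert_def
      by (intro exI[of _ s0] exI[of _ "map \<sigma> [0..<length gs]"]) (use s(3) in auto)
  qed
qed

section \<open>Certificates in time and state\<close>

interpretation tpolys: fun_algebra "{\<lambda>z. p (fst z) (snd z) | p. p \<in> tpolys U}" for U
proof
  fix a b :: "real \<times> (nat \<Rightarrow> real) \<Rightarrow> real"
  assume "a \<in> {\<lambda>z. p (fst z) (snd z) | p. p \<in> tpolys U}" "b \<in> {\<lambda>z. p (fst z) (snd z) | p. p \<in> tpolys U}"
  then obtain p q where *: "p \<in> tpolys U" "q \<in> tpolys U" "a = (\<lambda>z. p (fst z) (snd z))" "b = (\<lambda>z. q (fst z) (snd z))"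
    by blast
  show "(\<lambda>z. a z + b z) \<in> {\<lambda>z. p (fst z) (snd z) | p. p \<in> tpolys U}"
    unfolding * using tpolys.add[OF *(1,2)] by (intro CollectI exI conjI) auto
  show "(\<lambda>z. a z * b z) \<in> {\<lambda>z. p (fst z) (snd z) | p. p \<in> tpolys U}"
    unfolding * using tpolys.mult[OF *(1,2)] by (intro CollectI exI conjI) auto
next
  show "(\<lambda>z. c) \<in> {\<lambda>z. p (fst z) (snd z) | p. p \<in> tpolys U}" for c
    using tpolys.const[of c U] by (intro CollectI exI conjI) auto
qed

lemma tpolys_algebraI: "p \<in> tpolys U \<Longrightarrow> (\<lambda>z. p (fst z) (snd z)) \<in> {\<lambda>z. p (fst z) (snd z) | p. p \<in> tpolys U}"
  by blast

text \<open>Uncurrying to functions of a pair turns time into one more generator, so a character is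
  evaluation at a time and a point.\<close>

lemma tpolys_character:
  assumes c: "tpolys.character U \<phi>"
  shows "\<exists>t x. \<forall>p\<in>tpolys U. \<phi> (\<lambda>z. p (fst z) (snd z)) = p t x"
proof -
  define x where "x i = \<phi> (\<lambda>z. snd z i)" for i
  define t where "t = \<phi> fst"
  have "\<phi> (\<lambda>z. p (fst z) (snd z)) = p t x" if "p \<in> tpolys U" for p
    using that
    by induction (auto simp: tpolys.characterD(1)[OF c] tpolys.characterD(2,3)[OF c tpolys_algebraI tpolys_algebraI] x_def t_def)
  then show ?thesis by blast
qed

lemma tsos_on_eventually:
  assumes "s \<in> tpolys.sums_of_squares U"
  shows "\<forall>\<^sub>F k in sequentially. tsos_on U (k - c) (\<lambda>t x. s (t, x))"
proof -
  obtain qs where qs: "set qs \<subseteq> {\<lambda>z. p (fst z) (snd z) | p. p \<in> tpolys U}" "\<forall>z. s z = (\<Sum>q\<leftarrow>qs. (q z)\<^sup>2)"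
    using assms unfolding tpolys.sums_of_squares_def by blast
  have "\<forall>q\<in>set qs. \<forall>\<^sub>F k in sequentially. tpoly_on U ((k - c) div 2) (\<lambda>t x. q (t, x))"
  proof
    fix q assume "q \<in> set qs"
    then obtain p where "p \<in> tpolys U" "q = (\<lambda>z. p (fst z) (snd z))" using qs(1) by blast
    then obtain d where d: "tpoly_on U d (\<lambda>t x. q (t, x))" using tpolys_iff by auto
    show "\<forall>\<^sub>F k in sequentially. tpoly_on U ((k - c) div 2) (\<lambda>t x. q (t, x))"
      unfolding eventually_sequentially by (rule exI[of _ "2 * d + c"]) (auto intro: tpoly_on_mono[OF d])
  qed
  then have "\<forall>\<^sub>F k in sequentially. \<forall>q\<in>set qs. tpoly_on U ((k - c) div 2) (\<lambda>t x. q (t, x))"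
    by (simp add: eventually_ball_finite)
  then show ?thesis
    by eventually_elim (use qs(2) in \<open>auto simp: tsos_on_def comp_def intro!: exI[of _ "map (\<lambda>q t x. q (t, x)) qs"]\<close>)
qed

text \<open>The constraint \<open>t (T - t) \<ge> 0\<close> is put at the head of the generators;
  besides cutting out the time interval it supplies the archimedean bound for the variable
  \<open>t\<close>.\<close>

theorem putinar_tcert:
  assumes T: "T > 0" and gs: "set gs \<subseteq> polys U" and ball: "ball_bounded U gs" and p: "p \<in> tpolys U"
    and pos: "\<And>t x. t \<in> {0..T} \<Longrightarrow> (\<forall>g\<in>set gs. 0 \<le> g x) \<Longrightarrow> 0 < p t x"
  shows "\<forall>\<^sub>F k in sequentially. tcert U k T gs p"
proof -
  let ?A = "{\<lambda>z. p (fst z) (snd z) | p. p \<in> tpolys U}"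
  define hs where "hs = (\<lambda>z. fst z * (T - fst z)) # map (\<lambda>g z. g (snd z)) gs"
  let ?M = "tpolys.generated_module U hs"
  have gA: "(\<lambda>z. g (snd z)) \<in> ?A" if "g \<in> polys U" for g
    using tpolys_algebraI[OF tpolys_of_polys[OF that]] by simp
  have fA: "fst \<in> ?A" using tpolys_algebraI[OF tpolys.time] by simp
  have hs: "set hs \<subseteq> ?A"
    using gA gs unfolding hs_def
    by (simp only: set_simps insert_subset set_map)
      (intro conjI tpolys.A_mult tpolys.A_diff tpolys.A_const fA, blast)
  then have M: "tpolys.quadratic_module U ?M" by (rule tpolys.generated_module_qm)
  have gM: "(\<lambda>z. g (snd z)) \<in> ?M" if "g \<in> set gs" for g
    using that by (intro tpolys.generators_in_module) (auto simp: hs_def)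
  have tM: "(\<lambda>z. fst z * (T - fst z)) \<in> ?M"
    by (intro tpolys.generators_in_module) (auto simp: hs_def)
  have "\<exists>s0 \<sigma>. s0 \<in> tpolys.sums_of_squares U \<and> (\<forall>i<length hs. \<sigma> i \<in> tpolys.sums_of_squares U) \<and>
    (\<forall>z. p (fst z) (snd z) = s0 z + (\<Sum>i<length hs. \<sigma> i z * (hs!i) z))"
  proof (rule tpolys.positive_representation[OF hs tpolys_algebraI[OF p], of "insert fst ((\<lambda>i z. snd z i) ` U)"])
    fix g :: "real \<times> (nat \<Rightarrow> real) \<Rightarrow> real" assume "g \<in> insert fst ((\<lambda>i z. snd z i) ` U)"
    then consider "g = fst" | i where "i \<in> U" "g = (\<lambda>z. snd z i)" by blast
    then show "g \<in> ?A \<and> (\<exists>c. (\<lambda>z. c - (g z)\<^sup>2) \<in> ?M)"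
    proof cases
      case 1
      \<comment> \<open>\<open>2 t (T - t) + (t - T)^2 = T^2 - t^2\<close> bounds the square of the
        time variable.\<close>
      have "(\<lambda>z. 2 * (fst z * (T - fst z)) + (fst z - T)\<^sup>2) \<in> ?M"
        by (intro tpolys.qm_add[OF M] tpolys.qm_scale[OF M] tM tpolys.mult_in[OF M] tpolys.mult_square tpolys.A_diff fA tpolys.A_const) auto
      then have "(\<lambda>z. T\<^sup>2 - (fst z)\<^sup>2) \<in> ?M"
        by (rule tpolys.ext_mem) (simp add: power2_eq_square algebra_simps)
      then show ?thesis using 1 fA by blast
    next
      case (2 i)
      obtain W R where W: "finite W" "i \<in> W" "W \<subseteq> U" "(\<lambda>x. R\<^sup>2 - (\<Sum>i\<in>W. (x i)\<^sup>2)) \<in> set gs"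
        using ball 2(1) by (auto simp: ball_bounded_def)
      have vA: "(\<lambda>z. snd z j) \<in> ?A" if "j \<in> U" for j using gA[OF polys.var[OF that]] by simp
      have "(\<lambda>z. R\<^sup>2 - (snd z i)\<^sup>2) \<in> ?M"
        by (rule tpolys.square_bound_of_ball[where X = "\<lambda>i z. snd z i", OF M W(1,2) _ gM[OF W(4)]])
          (rule vA, use W(3) in blast)
      then show ?thesis using 2 vA by blast
    qed
  next
    fix B :: "(real \<times> (nat \<Rightarrow> real) \<Rightarrow> real) set"
    assume *: "\<And>c. (\<lambda>z. c) \<in> B" "insert fst ((\<lambda>i z. snd z i) ` U) \<subseteq> B"
      "\<And>a b. a \<in> B \<Longrightarrow> b \<in> B \<Longrightarrow> (\<lambda>z. a z + b z) \<in> B" "\<And>a b. a \<in> B \<Longrightarrow> b \<in> B \<Longrightarrow> (\<lambda>z. a z * b z) \<in> B"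
    have "(\<lambda>z. a (fst z) (snd z)) \<in> B" if "a \<in> tpolys U" for a using that by induction (use * in auto)
    then show "?A \<subseteq> B" by blast
  next
    fix \<phi> assume c: "tpolys.character U \<phi>" "\<forall>h\<in>set hs. 0 \<le> \<phi> h"
    obtain t x where x: "\<And>p. p \<in> tpolys U \<Longrightarrow> \<phi> (\<lambda>z. p (fst z) (snd z)) = p t x" using tpolys_character[OF c(1)] by blast
    have "0 \<le> g x" if "g \<in> set gs" for g
    proof -
      have "\<phi> (\<lambda>z. g (snd z)) = g x" using gs that by (intro x tpolys_of_polys) blast
      then show ?thesis using c(2) that by (force simp: hs_def)
    qed
    moreover have "(\<lambda>t x. t * (T - t)) \<in> tpolys U"
      by (intro tpolys.mult tpolys.time tpolys_diff tpolys.const)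
    from x[OF this] have "0 \<le> t * (T - t)" using c(2) by (simp add: hs_def)
    then have "t \<in> {0..T}" using T by (auto simp: zero_le_mult_iff)
    ultimately show "0 < \<phi> (\<lambda>z. p (fst z) (snd z))" using pos x[OF p] by auto
  qed
  then obtain s0 \<sigma> where s: "s0 \<in> tpolys.sums_of_squares U" "\<And>i. i < length hs \<Longrightarrow> \<sigma> i \<in> tpolys.sums_of_squares U"
    "\<And>z. p (fst z) (snd z) = s0 z + (\<Sum>i<length hs. \<sigma> i z * (hs!i) z)" by blast
  have len: "length hs = Suc (length gs)" by (simp add: hs_def)
  \<comment> \<open>Multiplier 0 belongs to \<open>t (T - t)\<close>, so the multiplier of
    \<open>gs ! i\<close> has index \<open>Suc i\<close>.\<close>
  have eq: "p t x = s0 (t, x) + \<sigma> 0 (t, x) * (t * (T - t)) + (\<Sum>i<length gs. \<sigma> (Suc i) (t, x) * (gs!i) x)" for t x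
    using s(3)[of "(t, x)"] unfolding len sum.lessThan_Suc_shift by (simp add: hs_def add.assoc)
  have "\<forall>\<^sub>F k in sequentially. tsos_on U k (\<lambda>t x. s0 (t, x))" using tsos_on_eventually[OF s(1), of 0] by simp
  moreover have "\<forall>\<^sub>F k in sequentially. tsos_on U (k - 2) (\<lambda>t x. \<sigma> 0 (t, x))"
    by (rule tsos_on_eventually[OF s(2)]) (simp add: len)
  moreover have "\<forall>\<^sub>F k in sequentially. \<forall>i\<in>{..<length gs}. tsos_on U (k - pdeg U (gs!i)) (\<lambda>t x. \<sigma> (Suc i) (t, x))"
    using s(2) by (intro eventually_ball_finite ballI tsos_on_eventually) (auto simp: len)
  ultimately show ?thesis
  proof eventually_elim
    case (elim k)
    then show ?case unfolding tcert_def
      by (intro exI[of _ "\<lambda>t x. s0 (t, x)"] exI[of _ "\<lambda>t x. \<sigma> 0 (t, x)"]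
          exI[of _ "map (\<lambda>i t x. \<sigma> (Suc i) (t, x)) [0..<length gs]"]) (use eq in auto)
  qed
qed

section \<open>Lie derivatives of polynomials\<close>

text \<open>The two kinds of derivative in \<open>Lop\<close>, as operators so that they can be
  iterated and commuted.\<close>

definition dt :: "(real \<Rightarrow> (nat \<Rightarrow> real) \<Rightarrow> real) \<Rightarrow> real \<Rightarrow> (nat \<Rightarrow> real) \<Rightarrow> real" where
  "dt p = (\<lambda>t x. deriv (\<lambda>s. p s x) t)"

definition dx :: "nat \<Rightarrow> (real \<Rightarrow> (nat \<Rightarrow> real) \<Rightarrow> real) \<Rightarrow> real \<Rightarrow> (nat \<Rightarrow> real) \<Rightarrow> real" where
  "dx i p = (\<lambda>t x. deriv (\<lambda>s. p t (x(i := s))) (x i))"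

lemma tpolys_dt_exists: "p \<in> tpolys V \<Longrightarrow> \<exists>D. ((\<lambda>s. p s x) has_real_derivative D) (at t)"
proof (induction rule: tpolys.induct)
  case (mult p q) then show ?case using DERIV_mult by blast
next
  case (add p q) then show ?case using DERIV_add by blast
qed (auto intro!: exI derivative_eq_intros)

lemma tpolys_dx_exists: "p \<in> tpolys V \<Longrightarrow> \<exists>D. ((\<lambda>s. p t (x(i := s))) has_real_derivative D) (at u)"
proof (induction rule: tpolys.induct)
  case (var j)
  then show ?case by (cases "i = j") (auto intro!: exI derivative_eq_intros)
next
  case (mult p q) then show ?case using DERIV_mult by blast
next
  case (add p q) then show ?case using DERIV_add by blast
qed (auto intro!: exI derivative_eq_intros)

lemma dt_deriv: "p \<in> tpolys V \<Longrightarrow> ((\<lambda>s. p s x) has_real_derivative dt p t x) (at t)"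
  using tpolys_dt_exists[of p V x t] by (auto simp: dt_def dest: DERIV_imp_deriv)

lemma dx_deriv: "p \<in> tpolys V \<Longrightarrow> ((\<lambda>s. p t (x(i := s))) has_real_derivative dx i p t x) (at (x i))"
  using tpolys_dx_exists[of p V t x i "x i"] by (auto simp: dx_def dest: DERIV_imp_deriv)

lemma dt_eqI: "(\<And>t x. ((\<lambda>s. p s x) has_real_derivative D t x) (at t)) \<Longrightarrow> dt p = D"
  by (intro ext) (auto simp: dt_def intro: DERIV_imp_deriv)

lemma dx_eqI: "(\<And>t x. ((\<lambda>s. p t (x(i := s))) has_real_derivative D t x) (at (x i))) \<Longrightarrow> dx i p = D"
  by (intro ext) (auto simp: dx_def intro: DERIV_imp_deriv)

lemma dt_simps:
  "dt (\<lambda>t x. c) = (\<lambda>t x. 0)" "dt (\<lambda>t x. t) = (\<lambda>t x. 1)" "dt (\<lambda>t x. p x) = (\<lambda>t x. 0)"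
  by (rule dt_eqI; auto intro!: derivative_eq_intros)+

lemma dx_simps:
  "dx i (\<lambda>t x. c) = (\<lambda>t x. 0)" "dx i (\<lambda>t x. t) = (\<lambda>t x. 0)" "dx i (\<lambda>t x. x j) = (\<lambda>t x. if i = j then 1 else 0)"
  by (rule dx_eqI; auto intro!: derivative_eq_intros)+

lemma dt_add: "p \<in> tpolys V \<Longrightarrow> q \<in> tpolys V \<Longrightarrow> dt (\<lambda>t x. p t x + q t x) = (\<lambda>t x. dt p t x + dt q t x)"
  by (rule dt_eqI) (intro DERIV_add dt_deriv)

lemma dt_mult: "p \<in> tpolys V \<Longrightarrow> q \<in> tpolys V \<Longrightarrow>
    dt (\<lambda>t x. p t x * q t x) = (\<lambda>t x. dt p t x * q t x + p t x * dt q t x)"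
  by (rule dt_eqI, rule DERIV_cong[OF DERIV_mult[OF dt_deriv dt_deriv]]) auto

lemma dx_add: "p \<in> tpolys V \<Longrightarrow> q \<in> tpolys V \<Longrightarrow> dx i (\<lambda>t x. p t x + q t x) = (\<lambda>t x. dx i p t x + dx i q t x)"
  by (rule dx_eqI) (intro DERIV_add dx_deriv)

lemma dx_mult: "p \<in> tpolys V \<Longrightarrow> q \<in> tpolys V \<Longrightarrow>
    dx i (\<lambda>t x. p t x * q t x) = (\<lambda>t x. dx i p t x * q t x + p t x * dx i q t x)"
  by (rule dx_eqI, rule DERIV_cong[OF DERIV_mult[OF dx_deriv dx_deriv]]) auto

lemma dt_closed: "p \<in> tpolys V \<Longrightarrow> dt p \<in> tpolys V"
  by (induction rule: tpolys.induct) (auto simp: dt_simps dt_add dt_mult intro: tpolys.intros)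

lemma dx_closed: "p \<in> tpolys V \<Longrightarrow> dx i p \<in> tpolys V"
proof (induction rule: tpolys.induct)
  case (var j)
  show ?case by (cases "i = j") (auto simp: dx_simps intro: tpolys.const)
qed (auto simp: dx_simps dx_add dx_mult intro: tpolys.intros)

lemma Lop_alt: "Lop f U v = (\<lambda>t x. dt v t x + (\<Sum>i\<in>U. dx i v t x * f i x))"
  by (intro ext) (simp add: Lop_def dt_def dx_def)

lemma Lop_simps:
  "Lop f U (\<lambda>t x. c) = (\<lambda>t x. 0)" "Lop f U (\<lambda>t x. t) = (\<lambda>t x. 1)"
  "finite U \<Longrightarrow> i \<in> U \<Longrightarrow> Lop f U (\<lambda>t x. x i) = (\<lambda>t x. f i x)"
  by (auto simp: Lop_alt dt_simps dx_simps if_distrib[of "\<lambda>c. c * _"] cong: if_cong)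

lemma Lop_add: "p \<in> tpolys V \<Longrightarrow> q \<in> tpolys V \<Longrightarrow> Lop f U (\<lambda>t x. p t x + q t x) = (\<lambda>t x. Lop f U p t x + Lop f U q t x)"
  by (simp add: Lop_alt dt_add dx_add distrib_right sum.distrib add_ac)

lemma Lop_mult: "p \<in> tpolys V \<Longrightarrow> q \<in> tpolys V \<Longrightarrow>
    Lop f U (\<lambda>t x. p t x * q t x) = (\<lambda>t x. Lop f U p t x * q t x + p t x * Lop f U q t x)"
  by (simp add: Lop_alt dt_mult dx_mult algebra_simps sum.distrib sum_distrib_left)

lemma Lop_closed:
  assumes "finite U" "\<And>i. i \<in> U \<Longrightarrow> f i \<in> polys U" "p \<in> tpolys U"
  shows "Lop f U p \<in> tpolys U"
  unfolding Lop_alt using assms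
  by (intro tpolys.add tpolys_sum tpolys.mult dt_closed dx_closed tpolys_of_polys) auto

text \<open>The coefficients \<open>f i\<close> do not depend on time. For Picard iterates this
  turns the defect in the transport equation into the solution of an ordinary differential equation
  in time.\<close>

lemma dt_Lop_commute:
  assumes U: "finite U" and f: "\<And>i. i \<in> U \<Longrightarrow> f i \<in> polys U"
  shows "p \<in> tpolys U \<Longrightarrow> dt (Lop f U p) = Lop f U (dt p)"
proof (induction rule: tpolys.induct)
  case (add p q)
  note [simp] = Lop_closed[OF U f] dt_closed
  from add show ?case by (simp add: Lop_add[of _ U] dt_add[of _ U])
next
  case (mult p q)
  note [simp] = Lop_closed[OF U f] dt_closed tpolys.mult
  from mult show ?case by (simp add: Lop_mult[of _ U] dt_mult[of _ U] dt_add[of _ U] Lop_add[of _ U] add_ac)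
qed (simp_all add: Lop_simps dt_simps U)

text \<open>Chain rule: \<open>dx j (\<lambda>_. p) 0\<close> is the \<open>j\<close>-th partial
  derivative of the time-independent \<open>p\<close>, taken at a dummy time.\<close>

lemma Lop_comp:
  assumes W: "finite W" and p: "p \<in> polys W" and q: "\<And>j. j \<in> W \<Longrightarrow> q j \<in> tpolys U"
  shows "Lop f U (\<lambda>t x. p (\<lambda>j. q j t x)) =
    (\<lambda>t x. \<Sum>j\<in>W. dx j (\<lambda>_. p) 0 (\<lambda>j. q j t x) * Lop f U (q j) t x)"
  using p
proof induction
  case (const c)
  show ?case by (simp add: Lop_simps dx_simps)
next
  case (var i)
  then show ?case using W by (simp add: dx_simps if_distrib[of "\<lambda>c. c * _"] cong: if_cong)
next
  case (add a b)
  have "dx j (\<lambda>_ x. a x + b x) = (\<lambda>t x. dx j (\<lambda>_. a) t x + dx j (\<lambda>_. b) t x)" for j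
    using dx_add[OF tpolys_of_polys[OF add.hyps(1)] tpolys_of_polys[OF add.hyps(2)]] by simp
  moreover have "Lop f U (\<lambda>t x. a (\<lambda>j. q j t x) + b (\<lambda>j. q j t x)) =
      (\<lambda>t x. Lop f U (\<lambda>t x. a (\<lambda>j. q j t x)) t x + Lop f U (\<lambda>t x. b (\<lambda>j. q j t x)) t x)"
    by (rule Lop_add[OF tpolys_comp[OF add.hyps(1) q] tpolys_comp[OF add.hyps(2) q]]) auto
  ultimately show ?case using add.IH by (simp add: distrib_right sum.distrib)
next
  case (mult a b)
  have "dx j (\<lambda>_ x. a x * b x) = (\<lambda>t x. dx j (\<lambda>_. a) t x * b x + a x * dx j (\<lambda>_. b) t x)" for j
    using dx_mult[OF tpolys_of_polys[OF mult.hyps(1)] tpolys_of_polys[OF mult.hyps(2)]] by simp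
  moreover have "Lop f U (\<lambda>t x. a (\<lambda>j. q j t x) * b (\<lambda>j. q j t x)) =
      (\<lambda>t x. Lop f U (\<lambda>t x. a (\<lambda>j. q j t x)) t x * b (\<lambda>j. q j t x) + a (\<lambda>j. q j t x) * Lop f U (\<lambda>t x. b (\<lambda>j. q j t x)) t x)"
    by (rule Lop_mult[OF tpolys_comp[OF mult.hyps(1) q] tpolys_comp[OF mult.hyps(2) q]]) auto
  ultimately show ?case using mult.IH
    by (simp add: sum_distrib_left sum_distrib_right sum.distrib[symmetric] algebra_simps)
qed

text \<open>\<open>v\<close> is built from the flow over the remaining time \<open>T - t\<close>.
  The reversal flips the sign of the time derivative only, which amounts to the operator for
  \<open>- f\<close> with a global minus sign.\<close>

lemma Lop_reverse_time:
  assumes U: "finite U"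
  shows "p \<in> tpolys U \<Longrightarrow> Lop f U (\<lambda>t x. p (T - t) x) = (\<lambda>t x. - Lop (\<lambda>i x. - f i x) U p (T - t) x)"
proof (induction rule: tpolys.induct)
  case time
  have "(\<lambda>t x. T - t) = (\<lambda>t (x :: nat \<Rightarrow> real). T + (-1) * t)" by auto
  moreover have "Lop f U (\<lambda>t x. T + (-1) * t) = (\<lambda>t x. -1)"
    using Lop_add[OF tpolys.const tpolys.mult[OF tpolys.const tpolys.time], of f U T "-1"]
      Lop_mult[OF tpolys.const tpolys.time, of f U "-1"] by (simp add: Lop_simps)
  ultimately show ?case by (simp add: Lop_simps)
next
  case (add p q)
  have "(\<lambda>t x. p (T - t) x) \<in> tpolys U" "(\<lambda>t x. q (T - t) x) \<in> tpolys U"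
    by (rule tpolys_time_comp[OF add.hyps(1) tpolys_diff[OF tpolys.const tpolys.time]]
        tpolys_time_comp[OF add.hyps(2) tpolys_diff[OF tpolys.const tpolys.time]])+
  then show ?case using add by (simp add: Lop_add[of _ U])
next
  case (mult p q)
  have "(\<lambda>t x. p (T - t) x) \<in> tpolys U" "(\<lambda>t x. q (T - t) x) \<in> tpolys U"
    by (rule tpolys_time_comp[OF mult.hyps(1) tpolys_diff[OF tpolys.const tpolys.time]]
        tpolys_time_comp[OF mult.hyps(2) tpolys_diff[OF tpolys.const tpolys.time]])+
  then show ?case using mult by (simp add: Lop_mult[of _ U])
qed (simp_all add: Lop_simps U)

lemma tpolys_curve_deriv:
  assumes U: "finite U" and y: "\<And>i. i \<in> U \<Longrightarrow> ((\<lambda>s. y s i) has_real_derivative y' i) (at t within S)"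
  shows "p \<in> tpolys U \<Longrightarrow> ((\<lambda>s. p s (y s)) has_real_derivative dt p t (y t) + (\<Sum>i\<in>U. dx i p t (y t) * y' i)) (at t within S)"
proof (induction rule: tpolys.induct)
  case (var i)
  then show ?case using U y by (simp add: dt_simps dx_simps if_distrib[of "\<lambda>c. c * _"] cong: if_cong)
next
  case (add p q)
  show ?case
    by (rule DERIV_cong[OF DERIV_add[OF add.IH]])
      (simp add: dt_add[OF add.hyps] dx_add[OF add.hyps] distrib_right sum.distrib)
next
  case (mult p q)
  show ?case
    by (rule DERIV_cong[OF DERIV_mult[OF mult.IH]])
      (simp add: dt_mult[OF mult.hyps] dx_mult[OF mult.hyps] sum.distrib sum_distrib_left sum_distrib_right algebra_simps)
qed (auto simp: dt_simps dx_simps intro!: derivative_eq_intros)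

lemma tpolys_solution_deriv:
  assumes "finite U" "\<And>i. i \<in> U \<Longrightarrow> ((\<lambda>s. y s i) has_real_derivative f i (y t)) (at t within S)" "p \<in> tpolys U"
  shows "((\<lambda>s. p s (y s)) has_real_derivative Lop f U p t (y t)) (at t within S)"
  using tpolys_curve_deriv[OF assms(1,2,3)] by (simp add: Lop_alt)

section \<open>A smooth clipping function and an iteration estimate\<close>

lemma weierstrass_interval:
  fixes h :: "real \<Rightarrow> real"
  assumes "continuous_on {a..b} h" "e > 0"
  shows "\<exists>p. real_polynomial_function p \<and> (\<forall>x\<in>{a..b}. \<bar>h x - p x\<bar> < e)"
  by (rule Stone_Weierstrass_real_polynomial_function[OF compact_Icc assms]) blast

lemma real_polynomial_antiderivative:
  fixes q :: "real \<Rightarrow> real"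
  assumes "real_polynomial_function q"
  shows "\<exists>Q. real_polynomial_function Q \<and> Q 0 = 0 \<and> (\<forall>u. (Q has_real_derivative q u) (at u))"
proof -
  obtain a n where q: "q = (\<lambda>x. \<Sum>i\<le>n. a i * x ^ i)"
    using assms real_polynomial_function_iff_sum by blast
  let ?Q = "\<lambda>x::real. \<Sum>i\<le>n. a i / real (Suc i) * x ^ Suc i"
  have "((\<lambda>x. a i / real (Suc i) * x ^ Suc i) has_real_derivative a i * u ^ i) (at u)" for i u
    by (rule DERIV_cong[OF DERIV_cmult[OF DERIV_pow]]) (simp del: of_nat_Suc)
  then have "\<forall>u. (?Q has_real_derivative q u) (at u)" unfolding q by (intro allI DERIV_sum)
  moreover have "real_polynomial_function (\<lambda>x::real. a i / real (Suc i) * x ^ Suc i)" for i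
    by (intro real_polynomial_function.intros(4)[OF real_polynomial_function.intros(2)]
        real_polynomial_function_power real_polynomial_function.intros(1) bounded_linear_ident)
  then have "real_polynomial_function ?Q" by (intro real_polynomial_function_sum) auto
  ultimately show ?thesis by (intro exI[of _ ?Q]) auto
qed

lemma pos_part_square_deriv:
  "((\<lambda>w. (max 0 w)\<^sup>2 / 2) has_real_derivative max 0 w) (at w)" for w :: real
proof (cases w "0::real" rule: linorder_cases)
  case less
  have "((\<lambda>w. 0) has_real_derivative 0) (at w)" by simp
  then have "((\<lambda>w. (max 0 w)\<^sup>2 / 2) has_real_derivative 0) (at w)"
    by (rule DERIV_cong_ev[THEN iffD1, rotated 3, OF _ refl _ refl])
      (use less in \<open>auto intro: eventually_mono[OF eventually_nhds_in_open[of "{..<0}"]]\<close>)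
  then show ?thesis using less by simp
next
  case greater
  have "((\<lambda>w. w\<^sup>2 / 2) has_real_derivative w) (at w)" by (auto intro!: derivative_eq_intros)
  then have "((\<lambda>w. (max 0 w)\<^sup>2 / 2) has_real_derivative w) (at w)"
    by (rule DERIV_cong_ev[THEN iffD1, rotated 3, OF _ refl _ refl])
      (use greater in \<open>auto intro: eventually_mono[OF eventually_nhds_in_open[of "{0<..}"]]\<close>)
  then show ?thesis using greater by simp
next
  case equal
  \<comment> \<open>The difference quotient at 0 is \<open>max 0 h / 2\<close>.\<close>
  have "((\<lambda>h::real. max 0 h / 2) \<longlongrightarrow> max 0 0 / 2) (at 0)" by (intro tendsto_intros) auto
  then have "((\<lambda>h::real. max 0 h / 2) \<longlongrightarrow> 0) (at 0)" by simp
  then have "((\<lambda>h::real. ((max 0 (0 + h))\<^sup>2 / 2 - (max 0 0)\<^sup>2 / 2) / h) \<longlongrightarrow> 0) (at 0)"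
    by (rule Lim_transform_eventually)
      (auto simp: eventually_at_filter max_def power2_eq_square intro!: always_eventually)
  then show ?thesis using equal by (simp add: DERIV_def)
qed

text \<open>A \<open>C\<^sup>1\<close> clipping function: the identity on \<open>[-R, R]\<close>, constant outside \<open>[-R - 1, R + 1]\<close>.\<close>

definition sat :: "real \<Rightarrow> real \<Rightarrow> real" where
  "sat R u = u - (max 0 (u - R))\<^sup>2 / 2 + (max 0 (u - R - 1))\<^sup>2 / 2
    + (max 0 (- u - R))\<^sup>2 / 2 - (max 0 (- u - R - 1))\<^sup>2 / 2"

text \<open>A trapezoid: 1 on \<open>[-R, R]\<close>, 0 beyond \<open>R + 1\<close>, linear in
  between. Being continuous, it can be approximated by polynomials.\<close>

definition sat' :: "real \<Rightarrow> real \<Rightarrow> real" where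
  "sat' R u = 1 - max 0 (u - R) + max 0 (u - R - 1) - max 0 (- u - R) + max 0 (- u - R - 1)"

lemma sat_deriv: "(sat R has_real_derivative sat' R u) (at u)"
proof -
  have 1: "((\<lambda>u. (max 0 (u - a))\<^sup>2 / 2) has_real_derivative max 0 (u - a)) (at u)" for a
  proof -
    have "((\<lambda>u. u - a) has_real_derivative 1) (at u)" by (auto intro!: derivative_eq_intros)
    from DERIV_chain2[OF pos_part_square_deriv this] show ?thesis by simp
  qed
  have 2: "((\<lambda>u. (max 0 (- u - a))\<^sup>2 / 2) has_real_derivative - max 0 (- u - a)) (at u)" for a
  proof -
    have "((\<lambda>u. - u - a) has_real_derivative -1) (at u)" by (auto intro!: derivative_eq_intros)
    from DERIV_chain2[OF pos_part_square_deriv this] show ?thesis by simp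
  qed
  show ?thesis
    unfolding sat_def[abs_def] sat'_def
    by (rule DERIV_cong[OF DERIV_diff[OF DERIV_add[OF DERIV_add[OF DERIV_diff[OF DERIV_ident 1[of R]]
            1[of "R + 1", unfolded diff_diff_eq[symmetric]]] 2[of R]] 2[of "R + 1", unfolded diff_diff_eq[symmetric]]]]) simp
qed

lemma sat'_bounds: "R \<ge> 0 \<Longrightarrow> 0 \<le> sat' R u \<and> sat' R u \<le> 1"
  unfolding sat'_def by (smt (verit))

lemma sat_eq:
  assumes "\<bar>u\<bar> \<le> R" shows "sat R u = u"
proof -
  have "max 0 (u - R) = 0" "max 0 (u - R - 1) = 0" "max 0 (- u - R) = 0" "max 0 (- u - R - 1) = 0"
    using assms by auto
  then show ?thesis by (simp add: sat_def)
qed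

lemma sat_le: assumes "R \<ge> 0" shows "\<bar>sat R u\<bar> \<le> R + 1"
proof -
  have *: "sat R u \<le> R + 1 \<and> 0 \<le> sat R u" if "u \<ge> 0" for u
  proof -
    consider "u \<le> R" | "R < u" "u \<le> R + 1" | "R + 1 < u" by linarith
    then show ?thesis
    proof cases
      case 1 then show ?thesis using sat_eq[of u R] that assms by auto
    next
      case 2
      then have "(u - R)\<^sup>2 \<le> 1" using power_le_one[of "u - R" 2] by auto
      moreover have "(u - R)\<^sup>2 \<le> 2 * u"
        using 2 assms mult_mono[of "u - R" 1 "u - R" u] by (simp add: power2_eq_square)
      moreover have "sat R u = u - (u - R)\<^sup>2 / 2" using 2 assms by (simp add: sat_def max_def)
      ultimately show ?thesis using 2 zero_le_power2[of "u - R"] by linarith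
    next
      case 3
      then have "sat R u = u - (u - R)\<^sup>2 / 2 + (u - R - 1)\<^sup>2 / 2" using assms by (simp add: sat_def max_def)
      also have "\<dots> = R + 1/2" by (simp add: power2_eq_square field_simps)
      finally show ?thesis using assms by simp
    qed
  qed
  have "sat R (- u) = - sat R u" by (simp add: sat_def)
  then show ?thesis using *[of u] *[of "- u"] by (cases "u \<ge> 0") auto
qed

lemma sat_lipschitz: assumes "R \<ge> 0" shows "\<bar>sat R u - sat R v\<bar> \<le> \<bar>u - v\<bar>"
proof -
  have "norm (sat R u - sat R v) \<le> 1 * norm (u - v)"
    by (rule field_differentiable_bound[of UNIV "sat R" "sat' R"])
      (use sat_deriv[of R] sat'_bounds[OF assms] in simp_all)
  then show ?thesis by simp
qed

text \<open>The slope is approximated and then integrated from 0, so value and slope are controlled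
  together. The slope bound 2 is independent of \<open>\<eta>\<close>, which keeps the rates of the
  later iterations fixed while \<open>\<eta>\<close> shrinks.\<close>

lemma sat_polynomial_approx:
  assumes R: "R \<ge> 0" and R2: "R2 \<ge> 0" and \<eta>: "\<eta> > 0"
  shows "\<exists>c q. real_polynomial_function c \<and> (\<forall>u. (c has_real_derivative q u) (at u)) \<and>
    (\<forall>u. \<bar>u\<bar> \<le> R2 \<longrightarrow> \<bar>c u - sat R u\<bar> \<le> \<eta> \<and> \<bar>q u\<bar> \<le> 2)"
proof -
  \<comment> \<open>\<open>e * R2 \<le> \<eta>\<close> bounds the integrated error,
    \<open>e \<le> 1\<close> turns the slope bound 1 of \<open>sat\<close> into 2, and
    \<open>R2 + 1\<close> excludes division by zero.\<close>
  define e where "e = min 1 (\<eta> / (R2 + 1))"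
  have e: "e > 0" "e \<le> 1" using \<eta> R2 by (auto simp: e_def)
  have "e * R2 \<le> e * (R2 + 1)" using e by simp
  also have "\<dots> \<le> \<eta>" using R2 pos_le_divide_eq[of "R2 + 1" e \<eta>] by (simp add: e_def)
  finally have eR: "e * R2 \<le> \<eta>" .
  have "continuous_on {-R2..R2} (sat' R)" unfolding sat'_def by (intro continuous_intros)
  then obtain q where q: "real_polynomial_function q" "\<forall>u\<in>{-R2..R2}. \<bar>sat' R u - q u\<bar> < e"
    using weierstrass_interval e(1) by blast
  obtain c where c: "real_polynomial_function c" "c 0 = 0" "\<And>u. (c has_real_derivative q u) (at u)"
    using real_polynomial_antiderivative[OF q(1)] by blast
  have "\<bar>c u - sat R u\<bar> \<le> \<eta> \<and> \<bar>q u\<bar> \<le> 2" if u: "\<bar>u\<bar> \<le> R2" for u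
  proof
    have "norm ((c u - sat R u) - (c 0 - sat R 0)) \<le> e * norm (u - 0)"
    proof (rule field_differentiable_bound[of "{-R2..R2}" "\<lambda>u. c u - sat R u" "\<lambda>u. q u - sat' R u"])
      show "((\<lambda>u. c u - sat R u) has_field_derivative q z - sat' R z) (at z within {-R2..R2})" for z
        by (intro DERIV_diff has_field_derivative_at_within[OF c(3)] has_field_derivative_at_within[OF sat_deriv])
      show "norm (q z - sat' R z) \<le> e" if "z \<in> {-R2..R2}" for z
        using q(2)[rule_format, OF that] by (simp add: abs_minus_commute)
    qed (use u R2 in auto)
    also have "e * norm (u - 0) \<le> e * R2" using u e by (intro mult_left_mono) auto
    finally show "\<bar>c u - sat R u\<bar> \<le> \<eta>" using eR c(2) sat_eq[of 0 R] R by simp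
    have "u \<in> {-R2..R2}" using u by auto
    from q(2)[rule_format, OF this] sat'_bounds[OF R, of u] e show "\<bar>q u\<bar> \<le> 2" by linarith
  qed
  then show ?thesis using c by blast
qed

section \<open>Comparison by derivatives and the iteration estimate\<close>

lemma nondecreasing_Icc:
  fixes h :: "real \<Rightarrow> real"
  assumes "a \<le> b" and d: "\<And>s. s \<in> {a..b} \<Longrightarrow> (h has_real_derivative h' s) (at s within {a..b})"
    and nn: "\<And>s. s \<in> {a..b} \<Longrightarrow> 0 \<le> h' s"
  shows "h a \<le> h b"
proof (cases "a = b")
  case False
  then have ab: "a < b" using assms(1) by simp
  have "\<exists>x\<in>{a<..<b}. h b - h a = h' x * (b - a)"
    using mvt_simple[OF ab, of h "\<lambda>x y. h' x * y"] d by (auto simp: has_field_derivative_def)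
  then obtain x where x: "x \<in> {a<..<b}" "h b - h a = h' x * (b - a)" by blast
  moreover have "0 \<le> h' x * (b - a)" using nn[of x] x(1) ab by (intro mult_nonneg_nonneg) auto
  ultimately show ?thesis by simp
qed simp

text \<open>One estimate serves three purposes below: convergence of the Picard iterates, smallness of their
  defect in the transport equation, and (for a constant sequence \<open>u\<close>) Gronwall's inequality.\<close>

lemma iterated_bound:
  fixes u u' :: "nat \<Rightarrow> real \<Rightarrow> nat \<Rightarrow> real"
  assumes L: "L \<ge> 0" and C: "C \<ge> 0" and \<delta>: "\<delta> \<ge> 0"
    and base: "\<And>s i. s \<in> {0..T} \<Longrightarrow> i \<in> U \<Longrightarrow> \<bar>u 0 s i\<bar> \<le> C"
    and init: "\<And>k i. i \<in> U \<Longrightarrow> \<bar>u (Suc k) 0 i\<bar> \<le> \<delta>"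
    and der: "\<And>k s i. s \<in> {0..T} \<Longrightarrow> i \<in> U \<Longrightarrow>
      ((\<lambda>s. u (Suc k) s i) has_real_derivative u' k s i) (at s within {0..T})"
    and step: "\<And>k s i b. s \<in> {0..T} \<Longrightarrow> i \<in> U \<Longrightarrow> b \<ge> 0 \<Longrightarrow> (\<And>j. j \<in> U \<Longrightarrow> \<bar>u k s j\<bar> \<le> b) \<Longrightarrow> \<bar>u' k s i\<bar> \<le> L * b + \<delta>"
    and s: "s \<in> {0..T}" and i: "i \<in> U"
  shows "\<bar>u k s i\<bar> \<le> C * (L * s) ^ k / fact k + \<delta> * (1 + s) * exp (L * s)"
  using s i
proof (induction k arbitrary: s i)
  case 0
  have "0 \<le> \<delta> * (1 + s) * exp (L * s)" using 0 \<delta> by auto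
  then show ?case using base[OF 0] by simp
next
  case (Suc k)
  \<comment> \<open>The majorant for index \<open>Suc k\<close>; \<open>b\<close> is the one for
    \<open>k\<close>, and the derivative \<open>L b + \<delta> exp (L s)\<close> of \<open>g\<close>
    dominates the growth allowed by \<open>step\<close>. The factor \<open>1 + s\<close> accounts
    for the initial error and the accumulated source.\<close>
  define g where "g s = C * (L * s) ^ Suc k / fact (Suc k) + \<delta> * (1 + s) * exp (L * s)" for s
  define b where "b s = C * (L * s) ^ k / fact k + \<delta> * (1 + s) * exp (L * s)" for s
  have g': "(g has_real_derivative L * b r + \<delta> * exp (L * r)) (at r)" for r
  proof -
    have "((\<lambda>s. C * (L * s) ^ Suc k / fact (Suc k)) has_real_derivative
       C * (real (Suc k) * (L * r) ^ k * L) / fact (Suc k)) (at r)"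
      by (intro DERIV_cdivide DERIV_cmult DERIV_cong[OF DERIV_power_Suc[OF DERIV_cmult_Id]]) (simp add: mult_ac)
    moreover have "((\<lambda>s. \<delta> * (1 + s) * exp (L * s)) has_real_derivative
       \<delta> * exp (L * r) + L * (\<delta> * (1 + r) * exp (L * r))) (at r)"
    proof -
      have "((\<lambda>s. \<delta> * (1 + s)) has_real_derivative \<delta>) (at r)" by (auto intro!: derivative_eq_intros)
      moreover have "((\<lambda>s. exp (L * s)) has_real_derivative exp (L * r) * L) (at r)"
        by (rule DERIV_chain2[OF DERIV_exp DERIV_cmult_Id])
      ultimately show ?thesis by (rule DERIV_cong[OF DERIV_mult]) (simp add: algebra_simps)
    qed
    ultimately have "(g has_real_derivative C * (real (Suc k) * (L * r) ^ k * L) / fact (Suc k) +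
        (\<delta> * exp (L * r) + L * (\<delta> * (1 + r) * exp (L * r)))) (at r)"
      unfolding g_def[abs_def] by (rule DERIV_add)
    moreover have "C * (real (Suc k) * (L * r) ^ k * L) / fact (Suc k) = L * (C * (L * r) ^ k / fact k)"
      by (simp add: fact_Suc field_simps del: of_nat_Suc)
    ultimately show ?thesis by (simp add: b_def algebra_simps)
  qed
  have bd: "\<bar>u' k r i\<bar> \<le> L * b r + \<delta> * exp (L * r)" if r: "r \<in> {0..T}" for r
  proof -
    have "0 \<le> b r" using r L C \<delta> by (auto simp: b_def)
    then have "\<bar>u' k r i\<bar> \<le> L * b r + \<delta>"
      using Suc.IH[OF r] by (intro step[OF r Suc.prems(2)]) (auto simp: b_def)
    moreover have "\<delta> * 1 \<le> \<delta> * exp (L * r)" using r L \<delta> by (intro mult_left_mono) auto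
    ultimately show ?thesis by simp
  qed
  have sub: "{0..s} \<subseteq> {0..T}" using Suc.prems by auto
  have d: "((\<lambda>s. u (Suc k) s i) has_real_derivative u' k r i) (at r within {0..s})" if "r \<in> {0..s}" for r
    using der[of r i k] Suc.prems that sub by (auto intro: has_field_derivative_subset)
  have g0: "g 0 = \<delta>" by (simp add: g_def)
  have s0: "0 \<le> s" using Suc.prems by simp
  have bd': "\<bar>u' k r i\<bar> \<le> L * b r + \<delta> * exp (L * r)" if "r \<in> {0..s}" for r using bd that sub by blast
  \<comment> \<open>Both \<open>g - u\<close> and \<open>g + u\<close> are nondecreasing; together
    they bound the absolute value.\<close>
  have "g 0 - u (Suc k) 0 i \<le> g s - u (Suc k) s i"
    by (rule nondecreasing_Icc[OF s0 DERIV_diff[OF has_field_derivative_at_within[OF g'] d]])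
      (use bd' in \<open>auto dest: abs_le_D1\<close>)
  moreover have "g 0 + u (Suc k) 0 i \<le> g s + u (Suc k) s i"
  proof (rule nondecreasing_Icc[OF s0 DERIV_add[OF has_field_derivative_at_within[OF g'] d]])
    show "0 \<le> L * b r + \<delta> * exp (L * r) + u' k r i" if "r \<in> {0..s}" for r
      using bd'[OF that] by linarith
  qed
  ultimately show ?case using init[OF Suc.prems(2), of k] g0 unfolding g_def by linarith
qed

section \<open>Polynomial Picard iterates\<close>

text \<open>\<open>R\<close> is meant to bound the constraint sets, but the bounds on
  \<open>f\<close> are taken on the box of radius \<open>R + 2\<close>: \<open>sat R\<close> takes
  values up to \<open>R + 1\<close> in modulus, and a polynomial approximation of it may exceed this
  by another 1. \<open>Df\<close> bounds the row sums of the Jacobian.\<close>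

locale ode_system =
  fixes U :: "nat set" and f :: "nat \<Rightarrow> (nat \<Rightarrow> real) \<Rightarrow> real" and T R B Lf Df :: real
  assumes finU: "finite U" and T_pos: "0 < T" and f_poly: "i \<in> U \<Longrightarrow> f i \<in> polys U"
    and nonneg: "0 \<le> R" "0 \<le> B" "0 \<le> Lf" "0 \<le> Df"
    and f_bound: "i \<in> U \<Longrightarrow> (\<And>j. j \<in> U \<Longrightarrow> \<bar>x j\<bar> \<le> R + 2) \<Longrightarrow> \<bar>f i x\<bar> \<le> B"
    and f_lipschitz: "i \<in> U \<Longrightarrow> (\<And>j. j \<in> U \<Longrightarrow> \<bar>x j\<bar> \<le> R + 2) \<Longrightarrow> (\<And>j. j \<in> U \<Longrightarrow> \<bar>y j\<bar> \<le> R + 2) \<Longrightarrow>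
      0 \<le> b \<Longrightarrow> (\<And>j. j \<in> U \<Longrightarrow> \<bar>x j - y j\<bar> \<le> b) \<Longrightarrow> \<bar>f i x - f i y\<bar> \<le> Lf * b"
    and f_gradient: "i \<in> U \<Longrightarrow> (\<And>j. j \<in> U \<Longrightarrow> \<bar>x j\<bar> \<le> R + 2) \<Longrightarrow> (\<Sum>j\<in>U. \<bar>dx j (\<lambda>_. f i) 0 x\<bar>) \<le> Df"

lemma gradient_bounded:
  assumes "finite U" "p \<in> polys U"
  shows "\<exists>D\<ge>0. \<forall>x. (\<forall>i\<in>U. \<bar>x i\<bar> \<le> R) \<longrightarrow> (\<Sum>j\<in>U. \<bar>dx j (\<lambda>_. p) 0 x\<bar>) \<le> D"
proof -
  have "dx j (\<lambda>_. p) 0 \<in> polys U" for j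
    by (rule tpolys_at[OF dx_closed[OF tpolys_of_polys[OF assms(2)]]])
  then have "\<forall>j. \<exists>B\<ge>0. \<forall>x. (\<forall>i\<in>U. \<bar>x i\<bar> \<le> R) \<longrightarrow> \<bar>dx j (\<lambda>_. p) 0 x\<bar> \<le> B"
    using polys_bounded by blast
  then obtain B where "\<And>j. 0 \<le> B j" "\<And>j x. (\<forall>i\<in>U. \<bar>x i\<bar> \<le> R) \<Longrightarrow> \<bar>dx j (\<lambda>_. p) 0 x\<bar> \<le> B j"
    by metis
  then show ?thesis by (intro exI[of _ "\<Sum>j\<in>U. B j"]) (auto intro!: sum_mono sum_nonneg)
qed

text \<open>Sums over the finite set \<open>U\<close> serve as constants common to all
  components.\<close>

lemma ode_system_exists:
  assumes U: "finite U" and T: "0 < T" and f: "\<And>i. i \<in> U \<Longrightarrow> f i \<in> polys U" and R: "0 \<le> R"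
  shows "\<exists>B Lf Df. ode_system U f T R B Lf Df"
proof -
  have "\<forall>i\<in>U. \<exists>B\<ge>0. \<forall>x. (\<forall>j\<in>U. \<bar>x j\<bar> \<le> R + 2) \<longrightarrow> \<bar>f i x\<bar> \<le> B" using f polys_bounded by blast
  then obtain B where B: "\<And>i. i \<in> U \<Longrightarrow> 0 \<le> B i"
    "\<And>i x. i \<in> U \<Longrightarrow> (\<forall>j\<in>U. \<bar>x j\<bar> \<le> R + 2) \<Longrightarrow> \<bar>f i x\<bar> \<le> B i" by metis
  have "\<forall>i\<in>U. \<exists>L\<ge>0. \<forall>x y b. (\<forall>j\<in>U. \<bar>x j\<bar> \<le> R + 2) \<longrightarrow> (\<forall>j\<in>U. \<bar>y j\<bar> \<le> R + 2) \<longrightarrow> 0 \<le> b \<longrightarrow>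
    (\<forall>j\<in>U. \<bar>x j - y j\<bar> \<le> b) \<longrightarrow> \<bar>f i x - f i y\<bar> \<le> L * b" using f polys_lipschitz by blast
  then obtain L where L: "\<And>i. i \<in> U \<Longrightarrow> 0 \<le> L i"
    "\<And>i x y b. i \<in> U \<Longrightarrow> (\<forall>j\<in>U. \<bar>x j\<bar> \<le> R + 2) \<Longrightarrow> (\<forall>j\<in>U. \<bar>y j\<bar> \<le> R + 2) \<Longrightarrow> 0 \<le> b \<Longrightarrow>
    (\<forall>j\<in>U. \<bar>x j - y j\<bar> \<le> b) \<Longrightarrow> \<bar>f i x - f i y\<bar> \<le> L i * b" by metis
  have "\<forall>i\<in>U. \<exists>D\<ge>0. \<forall>x. (\<forall>j\<in>U. \<bar>x j\<bar> \<le> R + 2) \<longrightarrow> (\<Sum>j\<in>U. \<bar>dx j (\<lambda>_. f i) 0 x\<bar>) \<le> D"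
    using f gradient_bounded[OF U] by blast
  then obtain D where D: "\<And>i. i \<in> U \<Longrightarrow> 0 \<le> D i"
    "\<And>i x. i \<in> U \<Longrightarrow> (\<forall>j\<in>U. \<bar>x j\<bar> \<le> R + 2) \<Longrightarrow> (\<Sum>j\<in>U. \<bar>dx j (\<lambda>_. f i) 0 x\<bar>) \<le> D i" by metis
  have le: "h i \<le> sum h U" if "i \<in> U" "\<And>i. i \<in> U \<Longrightarrow> 0 \<le> h i" for h :: "nat \<Rightarrow> real" and i
    using that U by (intro member_le_sum) auto
  show ?thesis
  proof (intro exI, unfold_locales)
    show "finite U" "0 < T" "0 \<le> R" "\<And>i. i \<in> U \<Longrightarrow> f i \<in> polys U" by (fact U T R f)+
    show "0 \<le> sum B U" "0 \<le> sum L U" "0 \<le> sum D U" using B(1) L(1) D(1) by (auto intro!: sum_nonneg)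
    show "\<bar>f i x\<bar> \<le> sum B U" if "i \<in> U" "\<And>j. j \<in> U \<Longrightarrow> \<bar>x j\<bar> \<le> R + 2" for i x
      using B(2)[of i x] le[of i B] B(1) that by force
    show "(\<Sum>j\<in>U. \<bar>dx j (\<lambda>_. f i) 0 x\<bar>) \<le> sum D U" if "i \<in> U" "\<And>j. j \<in> U \<Longrightarrow> \<bar>x j\<bar> \<le> R + 2" for i x
      using D(2)[of i x] le[of i D] D(1) that by force
    show "\<bar>f i x - f i y\<bar> \<le> sum L U * b"
      if *: "i \<in> U" "\<And>j. j \<in> U \<Longrightarrow> \<bar>x j\<bar> \<le> R + 2" "\<And>j. j \<in> U \<Longrightarrow> \<bar>y j\<bar> \<le> R + 2"
        "0 \<le> b" "\<And>j. j \<in> U \<Longrightarrow> \<bar>x j - y j\<bar> \<le> b" for i x y b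
    proof -
      have "\<bar>f i x - f i y\<bar> \<le> L i * b" using L(2)[OF *(1), of x y b] * by blast
      also have "\<dots> \<le> sum L U * b" using le[of i L] L(1) * by (intro mult_right_mono) auto
      finally show ?thesis .
    qed
  qed
qed

lemma power_over_fact_tendsto_zero: "(\<lambda>k. C * a ^ k / fact k) \<longlonglongrightarrow> 0" for C a :: real
proof -
  have "(\<lambda>k. C * (inverse (fact k) * a ^ k)) \<longlonglongrightarrow> C * 0"
    by (intro tendsto_mult tendsto_const summable_LIMSEQ_zero[OF summable_exp])
  then show ?thesis by (simp add: field_simps)
qed

section \<open>The clipped vector field and Gronwall's inequality\<close>

context ode_system
begin

text \<open>The radius that a motion of speed at most \<open>B\<close> started in the box of radius
  \<open>R\<close> can reach by time \<open>T\<close>.\<close>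

definition R2 :: real where "R2 = R + B * T"

definition fs :: "nat \<Rightarrow> (nat \<Rightarrow> real) \<Rightarrow> real" where
  "fs i x = f i (\<lambda>j. sat R (x j))"

lemma R2: "R \<le> R2" "0 \<le> R2"
  using nonneg T_pos by (auto simp: R2_def)

lemma fs_eq: "i \<in> U \<Longrightarrow> (\<And>j. j \<in> U \<Longrightarrow> \<bar>x j\<bar> \<le> R) \<Longrightarrow> fs i x = f i x"
  unfolding fs_def by (rule polys_cong[OF f_poly]) (auto simp: sat_eq)

lemma fs_lipschitz:
  assumes "i \<in> U" "0 \<le> b" "\<And>j. j \<in> U \<Longrightarrow> \<bar>x j - y j\<bar> \<le> b"
  shows "\<bar>fs i x - fs i y\<bar> \<le> Lf * b"
  unfolding fs_def
proof (rule f_lipschitz[OF assms(1) _ _ assms(2)])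
  show "\<bar>sat R (x j)\<bar> \<le> R + 2" "\<bar>sat R (y j)\<bar> \<le> R + 2" for j
    using sat_le[OF nonneg(1), of "x j"] sat_le[OF nonneg(1), of "y j"] by auto
  show "\<bar>sat R (x j) - sat R (y j)\<bar> \<le> b" if "j \<in> U" for j
    using sat_lipschitz[OF nonneg(1), of "x j" "y j"] assms(3)[OF that] by auto
qed

text \<open>The sequence fed into \<open>iterated_bound\<close> is constantly \<open>y - z\<close>.
  As \<open>k\<close> grows the first term vanishes, so the a priori bound \<open>C\<close>
  disappears from the result. Both curves may violate the equation, by \<open>d\<close> and by
  \<open>e\<close>.\<close>

lemma gronwall:
  assumes y: "\<And>s i. s \<in> {0..T} \<Longrightarrow> i \<in> U \<Longrightarrow> ((\<lambda>s. y s i) has_real_derivative y' s i) (at s within {0..T})"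
    and z: "\<And>s i. s \<in> {0..T} \<Longrightarrow> i \<in> U \<Longrightarrow> ((\<lambda>s. z s i) has_real_derivative z' s i) (at s within {0..T})"
    and yf: "\<And>s i. s \<in> {0..T} \<Longrightarrow> i \<in> U \<Longrightarrow> \<bar>y' s i - fs i (y s)\<bar> \<le> d"
    and zf: "\<And>s i. s \<in> {0..T} \<Longrightarrow> i \<in> U \<Longrightarrow> \<bar>z' s i - fs i (z s)\<bar> \<le> e"
    and bd: "\<And>s i. s \<in> {0..T} \<Longrightarrow> i \<in> U \<Longrightarrow> \<bar>y s i - z s i\<bar> \<le> C"
    and eq: "\<And>i. i \<in> U \<Longrightarrow> y 0 i = z 0 i" and s: "s \<in> {0..T}" and i: "i \<in> U"
  shows "\<bar>y s i - z s i\<bar> \<le> (d + e) * (1 + T) * exp (Lf * T)"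
proof -
  have C: "0 \<le> C" using bd[OF s i] by linarith
  have de: "0 \<le> d + e" using yf[OF s i] zf[OF s i] by linarith
  have "\<bar>y s i - z s i\<bar> \<le> C * (Lf * s) ^ k / fact k + (d + e) * (1 + s) * exp (Lf * s)" for k
  proof (rule iterated_bound[of Lf C "d + e" T U "\<lambda>k s i. y s i - z s i" "\<lambda>k s i. y' s i - z' s i" s i k])
    show "\<bar>y' s i - z' s i\<bar> \<le> Lf * b + (d + e)"
      if "s \<in> {0..T}" "i \<in> U" "b \<ge> 0" "\<And>j. j \<in> U \<Longrightarrow> \<bar>y s j - z s j\<bar> \<le> b" for s i b
      using yf[OF that(1,2)] zf[OF that(1,2)] fs_lipschitz[OF that(2,3), of "y s" "z s"] that(4) by fastforce
  qed (use nonneg C de bd eq s i in \<open>auto intro!: DERIV_diff y z\<close>)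
  moreover have "(\<lambda>k. C * (Lf * s) ^ k / fact k + (d + e) * (1 + s) * exp (Lf * s)) \<longlonglongrightarrow> 0 + (d + e) * (1 + s) * exp (Lf * s)"
  proof (intro tendsto_add tendsto_const)
    show "(\<lambda>k. C * (Lf * s) ^ k / fact k) \<longlonglongrightarrow> 0"
      by (rule power_over_fact_tendsto_zero)
  qed
  ultimately have "\<bar>y s i - z s i\<bar> \<le> 0 + (d + e) * (1 + s) * exp (Lf * s)"
    by (intro LIMSEQ_le_const) auto
  also have "\<dots> \<le> (d + e) * (1 + T) * exp (Lf * T)"
    using de s nonneg by (auto intro!: mult_mono)
  finally show ?thesis .
qed

end

text \<open>\<open>c\<close> is a polynomial version of \<open>sat R\<close>, accurate for arguments
  up to \<open>R2\<close>, and \<open>q\<close> is its derivative. The condition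
  \<open>\<eta> \<le> 1\<close> keeps its values there within \<open>R + 2\<close>, where
  \<open>f\<close> is controlled.\<close>

locale picard = ode_system +
  fixes c q :: "real \<Rightarrow> real" and \<eta> :: real
  assumes \<eta>: "0 < \<eta>" "\<eta> \<le> 1" and c_poly: "real_polynomial_function c"
    and c_deriv: "(c has_real_derivative q u) (at u)"
    and c_approx: "\<bar>u\<bar> \<le> R2 \<Longrightarrow> \<bar>c u - sat R u\<bar> \<le> \<eta>"
    and c_slope: "\<bar>u\<bar> \<le> R2 \<Longrightarrow> \<bar>q u\<bar> \<le> 2"
begin

definition F :: "nat \<Rightarrow> (nat \<Rightarrow> real) \<Rightarrow> real" where
  "F i x = f i (\<lambda>j. c (x j))"

text \<open>Chosen by \<open>SOME\<close>, so that the iterates are plain primitive recursion. It is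
  characterised for polynomials only, which is why facts about \<open>phi k i\<close> carry
  \<open>i \<in> U\<close>.\<close>

definition antideriv :: "(real \<Rightarrow> (nat \<Rightarrow> real) \<Rightarrow> real) \<Rightarrow> real \<Rightarrow> (nat \<Rightarrow> real) \<Rightarrow> real" where
  "antideriv p = (SOME Q. Q \<in> tpolys U \<and> (\<forall>x. Q 0 x = 0) \<and> (\<forall>t x. ((\<lambda>s. Q s x) has_real_derivative p t x) (at t)))"

primrec phi :: "nat \<Rightarrow> nat \<Rightarrow> real \<Rightarrow> (nat \<Rightarrow> real) \<Rightarrow> real" where
  "phi 0 = (\<lambda>i t x. x i)"
| "phi (Suc k) = (\<lambda>i t x. x i + antideriv (\<lambda>t x. F i (\<lambda>j. phi k j t x)) t x)"

declare phi.simps(2) [simp del]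

lemma antideriv:
  assumes "p \<in> tpolys U"
  shows "antideriv p \<in> tpolys U" "antideriv p 0 x = 0"
    "((\<lambda>s. antideriv p s x) has_real_derivative p t x) (at t)"
proof -
  have "\<exists>Q. Q \<in> tpolys U \<and> (\<forall>x. Q 0 x = 0) \<and> (\<forall>t x. ((\<lambda>s. Q s x) has_real_derivative p t x) (at t))"
    using tpolys_antiderivative[OF assms] by blast
  from someI_ex[OF this] show "antideriv p \<in> tpolys U" "antideriv p 0 x = 0"
    "((\<lambda>s. antideriv p s x) has_real_derivative p t x) (at t)"
    unfolding antideriv_def by blast+
qed

lemma c_comp: "p \<in> tpolys U \<Longrightarrow> (\<lambda>t x. c (p t x)) \<in> tpolys U"
  using tpolys_comp[OF polys_real_poly[OF c_poly polys.var[of 0 "{0}"]], of "\<lambda>_. p" U] by simp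

lemma phi_closed: "i \<in> U \<Longrightarrow> phi k i \<in> tpolys U"
proof (induction k arbitrary: i)
  case 0
  then show ?case by (simp add: tpolys.var)
next
  case (Suc k)
  have "(\<lambda>t x. F i (\<lambda>j. phi k j t x)) \<in> tpolys U"
    unfolding F_def using Suc by (intro tpolys_comp[OF f_poly] c_comp)
  then show ?case using Suc.prems by (simp add: phi.simps(2) tpolys.add tpolys.var antideriv)
qed

lemma F_phi_closed: "i \<in> U \<Longrightarrow> (\<lambda>t x. F i (\<lambda>j. phi k j t x)) \<in> tpolys U"
  unfolding F_def by (intro tpolys_comp[OF f_poly] c_comp phi_closed)

lemma phi_0: "i \<in> U \<Longrightarrow> phi k i 0 x = x i"
  by (cases k) (auto simp: phi.simps(2) antideriv F_phi_closed)

lemma phi_deriv: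
  assumes "i \<in> U"
  shows "((\<lambda>s. phi (Suc k) i s x) has_real_derivative F i (\<lambda>j. phi k j s x)) (at s)"
  using antideriv(3)[OF F_phi_closed[OF assms]] by (auto simp: phi.simps(2) intro!: derivative_eq_intros)

lemma c_le: "\<bar>u\<bar> \<le> R2 \<Longrightarrow> \<bar>c u\<bar> \<le> R + 2"
  using c_approx[of u] sat_le[OF nonneg(1), of u] \<eta> by linarith

lemma F_bound: "i \<in> U \<Longrightarrow> (\<And>j. j \<in> U \<Longrightarrow> \<bar>x j\<bar> \<le> R2) \<Longrightarrow> \<bar>F i x\<bar> \<le> B"
  unfolding F_def by (intro f_bound c_le)

lemma c_lipschitz:
  assumes "\<bar>u\<bar> \<le> R2" "\<bar>v\<bar> \<le> R2"
  shows "\<bar>c u - c v\<bar> \<le> 2 * \<bar>u - v\<bar>"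
proof -
  have "norm (c u - c v) \<le> 2 * norm (u - v)"
    by (rule field_differentiable_bound[of "{-R2..R2}" c q])
      (use c_slope assms in \<open>auto intro!: has_field_derivative_at_within[OF c_deriv]\<close>)
  then show ?thesis by simp
qed

lemma F_lipschitz:
  assumes "i \<in> U" "\<And>j. j \<in> U \<Longrightarrow> \<bar>x j\<bar> \<le> R2" "\<And>j. j \<in> U \<Longrightarrow> \<bar>y j\<bar> \<le> R2" "0 \<le> b" "\<And>j. j \<in> U \<Longrightarrow> \<bar>x j - y j\<bar> \<le> b"
  shows "\<bar>F i x - F i y\<bar> \<le> 2 * Lf * b"
proof -
  have "\<bar>F i x - F i y\<bar> \<le> Lf * (2 * b)"
    unfolding F_def
  proof (intro f_lipschitz assms(1) c_le assms(2,3))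
    show "\<bar>c (x j) - c (y j)\<bar> \<le> 2 * b" if "j \<in> U" for j
      by (rule order_trans[OF c_lipschitz[OF assms(2)[OF that] assms(3)[OF that]]]) (use assms(5)[OF that] in simp)
  qed (use assms(4) in auto)
  then show ?thesis by simp
qed

lemma F_approx:
  assumes "i \<in> U" "\<And>j. j \<in> U \<Longrightarrow> \<bar>x j\<bar> \<le> R2"
  shows "\<bar>F i x - fs i x\<bar> \<le> Lf * \<eta>"
  unfolding F_def fs_def
proof (intro f_lipschitz assms(1) c_le assms(2))
  show "\<bar>sat R (x j)\<bar> \<le> R + 2" for j using sat_le[OF nonneg(1), of "x j"] by auto
qed (use \<eta> c_approx assms in auto)

context
  fixes x assumes x: "\<And>j. j \<in> U \<Longrightarrow> \<bar>x j\<bar> \<le> R"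
begin

text \<open>\<open>c\<close> need not clip anything far away, so the iterates must not leave the box
  where it is accurate. Within \<open>R2\<close> the field \<open>F\<close> is bounded by
  \<open>B\<close>, and hence the next iterate obeys the same bound
  \<open>R + B * s\<close>.\<close>

lemma phi_box: "s \<in> {0..T} \<Longrightarrow> i \<in> U \<Longrightarrow> \<bar>phi k i s x\<bar> \<le> R + B * s"
proof (induction k arbitrary: s i)
  case 0
  then have "\<bar>x i\<bar> \<le> R" "0 \<le> B * s" using x nonneg by auto
  then show ?case by simp
next
  case (Suc k)
  have box: "\<bar>phi k j r x\<bar> \<le> R2" if "r \<in> {0..s}" "j \<in> U" for r j
  proof -
    have "\<bar>phi k j r x\<bar> \<le> R + B * r" using Suc that by auto
    also have "\<dots> \<le> R2" unfolding R2_def using that Suc.prems nonneg by (intro add_left_mono mult_left_mono) auto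
    finally show ?thesis .
  qed
  have b: "\<bar>F i (\<lambda>j. phi k j r x)\<bar> \<le> B" if "r \<in> {0..s}" for r
    by (rule F_bound[OF Suc.prems(2) box[OF that]])
  have "norm (phi (Suc k) i s x - phi (Suc k) i 0 x) \<le> B * norm (s - 0)"
    by (rule field_differentiable_bound[of "{0..s}" "\<lambda>s. phi (Suc k) i s x" "\<lambda>s. F i (\<lambda>j. phi k j s x)"])
      (use b Suc.prems has_field_derivative_at_within[OF phi_deriv[OF Suc.prems(2)]] in auto)
  then have "\<bar>phi (Suc k) i s x - x i\<bar> \<le> B * s"
    using Suc.prems phi_0[OF Suc.prems(2), of "Suc k" x] by simp
  then show ?case using x[OF Suc.prems(2)] by linarith
qed

lemma phi_R2:
  assumes "s \<in> {0..T}" "i \<in> U" shows "\<bar>phi k i s x\<bar> \<le> R2"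
proof -
  have "B * s \<le> B * T" using assms nonneg by (intro mult_left_mono) auto
  then show ?thesis using phi_box[OF assms, of k] by (simp add: R2_def)
qed

text \<open>All iterates share their initial value, so the iteration estimate runs without source
  term; its rate is \<open>2 * Lf\<close>, with 2 from the slope of \<open>c\<close>.\<close>

lemma phi_step:
  assumes "s \<in> {0..T}" "i \<in> U"
  shows "\<bar>phi (Suc k) i s x - phi k i s x\<bar> \<le> 2 * R2 * (2 * Lf * T) ^ k / fact k"
proof -
  have "\<bar>phi (Suc k) i s x - phi k i s x\<bar> \<le> 2 * R2 * (2 * Lf * s) ^ k / fact k + 0 * (1 + s) * exp (2 * Lf * s)"
  proof (rule iterated_bound[of "2 * Lf" "2 * R2" 0 T U "\<lambda>k s i. phi (Suc k) i s x - phi k i s x"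
        "\<lambda>k s i. F i (\<lambda>j. phi (Suc k) j s x) - F i (\<lambda>j. phi k j s x)" s i k])
    show "\<bar>phi (Suc 0) i s x - phi 0 i s x\<bar> \<le> 2 * R2" if "s \<in> {0..T}" "i \<in> U" for s i
      using phi_R2[OF that, of "Suc 0"] phi_R2[OF that, of 0] by linarith
    show "((\<lambda>s. phi (Suc (Suc k)) i s x - phi (Suc k) i s x) has_real_derivative
         F i (\<lambda>j. phi (Suc k) j s x) - F i (\<lambda>j. phi k j s x)) (at s within {0..T})" if "i \<in> U" for k s i
      by (intro DERIV_diff has_field_derivative_at_within[OF phi_deriv] that)
    show "\<bar>F i (\<lambda>j. phi (Suc k) j s x) - F i (\<lambda>j. phi k j s x)\<bar> \<le> 2 * Lf * b + 0"
      if "s \<in> {0..T}" "i \<in> U" "b \<ge> 0" "\<And>j. j \<in> U \<Longrightarrow> \<bar>phi (Suc k) j s x - phi k j s x\<bar> \<le> b" for k s i b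
      using F_lipschitz[OF that(2) _ _ that(3), of "\<lambda>j. phi (Suc k) j s x" "\<lambda>j. phi k j s x"] phi_R2[OF that(1)] that(4) by simp
  qed (use assms nonneg R2 phi_0 in auto)
  also have "\<dots> \<le> 2 * R2 * (2 * Lf * T) ^ k / fact k"
    using assms nonneg R2 by (auto intro!: divide_right_mono mult_left_mono power_mono)
  finally show ?thesis .
qed

text \<open>\<open>phi (Suc k)\<close> has derivative \<open>F\<close> at \<open>phi k\<close>. As a
  solution of the clipped equation it is therefore off by one Picard step plus the distance of
  \<open>F\<close> from the clipped field.\<close>

lemma phi_defect:
  assumes "s \<in> {0..T}" "i \<in> U"
  shows "\<bar>F i (\<lambda>j. phi k j s x) - fs i (\<lambda>j. phi (Suc k) j s x)\<bar> \<le> 2 * Lf * (2 * R2 * (2 * Lf * T) ^ k / fact k) + Lf * \<eta>"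
proof -
  have "\<bar>F i (\<lambda>j. phi (Suc k) j s x) - F i (\<lambda>j. phi k j s x)\<bar> \<le> 2 * Lf * (2 * R2 * (2 * Lf * T) ^ k / fact k)"
    using nonneg R2 T_pos assms phi_R2[OF assms(1)]
    by (intro F_lipschitz phi_step) auto
  moreover have "\<bar>F i (\<lambda>j. phi (Suc k) j s x) - fs i (\<lambda>j. phi (Suc k) j s x)\<bar> \<le> Lf * \<eta>"
    by (intro F_approx assms(2) phi_R2 assms(1))
  ultimately show ?thesis by linarith
qed

end

text \<open>The exact flow \<open>\<phi>\<close> of \<open>f\<close> satisfies \<open>\<partial>\<^sub>s \<phi> - \<nabla>\<phi> \<cdot> f = 0\<close>; the next operator measures the
  defect of a polynomial in this equation.\<close>

definition transport :: "(real \<Rightarrow> (nat \<Rightarrow> real) \<Rightarrow> real) \<Rightarrow> real \<Rightarrow> (nat \<Rightarrow> real) \<Rightarrow> real" where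
  "transport = Lop (\<lambda>i x. - f i x) U"

lemma transport_closed: "p \<in> tpolys U \<Longrightarrow> transport p \<in> tpolys U"
  unfolding transport_def by (intro Lop_closed finU polys_uminus f_poly)

lemma transport_dt: "p \<in> tpolys U \<Longrightarrow> dt (transport p) = transport (dt p)"
  unfolding transport_def by (intro dt_Lop_commute finU polys_uminus f_poly)

lemma transport_time_deriv:
  assumes "p \<in> tpolys U" shows "((\<lambda>s. transport p s x) has_real_derivative transport (dt p) t x) (at t)"
  using dt_deriv[OF transport_closed[OF assms]] by (simp add: transport_dt[OF assms])

lemma transport_comp:
  assumes "p \<in> polys U" "\<And>j. j \<in> U \<Longrightarrow> g j \<in> tpolys U"
  shows "transport (\<lambda>t x. p (\<lambda>j. g j t x)) t x = (\<Sum>j\<in>U. dx j (\<lambda>_. p) 0 (\<lambda>j. g j t x) * transport (g j) t x)"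
  unfolding transport_def using Lop_comp[OF finU assms] by simp

text \<open>The univariate \<open>c\<close> is viewed as a polynomial in the single coordinate 0, so
  that the chain rule applies.\<close>

lemma transport_c:
  assumes "p \<in> tpolys U"
  shows "transport (\<lambda>t x. c (p t x)) t x = q (p t x) * transport p t x"
proof -
  have *: "(\<lambda>x. c (x 0)) \<in> polys {0}" by (intro polys_real_poly[OF c_poly] polys.var) auto
  have "dx 0 (\<lambda>_ x. c (x 0)) 0 (\<lambda>_. p t x) = q (p t x)"
    unfolding dx_def using DERIV_imp_deriv[OF c_deriv] by simp
  then show ?thesis
    unfolding transport_def using Lop_comp[OF _ *, of "\<lambda>_. p" U "\<lambda>i x. - f i x"] assms by simp
qed

text \<open>At time 0 the spatial derivatives see only the initial profile \<open>g\<close>.\<close>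

lemma transport_initial:
  assumes p: "p \<in> tpolys U" and init: "\<And>x. p 0 x = g x" and g: "(\<lambda>t. g) \<in> tpolys U"
  shows "transport p 0 x = dt p 0 x - (\<Sum>j\<in>U. dx j (\<lambda>_. g) 0 x * f j x)"
proof -
  have "dx j p 0 x = dx j (\<lambda>_. g) 0 x" for j by (simp add: dx_def init)
  then show ?thesis by (simp add: transport_def Lop_alt sum_negf)
qed

text \<open>Origin of the constants: \<open>B\<close> bounds the defect \<open>- f i\<close> of the
  starting iterate; \<open>Lf * \<eta>\<close> bounds the initial defect \<open>F - f\<close> of
  every later one, on the box where clipping is the identity; the rate \<open>2 * Df\<close> is the
  Jacobian bound times the slope of \<open>c\<close>.\<close>

lemma phi_transport:
  assumes x: "\<And>j. j \<in> U \<Longrightarrow> \<bar>x j\<bar> \<le> R" and s: "s \<in> {0..T}" and i: "i \<in> U"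
  shows "\<bar>transport (phi k i) s x\<bar> \<le> B * (2 * Df * T) ^ k / fact k + Lf * \<eta> * (1 + T) * exp (2 * Df * T)"
proof -
  have dtphi: "dt (phi (Suc k) i) = (\<lambda>t x. F i (\<lambda>j. phi k j t x))" if "i \<in> U" for k i
    by (rule dt_eqI) (rule phi_deriv[OF that])
  have "\<bar>transport (phi k i) s x\<bar> \<le> B * (2 * Df * s) ^ k / fact k + Lf * \<eta> * (1 + s) * exp (2 * Df * s)"
  proof (rule iterated_bound[of "2 * Df" B "Lf * \<eta>" T U "\<lambda>k s i. transport (phi k i) s x"
        "\<lambda>k s i. transport (dt (phi (Suc k) i)) s x" s i k])
    show "\<bar>transport (phi 0 i) s x\<bar> \<le> B" if "i \<in> U" for s i
      using f_bound[OF that, of x] x nonneg that by (force simp: transport_def Lop_simps finU)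
    show "\<bar>transport (phi (Suc k) i) 0 x\<bar> \<le> Lf * \<eta>" if "i \<in> U" for k i
    proof -
      have "transport (phi (Suc k) i) 0 x = dt (phi (Suc k) i) 0 x - (\<Sum>j\<in>U. dx j (\<lambda>_ x. x i) 0 x * f j x)"
        by (rule transport_initial[OF phi_closed[OF that] phi_0[OF that]]) (rule tpolys.var[OF that])
      also have "\<dots> = F i (\<lambda>j. phi k j 0 x) - f i x"
        using that finU by (simp add: dtphi dx_simps if_distrib[of "\<lambda>c. c * _"] cong: if_cong)
      also have "F i (\<lambda>j. phi k j 0 x) = F i x"
        unfolding F_def by (rule polys_cong[OF f_poly[OF that]]) (simp add: phi_0)
      also have "f i x = fs i x" using fs_eq[OF that] x by simp
      finally show ?thesis using F_approx[OF that, of x] x R2 by force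
    qed
    show "((\<lambda>s. transport (phi (Suc k) i) s x) has_real_derivative transport (dt (phi (Suc k) i)) s x) (at s within {0..T})"
      if "i \<in> U" for k s i
      by (rule has_field_derivative_at_within[OF transport_time_deriv[OF phi_closed[OF that]]])
    show "\<bar>transport (dt (phi (Suc k) i)) s x\<bar> \<le> 2 * Df * b + Lf * \<eta>"
      if *: "s \<in> {0..T}" "i \<in> U" "b \<ge> 0" "\<And>j. j \<in> U \<Longrightarrow> \<bar>transport (phi k j) s x\<bar> \<le> b" for k s i b
    proof -
      have eq: "transport (dt (phi (Suc k) i)) s x =
          (\<Sum>j\<in>U. dx j (\<lambda>_. f i) 0 (\<lambda>j. c (phi k j s x)) * transport (\<lambda>t x. c (phi k j t x)) s x)"
        unfolding dtphi[OF *(2)] F_def using *(2) by (intro transport_comp f_poly c_comp phi_closed)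
      have "\<bar>transport (dt (phi (Suc k) i)) s x\<bar> \<le> (\<Sum>j\<in>U. \<bar>dx j (\<lambda>_. f i) 0 (\<lambda>j. c (phi k j s x))\<bar> * (2 * b))"
        unfolding eq
      proof (rule order_trans[OF sum_abs sum_mono])
        fix j assume j: "j \<in> U"
        have "\<bar>transport (\<lambda>t x. c (phi k j t x)) s x\<bar> \<le> 2 * b"
          unfolding transport_c[OF phi_closed[OF j]] abs_mult
          using *(4)[OF j] c_slope[OF phi_R2[OF x *(1) j]] by (intro mult_mono) auto
        then show "\<bar>dx j (\<lambda>_. f i) 0 (\<lambda>j. c (phi k j s x)) * transport (\<lambda>t x. c (phi k j t x)) s x\<bar>
            \<le> \<bar>dx j (\<lambda>_. f i) 0 (\<lambda>j. c (phi k j s x))\<bar> * (2 * b)"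
          unfolding abs_mult by (intro mult_left_mono) auto
      qed
      also have "\<dots> = (\<Sum>j\<in>U. \<bar>dx j (\<lambda>_. f i) 0 (\<lambda>j. c (phi k j s x))\<bar>) * (2 * b)"
        by (rule sum_distrib_right[symmetric])
      also have "\<dots> \<le> Df * (2 * b)"
        using *(3) f_gradient[OF *(2), of "\<lambda>j. c (phi k j s x)"] c_le[OF phi_R2[OF x *(1)]]
        by (intro mult_right_mono) auto
      also have "\<dots> \<le> 2 * Df * b + Lf * \<eta>" using nonneg \<eta> by simp
      finally show ?thesis .
    qed
  qed (use nonneg \<eta> s i in auto)
  also have "\<dots> \<le> B * (2 * Df * T) ^ k / fact k + Lf * \<eta> * (1 + T) * exp (2 * Df * T)"
    using s nonneg \<eta> mult_left_mono[of s T Df]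
    by (intro add_mono divide_right_mono mult_mono mult_left_mono power_mono) auto
  finally show ?thesis .
qed

end

section \<open>Polynomial subsolutions of the transport equation\<close>

text \<open>Each constraint contributes an approximation of \<open>M * max 0 (- g)\<close>. Raising
  the target by \<open>e'\<close> and approximating it to within \<open>e'\<close> puts the result
  above the penalty itself, so it is nonnegative.\<close>

lemma penalty_polynomial:
  assumes G: "set G \<subseteq> polys U" and M: "0 \<le> M" and e: "0 < e"
  shows "\<exists>P\<in>polys U. \<forall>x. (\<forall>j\<in>U. \<bar>x j\<bar> \<le> r) \<longrightarrow> 0 \<le> P x \<and> ((\<forall>g\<in>set G. 0 \<le> g x) \<longrightarrow> P x \<le> e) \<and>
    (\<forall>g\<in>set G. M * - g x \<le> P x)"
proof -
  have "\<forall>g\<in>set G. \<exists>B\<ge>0. \<forall>x. (\<forall>j\<in>U. \<bar>x j\<bar> \<le> r) \<longrightarrow> \<bar>g x\<bar> \<le> B" using G polys_bounded by blast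
  then obtain B where B: "\<And>g. g \<in> set G \<Longrightarrow> 0 \<le> B g" "\<And>g x. g \<in> set G \<Longrightarrow> (\<forall>j\<in>U. \<bar>x j\<bar> \<le> r) \<Longrightarrow> \<bar>g x\<bar> \<le> B g" by metis
  define C where "C = sum B (set G)"
  have C: "\<bar>g x\<bar> \<le> C" if "g \<in> set G" "\<forall>j\<in>U. \<bar>x j\<bar> \<le> r" for g x
    unfolding C_def using B(2)[OF that] member_le_sum[of g "set G" B] B(1) that(1) by auto
  \<comment> \<open>On the feasible set each summand is at most \<open>2 * e'\<close>; the
    \<open>+ 1\<close> covers the empty list.\<close>
  define e' where "e' = e / (2 * (real (length G) + 1))"
  have e': "0 < e'" using e by (auto simp: e'_def)
  have "continuous_on {-C..C} (\<lambda>u. M * max 0 (-u) + e')" by (intro continuous_intros)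
  then obtain \<psi> where \<psi>: "real_polynomial_function \<psi>" "\<forall>u\<in>{-C..C}. \<bar>M * max 0 (-u) + e' - \<psi> u\<bar> < e'"
    using weierstrass_interval[OF _ e'] by blast
  have \<psi>': "M * max 0 (- g x) \<le> \<psi> (g x) \<and> \<psi> (g x) \<le> M * max 0 (- g x) + 2 * e'"
    if "g \<in> set G" "\<forall>j\<in>U. \<bar>x j\<bar> \<le> r" for g x
  proof -
    have "g x \<in> {-C..C}" using C[OF that] by auto
    from \<psi>(2)[rule_format, OF this] show ?thesis by linarith
  qed
  show ?thesis
  proof (intro bexI[of _ "\<lambda>x. \<Sum>g\<leftarrow>G. \<psi> (g x)"] allI impI conjI ballI)
    show "(\<lambda>x. \<Sum>g\<leftarrow>G. \<psi> (g x)) \<in> polys U"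
      using G by (intro polys_sum_list polys_real_poly[OF \<psi>(1)]) auto
    fix x assume x: "\<forall>j\<in>U. \<bar>x j\<bar> \<le> r"
    have nn: "0 \<le> \<psi> (g x)" if "g \<in> set G" for g
      using \<psi>'[OF that x] mult_nonneg_nonneg[OF M, of "max 0 (- g x)"] by linarith
    show "0 \<le> (\<Sum>g\<leftarrow>G. \<psi> (g x))" using nn by (intro sum_list_nonneg) auto
    show "(\<Sum>g\<leftarrow>G. \<psi> (g x)) \<le> e" if "\<forall>g\<in>set G. 0 \<le> g x"
    proof -
      have "(\<Sum>g\<leftarrow>G. \<psi> (g x)) \<le> (\<Sum>g\<leftarrow>G. 2 * e')"
        using \<psi>'[OF _ x] that by (intro sum_list_mono) fastforce
      also have "\<dots> = real (length G) * (2 * e')" by (simp add: sum_list_triv)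
      also have "\<dots> \<le> (real (length G) + 1) * (2 * e')" using e' by simp
      also have "\<dots> = e" by (simp add: e'_def field_simps)
      finally show ?thesis .
    qed
    fix g assume g: "g \<in> set G"
    have "\<psi> (g x) \<le> (\<Sum>g\<leftarrow>G. \<psi> (g x))"
      using nn g by (intro member_le_sum_list) auto
    moreover have "M * - g x \<le> M * max 0 (- g x)" using M by (intro mult_left_mono) auto
    ultimately show "M * - g x \<le> (\<Sum>g\<leftarrow>G. \<psi> (g x))" using \<psi>'[OF g x] by linarith
  qed
qed

context ode_system
begin

text \<open>The approximate trajectories \<open>z\<close> are exported along with \<open>v\<close>,
  since \<open>v\<close> at time 0 is bounded through the constraint violations along them. The last
  clause speaks of intervals because the running penalty is an integral.\<close>

lemma subsolution_exists:
  assumes GX: "set GX \<subseteq> polys U" and GY: "set GY \<subseteq> polys U"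
    and boxes: "\<forall>x. (\<forall>g\<in>set GX. 0 \<le> g x) \<longrightarrow> (\<forall>j\<in>U. \<bar>x j\<bar> \<le> R)"
      "\<forall>x. (\<forall>g\<in>set GY. 0 \<le> g x) \<longrightarrow> (\<forall>j\<in>U. \<bar>x j\<bar> \<le> R)"
    and M: "0 \<le> M" and e: "0 < e" and d: "0 < d"
  shows "\<exists>v\<in>tpolys U. \<exists>z z'. (\<forall>t\<in>{0..T}. \<forall>x. (\<forall>g\<in>set GX. 0 \<le> g x) \<longrightarrow> Lop f U v t x < 0) \<and>
    (\<forall>x. (\<forall>g\<in>set GY. 0 \<le> g x) \<longrightarrow> 0 < v T x) \<and>
    (\<forall>x. (\<forall>g\<in>set GX. 0 \<le> g x) \<longrightarrow>
      (\<forall>i\<in>U. z x 0 i = x i) \<and>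
      (\<forall>s\<in>{0..T}. \<forall>i\<in>U. ((\<lambda>s. z x s i) has_real_derivative z' x s i) (at s within {0..T}) \<and>
         \<bar>z' x s i - fs i (z x s)\<bar> \<le> d \<and> \<bar>z x s i\<bar> \<le> R2) \<and>
      v 0 x \<le> e \<and> (\<forall>g\<in>set GY. v 0 x \<le> e - M * - g (z x T)) \<and>
      (\<forall>g\<in>set GX. \<forall>p a b. 0 \<le> a \<longrightarrow> a \<le> b \<longrightarrow> b \<le> T \<longrightarrow> (\<forall>s\<in>{a..b}. g (z x s) \<le> - p) \<longrightarrow> v 0 x \<le> e - M * p * (b - a)))"
proof -
  have GX_box: "\<And>x j. (\<forall>g\<in>set GX. 0 \<le> g x) \<Longrightarrow> j \<in> U \<Longrightarrow> \<bar>x j\<bar> \<le> R"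
    and GY_box: "\<And>x j. (\<forall>g\<in>set GY. 0 \<le> g x) \<Longrightarrow> j \<in> U \<Longrightarrow> \<bar>x j\<bar> \<le> R"
    using boxes by blast+
  \<comment> \<open>Error budget: the affine part \<open>a - b t\<close> with
    \<open>b = 3 e1\<close> and \<open>a = e\<close> beats an error below \<open>2 e1\<close> in the
    differential inequality and leaves \<open>2 e1\<close> against \<open>Q \<le> e1\<close> at time
    \<open>T\<close>.\<close>
  define e1 where "e1 = e / (3 * T + 2)"
  have e1: "0 < e1" "(3 * T + 2) * e1 = e" using e T_pos by (auto simp: e1_def)
  obtain P where P: "P \<in> polys U" and P_nn: "\<And>x. (\<forall>j\<in>U. \<bar>x j\<bar> \<le> R2) \<Longrightarrow> 0 \<le> P x"
    and P_le: "\<And>x. (\<forall>j\<in>U. \<bar>x j\<bar> \<le> R2) \<Longrightarrow> (\<forall>g\<in>set GX. 0 \<le> g x) \<Longrightarrow> P x \<le> e1"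
    and P_ge: "\<And>x g. (\<forall>j\<in>U. \<bar>x j\<bar> \<le> R2) \<Longrightarrow> g \<in> set GX \<Longrightarrow> M * - g x \<le> P x"
    using penalty_polynomial[OF GX M e1(1), of R2] by blast
  obtain Q where Q: "Q \<in> polys U" and Q_nn: "\<And>x. (\<forall>j\<in>U. \<bar>x j\<bar> \<le> R2) \<Longrightarrow> 0 \<le> Q x"
    and Q_le: "\<And>x. (\<forall>j\<in>U. \<bar>x j\<bar> \<le> R2) \<Longrightarrow> (\<forall>g\<in>set GY. 0 \<le> g x) \<Longrightarrow> Q x \<le> e1"
    and Q_ge: "\<And>x g. (\<forall>j\<in>U. \<bar>x j\<bar> \<le> R2) \<Longrightarrow> g \<in> set GY \<Longrightarrow> M * - g x \<le> Q x"
    using penalty_polynomial[OF GY M e1(1), of R2] by blast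
  obtain DP where DP: "0 \<le> DP" "\<And>x. (\<forall>i\<in>U. \<bar>x i\<bar> \<le> R2) \<Longrightarrow> (\<Sum>j\<in>U. \<bar>dx j (\<lambda>_. P) 0 x\<bar>) \<le> DP"
    using gradient_bounded[OF finU P, of R2] by blast
  obtain DQ where DQ: "0 \<le> DQ" "\<And>x. (\<forall>i\<in>U. \<bar>x i\<bar> \<le> R2) \<Longrightarrow> (\<Sum>j\<in>U. \<bar>dx j (\<lambda>_. Q) 0 x\<bar>) \<le> DQ"
    using gradient_bounded[OF finU Q, of R2] by blast
  \<comment> \<open>\<open>K\<close> is the factor by which the defect of the trajectories enters
    that of \<open>v\<close>; \<open>H * \<eta>\<close> is the share of the former caused by the
    clipping error.\<close>
  define K where "K = DQ + T * DP"
  define H where "H = Lf * (1 + T) * exp (2 * Df * T)"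
  have K: "0 \<le> K" and H: "0 \<le> H" using DP DQ T_pos nonneg by (auto simp: K_def H_def)
  \<comment> \<open>The penalties and their gradient bounds on the box of radius \<open>R2\<close>
    are fixed by now, so the accuracy may depend on them. The number of iterations is chosen
    afterwards, for this \<open>\<eta>\<close>.\<close>
  define \<eta> where "\<eta> = min 1 (min (d / (2 * (Lf + 1))) (e1 / (2 * (H * K + 1))))"
  have \<eta>: "0 < \<eta>" "\<eta> \<le> 1" using d e1 H K nonneg by (auto simp: \<eta>_def intro!: divide_pos_pos add_nonneg_pos)
  have half: "u * (w / (2 * u)) = w / 2" if "u > 0" for u w :: real
    using that by simp
  have \<eta>_d: "Lf * \<eta> \<le> d / 2"
  proof -
    have "Lf * \<eta> \<le> (Lf + 1) * \<eta>" using \<eta> by simp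
    also have "\<dots> \<le> (Lf + 1) * (d / (2 * (Lf + 1)))" using nonneg by (intro mult_left_mono) (auto simp: \<eta>_def)
    also have "\<dots> = d / 2" using half[of "Lf + 1" d] nonneg by simp
    finally show ?thesis .
  qed
  have \<eta>_e: "H * \<eta> * K \<le> e1 / 2"
  proof -
    have HK: "0 \<le> H * K" using H K by simp
    have "H * \<eta> * K \<le> (H * K + 1) * \<eta>" using \<eta> by (simp add: algebra_simps)
    also have "\<dots> \<le> (H * K + 1) * (e1 / (2 * (H * K + 1)))" using HK by (intro mult_left_mono) (auto simp: \<eta>_def)
    also have "\<dots> = e1 / 2" using half[of "H * K + 1" e1] HK by simp
    finally show ?thesis .
  qed
  obtain c q where cq: "real_polynomial_function c" "\<And>u. (c has_real_derivative q u) (at u)"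
    "\<And>u. \<bar>u\<bar> \<le> R2 \<Longrightarrow> \<bar>c u - sat R u\<bar> \<le> \<eta> \<and> \<bar>q u\<bar> \<le> 2"
    using sat_polynomial_approx[OF nonneg(1) R2(2) \<eta>(1)] by blast
  interpret picard U f T R B Lf Df c q \<eta>
    by unfold_locales (use \<eta> cq in blast)+
  have "\<forall>\<^sub>F k in sequentially. K * B * (2 * Df * T) ^ Suc k / fact (Suc k) < e1 / 2"
    using order_tendstoD(2)[OF LIMSEQ_Suc[OF power_over_fact_tendsto_zero[of "K * B" "2 * Df * T"]], of "e1 / 2"] e1
    by simp
  moreover have "\<forall>\<^sub>F k in sequentially. 2 * Lf * (2 * R2) * (2 * Lf * T) ^ k / fact k < d / 2"
    using order_tendstoD(2)[OF power_over_fact_tendsto_zero[of "2 * Lf * (2 * R2)" "2 * Lf * T"], of "d / 2"] d by simp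
  ultimately have "\<forall>\<^sub>F k in sequentially. K * B * (2 * Df * T) ^ Suc k / fact (Suc k) < e1 / 2 \<and>
    2 * Lf * (2 * R2) * (2 * Lf * T) ^ k / fact k < d / 2" by eventually_elim auto
  then obtain k where k: "K * B * (2 * Df * T) ^ Suc k / fact (Suc k) < e1 / 2"
    "2 * Lf * (2 * R2) * (2 * Lf * T) ^ k / fact k < d / 2" by (auto simp: eventually_sequentially)
  define E where "E = B * (2 * Df * T) ^ Suc k / fact (Suc k) + Lf * \<eta> * (1 + T) * exp (2 * Df * T)"
  have E: "0 \<le> E" using nonneg \<eta> T_pos by (auto simp: E_def)
  have KE: "K * E < e1"
  proof -
    have "K * E = K * B * (2 * Df * T) ^ Suc k / fact (Suc k) + H * \<eta> * K"
      by (simp add: E_def H_def algebra_simps)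
    then show ?thesis using k(1) \<eta>_e by linarith
  qed
  define z where "z x s i = phi (Suc k) i s x" for x s i
  define Pz where "Pz = (\<lambda>t x. P (\<lambda>i. phi (Suc k) i t x))"
  define Qz where "Qz = (\<lambda>t x. Q (\<lambda>i. phi (Suc k) i t x))"
  have Pz: "Pz \<in> tpolys U" unfolding Pz_def by (intro tpolys_comp[OF P] phi_closed)
  have Qz: "Qz \<in> tpolys U" unfolding Qz_def by (intro tpolys_comp[OF Q] phi_closed)
  define W where "W = antideriv Pz"
  have W: "W \<in> tpolys U" "\<And>x. W 0 x = 0" "\<And>t x. ((\<lambda>s. W s x) has_real_derivative Pz t x) (at t)"
    unfolding W_def by (intro antideriv Pz)+
  define V where "V = (\<lambda>t x. Qz t x + W t x)"
  have V: "V \<in> tpolys U" unfolding V_def by (intro tpolys.add Qz W)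
  define a b where "a = 3 * e1 * T + 2 * e1" and "b = 3 * e1"
  define v where "v = (\<lambda>t x. (a + (-b) * t) + (-1) * V (T - t) x)"
  have VT: "(\<lambda>t x. V (T - t) x) \<in> tpolys U"
    by (rule tpolys_time_comp[OF V tpolys_diff[OF tpolys.const tpolys.time]])
  have bt: "(\<lambda>t x. (-b) * t) \<in> tpolys U" by (rule tpolys.mult[OF tpolys.const tpolys.time])
  have lin: "(\<lambda>t x. a + (-b) * t) \<in> tpolys U" by (rule tpolys.add[OF tpolys.const bt])
  have mV: "(\<lambda>t x. (-1) * V (T - t) x) \<in> tpolys U" by (rule tpolys.mult[OF tpolys.const VT])
  have v: "v \<in> tpolys U" unfolding v_def by (rule tpolys.add[OF lin mV])
  have Lv: "Lop f U v t x = - b + transport V (T - t) x" for t x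
  proof -
    have "Lop f U (\<lambda>t x. a + (-b) * t) = (\<lambda>t x. - b)"
      using Lop_add[OF tpolys.const bt, of f U a] Lop_mult[OF tpolys.const tpolys.time, of f U "-b"] by (simp add: Lop_simps)
    moreover have "Lop f U (\<lambda>t x. (-1) * V (T - t) x) = (\<lambda>t x. transport V (T - t) x)"
      using Lop_mult[OF tpolys.const VT, of f U "-1"] Lop_reverse_time[OF finU V, of f T]
      by (simp add: Lop_simps transport_def)
    ultimately show ?thesis unfolding v_def Lop_add[OF lin mV] by simp
  qed
  have linear_deriv: "((\<lambda>s. s * m) has_real_derivative m) (at r within S)" for m r S
    by (auto intro!: derivative_eq_intros)
  have phi0: "g (\<lambda>i. phi (Suc k) i 0 x) = g x" if "g \<in> polys U" for g x
    by (rule polys_cong[OF that]) (simp add: phi_0)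
  have comp_bound: "\<bar>transport (\<lambda>t x. p (\<lambda>i. phi (Suc k) i t x)) s x\<bar> \<le> D * E"
    if p: "p \<in> polys U" and D: "\<And>x. (\<forall>i\<in>U. \<bar>x i\<bar> \<le> R2) \<Longrightarrow> (\<Sum>j\<in>U. \<bar>dx j (\<lambda>_. p) 0 x\<bar>) \<le> D"
      and xR: "\<forall>j\<in>U. \<bar>x j\<bar> \<le> R" and s: "s \<in> {0..T}" for p D x s
  proof -
    have x: "\<And>j. j \<in> U \<Longrightarrow> \<bar>x j\<bar> \<le> R" using xR by blast
    have eq: "transport (\<lambda>t x. p (\<lambda>i. phi (Suc k) i t x)) s x =
        (\<Sum>j\<in>U. dx j (\<lambda>_. p) 0 (\<lambda>j. phi (Suc k) j s x) * transport (phi (Suc k) j) s x)"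
      by (rule transport_comp[OF p phi_closed])
    have "\<bar>transport (\<lambda>t x. p (\<lambda>i. phi (Suc k) i t x)) s x\<bar> \<le> (\<Sum>j\<in>U. \<bar>dx j (\<lambda>_. p) 0 (\<lambda>j. phi (Suc k) j s x)\<bar> * E)"
      unfolding eq
    proof (rule order_trans[OF sum_abs sum_mono])
      fix j assume j: "j \<in> U"
      show "\<bar>dx j (\<lambda>_. p) 0 (\<lambda>j. phi (Suc k) j s x) * transport (phi (Suc k) j) s x\<bar>
        \<le> \<bar>dx j (\<lambda>_. p) 0 (\<lambda>j. phi (Suc k) j s x)\<bar> * E"
        unfolding abs_mult E_def by (rule mult_left_mono[OF phi_transport[OF x s j]]) auto
    qed
    also have "\<dots> = (\<Sum>j\<in>U. \<bar>dx j (\<lambda>_. p) 0 (\<lambda>j. phi (Suc k) j s x)\<bar>) * E"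
      by (rule sum_distrib_right[symmetric])
    also have "\<dots> \<le> D * E"
      using phi_R2[OF x s] by (intro mult_right_mono D E) auto
    finally show ?thesis .
  qed
  \<comment> \<open>For an exact flow the transport of the integrated penalty is constantly
    \<open>P x\<close>. The deviation has the transport of the integrand as its time derivative,
    which is at most \<open>DP * E\<close>.\<close>
  have W_bound: "transport W s x \<le> P x + T * (DP * E)"
    if x: "\<forall>j\<in>U. \<bar>x j\<bar> \<le> R" and s: "s \<in> {0..T}" for x s
  proof -
    have dtW: "dt W = Pz" by (rule dt_eqI) (rule W(3))
    have z0: "(\<lambda>t x. 0) \<in> tpolys U" by (rule tpolys.const)
    have "transport W 0 x = Pz 0 x"
      using transport_initial[OF W(1), of "\<lambda>_. 0" x] z0 by (simp add: W(2) dtW dx_simps)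
    also have "\<dots> = P x" unfolding Pz_def by (rule phi0[OF P])
    finally have 0: "transport W 0 x = P x" .
    have "0 * (DP * E) - transport W 0 x \<le> s * (DP * E) - transport W s x"
    proof (rule nondecreasing_Icc[of 0 s "\<lambda>s. s * (DP * E) - transport W s x" "\<lambda>s. DP * E - transport Pz s x"])
      show "((\<lambda>s. s * (DP * E) - transport W s x) has_real_derivative DP * E - transport Pz r x) (at r within {0..s})" for r
        using DERIV_diff[OF linear_deriv has_field_derivative_at_within[OF transport_time_deriv[OF W(1)]]]
        unfolding dtW .
      show "0 \<le> DP * E - transport Pz r x" if "r \<in> {0..s}" for r
        using comp_bound[OF P DP(2) x, where s = r] that s unfolding Pz_def by (auto dest: abs_le_D1)
    qed (use s in auto)
    moreover have "s * (DP * E) \<le> T * (DP * E)" using s DP E by (intro mult_right_mono) auto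
    ultimately show ?thesis using 0 by simp
  qed
  have X: "\<And>j. j \<in> U \<Longrightarrow> \<bar>x j\<bar> \<le> R" if "\<forall>g\<in>set GX. 0 \<le> g x" for x using GX_box[OF that] .
  have X': "\<forall>j\<in>U. \<bar>x j\<bar> \<le> R" if "\<forall>g\<in>set GX. 0 \<le> g x" for x using GX_box[OF that] by blast
  have c1: "Lop f U v t x < 0" if t: "t \<in> {0..T}" and x: "\<forall>g\<in>set GX. 0 \<le> g x" for t x
  proof -
    have s: "T - t \<in> {0..T}" using t by auto
    have "transport V (T - t) x = transport Qz (T - t) x + transport W (T - t) x"
      unfolding transport_def V_def Lop_add[OF Qz W(1)] ..
    also have "\<dots> \<le> DQ * E + (P x + T * (DP * E))"
      using comp_bound[OF Q DQ(2) X'[OF x] s] W_bound[OF X'[OF x] s] unfolding Qz_def by linarith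
    also have "\<dots> = K * E + P x" by (simp add: K_def algebra_simps)
    also have "\<dots> < e1 + e1" using KE P_le[OF _ x] X[OF x] R2 by (force intro: add_less_le_mono)
    finally show ?thesis unfolding Lv b_def using e1 by simp
  qed
  have c2: "0 < v T x" if x: "\<forall>g\<in>set GY. 0 \<le> g x" for x
  proof -
    have "Qz 0 x = Q x" unfolding Qz_def by (rule phi0[OF Q])
    then have "v T x = 2 * e1 - Q x" by (simp add: v_def V_def W(2) a_def b_def)
    moreover have "Q x \<le> e1" using Q_le[OF _ x] GY_box[OF x] R2 by force
    ultimately show ?thesis using e1 by linarith
  qed
  have a_e: "a = e" using e1(2) by (simp add: a_def algebra_simps)
  have c3: "(\<forall>i\<in>U. z x 0 i = x i) \<and>
      (\<forall>s\<in>{0..T}. \<forall>i\<in>U. ((\<lambda>s. z x s i) has_real_derivative F i (\<lambda>j. phi k j s x)) (at s within {0..T}) \<and>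
         \<bar>F i (\<lambda>j. phi k j s x) - fs i (z x s)\<bar> \<le> d \<and> \<bar>z x s i\<bar> \<le> R2) \<and>
      v 0 x \<le> e \<and> (\<forall>g\<in>set GY. v 0 x \<le> e - M * - g (z x T)) \<and>
      (\<forall>g\<in>set GX. \<forall>p a b. 0 \<le> a \<longrightarrow> a \<le> b \<longrightarrow> b \<le> T \<longrightarrow> (\<forall>s\<in>{a..b}. g (z x s) \<le> - p) \<longrightarrow> v 0 x \<le> e - M * p * (b - a))"
    if x: "\<forall>g\<in>set GX. 0 \<le> g x" for x
  proof (intro conjI ballI allI impI)
    have zR: "\<forall>i\<in>U. \<bar>z x s i\<bar> \<le> R2" if "s \<in> {0..T}" for s
      unfolding z_def using phi_R2[of x, OF X[OF x] that] by blast
    have Pz_z: "Pz s x = P (z x s)" "Qz s x = Q (z x s)" for s by (simp_all add: Pz_def Qz_def z_def[abs_def])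
    have v0: "v 0 x = e - Q (z x T) - W T x" by (simp add: v_def V_def Pz_z a_e)
    \<comment> \<open>Used with \<open>m = M * p\<close> on an interval of violation and with
      \<open>m = 0\<close> elsewhere.\<close>
    have W_incr: "W r x + m * (r' - r) \<le> W r' x" if "0 \<le> r" "r \<le> r'" "r' \<le> T" "\<And>s. s \<in> {r..r'} \<Longrightarrow> m \<le> P (z x s)" for r r' m
    proof -
      have "W r x - r * m \<le> W r' x - r' * m"
      proof (rule nondecreasing_Icc[OF that(2), of "\<lambda>s. W s x - s * m" "\<lambda>s. Pz s x - m"])
        show "((\<lambda>s. W s x - s * m) has_real_derivative Pz s x - m) (at s within {r..r'})" for s
          by (rule DERIV_diff[OF has_field_derivative_at_within[OF W(3)] linear_deriv])
      qed (use that(4) Pz_z in auto)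
      then show ?thesis by (simp add: algebra_simps)
    qed
    have WT: "0 \<le> W T x" using W_incr[of 0 T 0] P_nn zR T_pos W(2) by auto
    have QT: "0 \<le> Q (z x T)" using Q_nn zR[of T] T_pos by auto
    show "z x 0 i = x i" if "i \<in> U" for i unfolding z_def by (rule phi_0[OF that])
    show "((\<lambda>s. z x s i) has_real_derivative F i (\<lambda>j. phi k j s x)) (at s within {0..T})" if "i \<in> U" for s i
      unfolding z_def by (rule has_field_derivative_at_within[OF phi_deriv[OF that]])
    show "\<bar>F i (\<lambda>j. phi k j s x) - fs i (z x s)\<bar> \<le> d" if "s \<in> {0..T}" "i \<in> U" for s i
      using phi_defect[of x, OF X[OF x] that, of k] k(2) \<eta>_d unfolding z_def by (simp add: mult.assoc)
    show "\<bar>z x s i\<bar> \<le> R2" if "s \<in> {0..T}" "i \<in> U" for s i using zR that by blast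
    show "v 0 x \<le> e" using v0 WT QT by simp
    show "v 0 x \<le> e - M * - g (z x T)" if "g \<in> set GY" for g
      using Q_ge[OF zR[of T] that] v0 WT T_pos by simp
    show "v 0 x \<le> e - M * p * (b - a)"
      if g: "g \<in> set GX" and ab: "0 \<le> a" "a \<le> b" "b \<le> T" and p: "\<forall>s\<in>{a..b}. g (z x s) \<le> - p" for g p a b
    proof -
      have "W a x + M * p * (b - a) \<le> W b x"
      proof (rule W_incr[OF ab])
        fix s assume s: "s \<in> {a..b}"
        then have "M * p \<le> M * - g (z x s)" using p M by (intro mult_left_mono) force+
        also have "\<dots> \<le> P (z x s)" using s ab zR by (intro P_ge g) auto
        finally show "M * p \<le> P (z x s)" .
      qed
      moreover have "W 0 x + 0 * (a - 0) \<le> W a x" using P_nn zR ab by (intro W_incr) auto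
      moreover have "W b x + 0 * (T - b) \<le> W T x" using P_nn zR ab by (intro W_incr) auto
      ultimately show ?thesis using v0 QT W(2)[of x] by simp
    qed
  qed
  show ?thesis
    apply (rule bexI[OF _ v], rule exI[of _ z], rule exI[of _ "\<lambda>x s i. F i (\<lambda>j. phi k j s x)"])
    apply (rule conjI[OF _ conjI]; intro ballI allI impI)
      apply (rule c1; assumption)
     apply (rule c2; assumption)
    apply (rule c3; assumption)
    done
qed

end

section \<open>Convergence of the subsolutions\<close>

definition admissible :: "nat set \<Rightarrow> (nat \<Rightarrow> (nat \<Rightarrow> real) \<Rightarrow> real) \<Rightarrow> real \<Rightarrow>
    ((nat \<Rightarrow> real) \<Rightarrow> real) list \<Rightarrow> ((nat \<Rightarrow> real) \<Rightarrow> real) list \<Rightarrow> (real \<Rightarrow> nat \<Rightarrow> real) \<Rightarrow> bool" where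
  "admissible U f T GX GY y \<longleftrightarrow> (\<forall>s\<in>{0..T}. \<forall>g\<in>set GX. 0 \<le> g (y s)) \<and> (\<forall>g\<in>set GY. 0 \<le> g (y T)) \<and>
     (\<forall>i\<in>U. \<forall>s\<in>{0..T}. ((\<lambda>s. y s i) has_real_derivative f i (y s)) (at s within {0..T}))"

text \<open>The region of attraction of the subsystem in the variables \<open>U\<close>. Only the
  initial point has to be extensional; curves may carry further coordinates, so one trajectory of
  the full system serves all subsystems.\<close>

definition reach :: "nat set \<Rightarrow> (nat \<Rightarrow> (nat \<Rightarrow> real) \<Rightarrow> real) \<Rightarrow> real \<Rightarrow>
    ((nat \<Rightarrow> real) \<Rightarrow> real) list \<Rightarrow> ((nat \<Rightarrow> real) \<Rightarrow> real) list \<Rightarrow> (nat \<Rightarrow> real) set" where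
  "reach U f T GX GY = {x \<in> PiE U (\<lambda>_. UNIV). \<exists>y. (\<forall>i\<in>U. y 0 i = x i) \<and> admissible U f T GX GY y}"

lemma value_nonneg:
  assumes U: "finite U" and T: "0 \<le> T" and v: "v \<in> tpolys U"
    and y: "\<And>i s. i \<in> U \<Longrightarrow> s \<in> {0..T} \<Longrightarrow> ((\<lambda>s. y s i) has_real_derivative f i (y s)) (at s within {0..T})"
    and L: "\<And>s. s \<in> {0..T} \<Longrightarrow> Lop f U v s (y s) \<le> 0" and terminal: "0 \<le> v T (y T)"
  shows "0 \<le> v 0 (y 0)"
proof -
  have "- v 0 (y 0) \<le> - v T (y T)"
  proof (rule nondecreasing_Icc[OF T])
    show "((\<lambda>s. - v s (y s)) has_real_derivative - Lop f U v s (y s)) (at s within {0..T})" if "s \<in> {0..T}" for s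
      by (rule DERIV_minus[OF tpolys_solution_deriv[where y = y and f = f, OF U y[OF _ that] v]])
  qed (use L in auto)
  then show ?thesis using terminal by simp
qed

section \<open>Limits of the approximate trajectories\<close>

context ode_system
begin

text \<open>Gronwall makes the sequence Cauchy, and uniform convergence of the derivatives passes
  the equation to the limit. The exact trajectory of the clipped field is thus obtained from the
  approximations themselves, with a rate.\<close>

lemma approximate_solutions_converge:
  assumes z: "\<And>m s i. s \<in> {0..T} \<Longrightarrow> i \<in> U \<Longrightarrow> ((\<lambda>s. z m s i) has_real_derivative z' m s i) (at s within {0..T})"
    and zf: "\<And>m s i. s \<in> {0..T} \<Longrightarrow> i \<in> U \<Longrightarrow> \<bar>z' m s i - fs i (z m s)\<bar> \<le> d m"
    and zR: "\<And>m s i. s \<in> {0..T} \<Longrightarrow> i \<in> U \<Longrightarrow> \<bar>z m s i\<bar> \<le> R2"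
    and z0: "\<And>m i. i \<in> U \<Longrightarrow> z m 0 i = x i" and d: "d \<longlonglongrightarrow> 0"
  shows "\<exists>\<Phi>. (\<forall>i\<in>U. \<Phi> 0 i = x i) \<and> (\<forall>s\<in>{0..T}. \<forall>i\<in>U. \<bar>\<Phi> s i\<bar> \<le> R2 \<and>
      ((\<lambda>s. \<Phi> s i) has_real_derivative fs i (\<Phi> s)) (at s within {0..T})) \<and>
      (\<forall>m. \<forall>s\<in>{0..T}. \<forall>i\<in>U. \<bar>z m s i - \<Phi> s i\<bar> \<le> d m * ((1 + T) * exp (Lf * T)))"
proof -
  define K where "K = (1 + T) * exp (Lf * T)"
  have K: "0 < K" using T_pos by (simp add: K_def)
  have diff: "\<bar>z m s i - z l s i\<bar> \<le> (d m + d l) * K" if si: "s \<in> {0..T}" "i \<in> U" for m l s i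
    unfolding K_def mult.assoc[symmetric]
  proof (rule gronwall[OF z z zf zf _ _ si])
    show "\<bar>z m s i - z l s i\<bar> \<le> 2 * R2" if "s \<in> {0..T}" "i \<in> U" for s i
      using zR[OF that, of m] zR[OF that, of l] by linarith
  qed (simp_all add: z0)
  define \<Phi> where "\<Phi> s i = lim (\<lambda>m. z m s i)" for s i
  have conv: "(\<lambda>m. z m s i) \<longlonglongrightarrow> \<Phi> s i" if si: "s \<in> {0..T}" "i \<in> U" for s i
  proof -
    have "Cauchy (\<lambda>m. z m s i)"
    proof (rule metric_CauchyI)
      fix e :: real assume e: "0 < e"
      then obtain N where N: "\<And>m. m \<ge> N \<Longrightarrow> \<bar>d m\<bar> < e / (2 * K)"
        using LIMSEQ_D[OF d, of "e / (2 * K)"] K by auto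
      have "dist (z m s i) (z l s i) < e" if "m \<ge> N" "l \<ge> N" for m l
      proof -
        have "(d m + d l) * K < (e / (2 * K) + e / (2 * K)) * K"
          using N[OF that(1)] N[OF that(2)] K by (intro mult_strict_right_mono) auto
        also have "\<dots> = e" using K by (simp add: field_simps)
        finally show ?thesis using diff[OF si, of m l] by (simp add: dist_real_def)
      qed
      then show "\<exists>M. \<forall>m\<ge>M. \<forall>n\<ge>M. dist (z m s i) (z n s i) < e" by blast
    qed
    then show ?thesis unfolding \<Phi>_def using Cauchy_convergent_iff convergent_LIMSEQ_iff by blast
  qed
  have close: "\<bar>z m s i - \<Phi> s i\<bar> \<le> d m * K" if si: "s \<in> {0..T}" "i \<in> U" for m s i
  proof (rule LIMSEQ_le)
    show "(\<lambda>l. \<bar>z m s i - z l s i\<bar>) \<longlonglongrightarrow> \<bar>z m s i - \<Phi> s i\<bar>" by (intro tendsto_intros conv si)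
    have "(\<lambda>l. (d m + d l) * K) \<longlonglongrightarrow> (d m + 0) * K" by (intro tendsto_intros d)
    then show "(\<lambda>l. (d m + d l) * K) \<longlonglongrightarrow> d m * K" by simp
  qed (use diff[OF si] in auto)
  have bound: "\<bar>\<Phi> s i\<bar> \<le> R2" if si: "s \<in> {0..T}" "i \<in> U" for s i
    by (rule LIMSEQ_le_const2[OF tendsto_rabs[OF conv[OF si]]]) (use zR[OF si] in auto)
  have init: "\<Phi> 0 i = x i" if "i \<in> U" for i
    using LIMSEQ_unique[OF conv[of 0 i]] that T_pos z0 by auto
  have deriv: "((\<lambda>s. \<Phi> s i) has_real_derivative fs i (\<Phi> s)) (at s within {0..T})" if si: "s \<in> {0..T}" and i: "i \<in> U" for s i
  proof -
    have zero: "0 \<in> {0..T}" using T_pos by simp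
    have dd: "\<bar>z' m s i - fs i (\<Phi> s)\<bar> \<le> d m + Lf * (d m * K)" if s: "s \<in> {0..T}" for m s
    proof -
      have "0 \<le> d m" using zf[OF s i, of m] by linarith
      then have "\<bar>fs i (z m s) - fs i (\<Phi> s)\<bar> \<le> Lf * (d m * K)" using K close[OF s] by (intro fs_lipschitz[OF i]) auto
      then show ?thesis using zf[OF s i, of m] by linarith
    qed
    have lim0: "(\<lambda>m. d m + Lf * (d m * K)) \<longlonglongrightarrow> 0"
      using tendsto_add[OF d tendsto_mult[OF tendsto_const tendsto_mult[OF d tendsto_const]], of Lf K] by simp
    have "\<exists>g. \<forall>s\<in>{0..T}. (\<lambda>m. z m s i) \<longlonglongrightarrow> g s \<and> (g has_derivative (\<lambda>h. fs i (\<Phi> s) * h)) (at s within {0..T})"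
    proof (rule has_derivative_sequence[where f = "\<lambda>m s. z m s i" and f' = "\<lambda>m s h. z' m s i * h",
          OF convex_real_interval(5) _ _ zero conv[OF zero i]])
      show "((\<lambda>s. z m s i) has_derivative (*) (z' m s i)) (at s within {0..T})" if "s \<in> {0..T}" for m s
        using z[OF that i] by (simp add: has_field_derivative_def)
      fix e :: real assume e: "0 < e"
      have "\<forall>\<^sub>F m in sequentially. d m + Lf * (d m * K) < e" using order_tendstoD(2)[OF lim0 e] .
      then show "\<forall>\<^sub>F m in sequentially. \<forall>s\<in>{0..T}. \<forall>h. norm (z' m s i * h - fs i (\<Phi> s) * h) \<le> e * norm h"
      proof eventually_elim
        case (elim m)
        have "norm (z' m s i * h - fs i (\<Phi> s) * h) \<le> e * norm h" if "s \<in> {0..T}" for s h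
        proof -
          have "norm (z' m s i * h - fs i (\<Phi> s) * h) = \<bar>z' m s i - fs i (\<Phi> s)\<bar> * norm h"
            by (simp add: left_diff_distrib[symmetric] abs_mult)
          also have "\<dots> \<le> e * norm h" using dd[OF that, of m] elim by (intro mult_right_mono) auto
          finally show ?thesis .
        qed
        then show ?case by blast
      qed
    qed
    then obtain g where g: "\<And>s. s \<in> {0..T} \<Longrightarrow> (\<lambda>m. z m s i) \<longlonglongrightarrow> g s"
      "\<And>s. s \<in> {0..T} \<Longrightarrow> (g has_real_derivative fs i (\<Phi> s)) (at s within {0..T})"
      unfolding has_field_derivative_def by blast
    have "g s = \<Phi> s i" if "s \<in> {0..T}" for s using LIMSEQ_unique[OF g(1) conv] that i by blast
    then show ?thesis
      using has_field_derivative_transform_within[OF g(2)[OF si], of 1 "\<lambda>s. \<Phi> s i"] si by auto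
  qed
  show ?thesis
    by (rule exI[of _ \<Phi>]) (use init bound deriv close in \<open>auto simp: K_def\<close>)
qed

text \<open>An integral penalty does not see a violation at a single instant; continuity spreads it
  over an interval of positive length, also at the ends of \<open>[0, T]\<close>.\<close>

lemma negative_on_interval:
  assumes h: "continuous_on {0..T} h" and s0: "s0 \<in> {0..T}" and neg: "h s0 < - p"
  shows "\<exists>a b. 0 \<le> a \<and> a < b \<and> b \<le> T \<and> (\<forall>s\<in>{a..b}. h s \<le> - (p :: real))"
proof -
  obtain e where e: "0 < e" "\<And>s. s \<in> {0..T} \<Longrightarrow> \<bar>s - s0\<bar> < e \<Longrightarrow> \<bar>h s - h s0\<bar> < - p - h s0"
    using h[unfolded continuous_on_iff, rule_format, OF s0, of "- p - h s0"] neg by (auto simp: dist_real_def)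
  define a b where "a = max 0 (s0 - e / 2)" and "b = min T (s0 + e / 2)"
  have "h s \<le> - p" if "s \<in> {a..b}" for s
  proof -
    have "s \<in> {0..T}" "\<bar>s - s0\<bar> < e" using that e(1) by (auto simp: a_def b_def)
    then show ?thesis using e(2)[of s] by linarith
  qed
  moreover have "0 \<le> a" "a < b" "b \<le> T" using s0 e(1) T_pos by (auto simp: a_def b_def)
  ultimately show ?thesis by blast
qed

text \<open>The penalty weight is \<open>m\<close> and the tolerance \<open>1 / (m + 1)\<close>. For
  a point off the region the limit trajectory violates some constraint: otherwise it would stay in
  the box where the clipped field is \<open>f\<close> and be admissible. The growing weight then
  drives \<open>v m 0 x\<close> below \<open>-1\<close>.\<close>

theorem subsolution_sequence:
  assumes GX: "set GX \<subseteq> polys U" and GY: "set GY \<subseteq> polys U"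
    and boxes: "\<forall>x. (\<forall>g\<in>set GX. 0 \<le> g x) \<longrightarrow> (\<forall>j\<in>U. \<bar>x j\<bar> \<le> R)"
      "\<forall>x. (\<forall>g\<in>set GY. 0 \<le> g x) \<longrightarrow> (\<forall>j\<in>U. \<bar>x j\<bar> \<le> R)"
  shows "\<exists>v. (\<forall>m. v m \<in> tpolys U) \<and>
    (\<forall>m. \<forall>t\<in>{0..T}. \<forall>x. (\<forall>g\<in>set GX. 0 \<le> g x) \<longrightarrow> Lop f U (v m) t x < 0) \<and>
    (\<forall>m x. (\<forall>g\<in>set GY. 0 \<le> g x) \<longrightarrow> 0 < v m T x) \<and>
    (\<forall>m x. (\<forall>g\<in>set GX. 0 \<le> g x) \<longrightarrow> v m 0 x \<le> 1 / (real m + 1)) \<and>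
    (\<forall>x\<in>semialg U GX - reach U f T GX GY. \<forall>\<^sub>F m in sequentially. v m 0 x \<le> - 1)"
proof -
  define d where "d m = 1 / (real m + 1)" for m
  have d: "0 < d m" for m by (simp add: d_def)
  have d0: "d \<longlonglongrightarrow> 0" unfolding d_def using LIMSEQ_inverse_real_of_nat by (simp add: inverse_eq_divide add.commute)
  define sub where "sub m v z z' \<longleftrightarrow> v \<in> tpolys U \<and> (\<forall>t\<in>{0..T}. \<forall>x. (\<forall>g\<in>set GX. 0 \<le> g x) \<longrightarrow> Lop f U v t x < 0) \<and>
    (\<forall>x. (\<forall>g\<in>set GY. 0 \<le> g x) \<longrightarrow> 0 < v T x) \<and>
    (\<forall>x. (\<forall>g\<in>set GX. 0 \<le> g x) \<longrightarrow>
      (\<forall>i\<in>U. z x 0 i = x i) \<and>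
      (\<forall>s\<in>{0..T}. \<forall>i\<in>U. ((\<lambda>s. z x s i) has_real_derivative z' x s i) (at s within {0..T}) \<and>
         \<bar>z' x s i - fs i (z x s)\<bar> \<le> d m \<and> \<bar>z x s i\<bar> \<le> R2) \<and>
      v 0 x \<le> d m \<and> (\<forall>g\<in>set GY. v 0 x \<le> d m - real m * - g (z x T)) \<and>
      (\<forall>g\<in>set GX. \<forall>p a b. 0 \<le> a \<longrightarrow> a \<le> b \<longrightarrow> b \<le> T \<longrightarrow> (\<forall>s\<in>{a..b}. g (z x s) \<le> - p) \<longrightarrow>
        v 0 x \<le> d m - real m * p * (b - a)))" for m v and z z' :: "(nat \<Rightarrow> real) \<Rightarrow> real \<Rightarrow> nat \<Rightarrow> real"
  have "\<forall>m. \<exists>v z z'. sub m v z z'"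
  proof
    fix m
    show "\<exists>v z z'. sub m v z z'"
      using subsolution_exists[OF GX GY boxes, of "real m" "d m" "d m"] d[of m]
      unfolding sub_def Bex_def by (simp add: less_imp_le)
  qed
  then obtain v z z' where "\<And>m. sub m (v m) (z m) (z' m)" by metis
  note sub = this[unfolded sub_def]
  have "\<forall>\<^sub>F m in sequentially. v m 0 x \<le> - 1" if x: "x \<in> semialg U GX - reach U f T GX GY" for x
  proof -
    have xX: "\<forall>g\<in>set GX. 0 \<le> g x" and xU: "x \<in> PiE U (\<lambda>_. UNIV)" using x by (auto simp: semialg_def)
    have zx0: "z m x 0 i = x i" if "i \<in> U" for m i using sub[of m] xX that by blast
    have zxd: "((\<lambda>s. z m x s i) has_real_derivative z' m x s i) (at s within {0..T})"
      and zxf: "\<bar>z' m x s i - fs i (z m x s)\<bar> \<le> d m" and zxR: "\<bar>z m x s i\<bar> \<le> R2"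
      if "s \<in> {0..T}" "i \<in> U" for m s i using sub[of m] xX that by blast+
    have zxT: "v m 0 x \<le> d m - real m * - g (z m x T)" if "g \<in> set GY" for m g
      using sub[of m] xX that by blast
    have zxX: "v m 0 x \<le> d m - real m * p * (b - a)"
      if "g \<in> set GX" "0 \<le> a" "a \<le> b" "b \<le> T" "\<forall>s\<in>{a..b}. g (z m x s) \<le> - p" for m g p a b
      using sub[of m] xX that by blast
    define K where "K = (1 + T) * exp (Lf * T)"
    have K: "0 < K" using T_pos by (simp add: K_def)
    obtain \<Phi> where \<Phi>: "\<And>i. i \<in> U \<Longrightarrow> \<Phi> 0 i = x i" "\<And>s i. s \<in> {0..T} \<Longrightarrow> i \<in> U \<Longrightarrow> \<bar>\<Phi> s i\<bar> \<le> R2"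
      "\<And>s i. s \<in> {0..T} \<Longrightarrow> i \<in> U \<Longrightarrow> ((\<lambda>s. \<Phi> s i) has_real_derivative fs i (\<Phi> s)) (at s within {0..T})"
      "\<And>m s i. s \<in> {0..T} \<Longrightarrow> i \<in> U \<Longrightarrow> \<bar>z m x s i - \<Phi> s i\<bar> \<le> d m * K"
      using approximate_solutions_converge[where z = "\<lambda>m. z m x" and z' = "\<lambda>m. z' m x" and x = x, OF zxd zxf zxR zx0 d0]
      unfolding K_def by blast
    have close: "\<exists>N. \<forall>m\<ge>N. \<forall>s\<in>{0..T}. \<bar>g (z m x s) - g (\<Phi> s)\<bar> \<le> p" if g: "g \<in> polys U" and p: "0 < p" for g p
    proof -
      obtain L where L: "0 \<le> L" "\<And>x y b. (\<forall>i\<in>U. \<bar>x i\<bar> \<le> R2) \<Longrightarrow> (\<forall>i\<in>U. \<bar>y i\<bar> \<le> R2) \<Longrightarrow> 0 \<le> b \<Longrightarrow>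
          (\<forall>i\<in>U. \<bar>x i - y i\<bar> \<le> b) \<Longrightarrow> \<bar>g x - g y\<bar> \<le> L * b"
        using polys_lipschitz[OF g, of R2] by blast
      have "(\<lambda>m. L * (d m * K)) \<longlonglongrightarrow> L * (0 * K)" by (intro tendsto_intros d0)
      then have "\<forall>\<^sub>F m in sequentially. L * (d m * K) < p" using p by (intro order_tendstoD(2)) auto
      then obtain N where N: "\<And>m. m \<ge> N \<Longrightarrow> L * (d m * K) < p" by (auto simp: eventually_sequentially)
      have "\<bar>g (z m x s) - g (\<Phi> s)\<bar> \<le> p" if "m \<ge> N" "s \<in> {0..T}" for m s
      proof -
        have "0 \<le> d m * K" using d[of m] K by simp
        moreover have "\<forall>i\<in>U. \<bar>z m x s i\<bar> \<le> R2" using zxR that(2) by blast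
        ultimately have "\<bar>g (z m x s) - g (\<Phi> s)\<bar> \<le> L * (d m * K)" using \<Phi>(2,4) that(2) by (intro L(2)) auto
        then show ?thesis using N[OF that(1)] by simp
      qed
      then show ?thesis by blast
    qed
    have large: "\<exists>N. \<forall>m\<ge>N. d m - real m * p \<le> -1" if "0 < p" for p
    proof -
      obtain N :: nat where N: "2 / p < real N" using reals_Archimedean2 by blast
      have "d m - real m * p \<le> -1" if "m \<ge> N" for m
      proof -
        have "2 / p < real m" using N that by (meson less_le_trans of_nat_le_iff)
        then have "2 < real m * p" using \<open>0 < p\<close> by (simp add: field_simps)
        moreover have "d m \<le> 1" by (simp add: d_def)
        ultimately show ?thesis by linarith
      qed
      then show ?thesis by blast
    qed
    consider (T) g where "g \<in> set GY" "g (\<Phi> T) < 0" | (X) s g where "s \<in> {0..T}" "g \<in> set GX" "g (\<Phi> s) < 0"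
    proof (cases "(\<forall>g\<in>set GY. 0 \<le> g (\<Phi> T)) \<and> (\<forall>s\<in>{0..T}. \<forall>g\<in>set GX. 0 \<le> g (\<Phi> s))")
      case True
      have "fs i (\<Phi> s) = f i (\<Phi> s)" if "s \<in> {0..T}" "i \<in> U" for s i
        using True that boxes(1) by (intro fs_eq) blast+
      then have "admissible U f T GX GY \<Phi>" unfolding admissible_def using True \<Phi>(3) by auto
      then have "x \<in> reach U f T GX GY" unfolding reach_def using xU \<Phi>(1) by blast
      then show ?thesis using x by blast
    next
      case False
      then show ?thesis using that by (meson not_le)
    qed
    then show ?thesis
    proof cases
      case T
      \<comment> \<open>Half of the violation is given away to the distance of
        \<open>z m x T\<close> from the limit.\<close>
      define p where "p = - g (\<Phi> T) / 2"
      have p: "0 < p" using T by (simp add: p_def)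
      obtain N1 where N1: "\<forall>m\<ge>N1. \<forall>s\<in>{0..T}. \<bar>g (z m x s) - g (\<Phi> s)\<bar> \<le> p" using close[OF _ p, of g] T GY by blast
      obtain N2 where N2: "\<forall>m\<ge>N2. d m - real m * p \<le> -1" using large[OF p] by blast
      have "v m 0 x \<le> - 1" if m: "m \<ge> max N1 N2" for m
      proof -
        have "\<bar>g (z m x T) - g (\<Phi> T)\<bar> \<le> p" using N1 m T_pos by auto
        then have "p \<le> - g (z m x T)" unfolding p_def by linarith
        then have "real m * p \<le> real m * - g (z m x T)" by (intro mult_left_mono) auto
        moreover have "v m 0 x \<le> d m - real m * - g (z m x T)" using zxT T(1) by blast
        moreover have "d m - real m * p \<le> -1" using N2 m by auto
        ultimately show ?thesis by linarith
      qed
      then show ?thesis unfolding eventually_sequentially by blast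
    next
      case (X s0 g)
      \<comment> \<open>With quarters, the limit stays below \<open>- (2 * p)\<close> on an interval
        and its approximations below \<open>- p\<close>.\<close>
      define p where "p = - g (\<Phi> s0) / 4"
      have p: "0 < p" using X by (simp add: p_def)
      have gU: "g \<in> polys U" using X(2) GX by blast
      have "continuous_on {0..T} (\<lambda>s. g (\<Phi> s))"
        by (rule DERIV_continuous_on)
          (rule tpolys_solution_deriv[where y = \<Phi> and f = fs, OF finU \<Phi>(3) tpolys_of_polys[OF gU]])
      then obtain a b where ab: "0 \<le> a" "a < b" "b \<le> T" "\<forall>s\<in>{a..b}. g (\<Phi> s) \<le> - (2 * p)"
        using negative_on_interval[of "\<lambda>s. g (\<Phi> s)" s0 "2 * p"] X p unfolding p_def by auto
      obtain N1 where N1: "\<forall>m\<ge>N1. \<forall>s\<in>{0..T}. \<bar>g (z m x s) - g (\<Phi> s)\<bar> \<le> p" using close[OF gU p] by blast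
      obtain N2 where N2: "\<forall>m\<ge>N2. d m - real m * (p * (b - a)) \<le> -1" using large[of "p * (b - a)"] p ab by auto
      have "v m 0 x \<le> - 1" if m: "m \<ge> max N1 N2" for m
      proof -
        have "g (z m x s) \<le> - p" if s: "s \<in> {a..b}" for s
        proof -
          have "\<bar>g (z m x s) - g (\<Phi> s)\<bar> \<le> p" using N1 m s ab by auto
          moreover have "g (\<Phi> s) \<le> - (2 * p)" using ab(4) s by blast
          ultimately show ?thesis by linarith
        qed
        then have "v m 0 x \<le> d m - real m * p * (b - a)" using ab by (intro zxX[OF X(2)]) auto
        moreover have "d m - real m * (p * (b - a)) \<le> -1" using N2 m by auto
        ultimately show ?thesis by (simp add: mult.assoc)
      qed
      then show ?thesis unfolding eventually_sequentially by blast
    qed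
  qed
  then show ?thesis
    by (intro exI[of _ v]) (use sub in \<open>auto simp: d_def\<close>)
qed

end

section \<open>Convergence of a single relaxation\<close>

lemma ball_bounded_box:
  assumes U: "finite U" and b: "ball_bounded U gs"
  shows "\<exists>R\<ge>0. \<forall>x. (\<forall>g\<in>set gs. 0 \<le> g x) \<longrightarrow> (\<forall>j\<in>U. \<bar>x j\<bar> \<le> R)"
proof -
  have "\<exists>r\<ge>0. \<forall>x. (\<forall>g\<in>set gs. 0 \<le> g x) \<longrightarrow> \<bar>x i\<bar> \<le> r" if i: "i \<in> U" for i
  proof -
    obtain W r where W: "finite W" "i \<in> W" "(\<lambda>x. r\<^sup>2 - (\<Sum>i\<in>W. (x i)\<^sup>2)) \<in> set gs"
      using b i by (auto simp: ball_bounded_def)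
    have "\<bar>x i\<bar> \<le> \<bar>r\<bar>" if "\<forall>g\<in>set gs. 0 \<le> g x" for x
    proof -
      have "(x i)\<^sup>2 \<le> (\<Sum>i\<in>W. (x i)\<^sup>2)" using W by (intro member_le_sum) auto
      also have "\<dots> \<le> r\<^sup>2" using that[rule_format, OF W(3)] by simp
      finally show ?thesis by (simp add: abs_le_square_iff)
    qed
    then show ?thesis by (intro exI[of _ "\<bar>r\<bar>"]) auto
  qed
  then obtain r where r: "\<And>i. i \<in> U \<Longrightarrow> 0 \<le> r i" "\<And>i x. i \<in> U \<Longrightarrow> (\<forall>g\<in>set gs. 0 \<le> g x) \<Longrightarrow> \<bar>x i\<bar> \<le> r i"
    by metis
  have "\<bar>x i\<bar> \<le> sum r U" if "i \<in> U" "\<forall>g\<in>set gs. 0 \<le> g x" for i x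
    using r(2)[OF that] member_le_sum[of i U r] r(1) U that(1) by auto
  then show ?thesis using r(1) by (intro exI[of _ "sum r U"]) (auto intro!: sum_nonneg)
qed

lemma space_lebV: "space (lebV V) = PiE V (\<lambda>_. UNIV)"
  by (simp add: space_PiM)

lemma semialg_measurable:
  assumes "set gs \<subseteq> polys U"
  shows "semialg U gs \<in> sets (lebV U)"
proof -
  have "{x \<in> space (lebV U). \<forall>g\<in>set gs. 0 \<le> g x} \<in> sets (lebV U)"
  proof (rule sets.sets_Collect_finite_All)
    fix g assume "g \<in> set gs"
    then have [measurable]: "g \<in> borel_measurable (lebV U)" using assms polys_measurable by blast
    show "{x \<in> space (lebV U). 0 \<le> g x} \<in> sets (lebV U)" by measurable
  qed simp
  then show ?thesis by (simp add: semialg_def space_lebV)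
qed

lemma box_finite:
  assumes "finite U"
  shows "PiE U (\<lambda>_. {-R..R}) \<in> sets (lebV U)" "emeasure (lebV U) (PiE U (\<lambda>_. {-R..R :: real})) < \<infinity>"
proof -
  interpret finite_product_sigma_finite "\<lambda>_. lborel :: real measure" U
    by unfold_locales (rule assms)
  show "PiE U (\<lambda>_. {-R..R}) \<in> sets (lebV U)" using assms by (intro sets_PiM_I_finite) auto
  have "emeasure (lebV U) (PiE U (\<lambda>_. {-R..R})) = (\<Prod>i\<in>U. emeasure lborel {-R..R})"
    by (rule measure_times) auto
  also have "\<dots> = (\<Prod>i\<in>U. ennreal (max 0 (2 * R)))" by (intro prod.cong) (auto simp: emeasure_lborel_Icc_eq)
  also have "\<dots> = ennreal (\<Prod>i\<in>U. max 0 (2 * R))" by (rule prod_ennreal) simp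
  also have "\<dots> < \<infinity>" by simp
  finally show "emeasure (lebV U) (PiE U (\<lambda>_. {-R..R})) < \<infinity>" .
qed

lemma semialg_finite:
  assumes U: "finite U" and b: "ball_bounded U gs"
  shows "emeasure (lebV U) (semialg U gs) < \<infinity>"
proof -
  obtain R where R: "\<forall>x. (\<forall>g\<in>set gs. 0 \<le> g x) \<longrightarrow> (\<forall>j\<in>U. \<bar>x j\<bar> \<le> R)" using ball_bounded_box[OF assms] by blast
  have "semialg U gs \<subseteq> PiE U (\<lambda>_. {-R..R})"
  proof
    fix x assume x: "x \<in> semialg U gs"
    then have "\<forall>j\<in>U. \<bar>x j\<bar> \<le> R" using R by (simp add: semialg_def)
    then show "x \<in> PiE U (\<lambda>_. {-R..R})" using x by (auto simp: semialg_def PiE_def Pi_def abs_le_iff)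
  qed
  then have "emeasure (lebV U) (semialg U gs) \<le> emeasure (lebV U) (PiE U (\<lambda>_. {-R..R}))"
    by (intro emeasure_mono box_finite U)
  then show ?thesis using box_finite(2)[OF U, of R] by (meson le_less_trans)
qed

lemma polys_integrable_on_semialg:
  assumes U: "finite U" and gs: "set gs \<subseteq> polys U" and b: "ball_bounded U gs" and p: "p \<in> polys U"
    and A: "A \<in> sets (lebV U)" "A \<subseteq> semialg U gs"
  shows "integrable (lebV U) (\<lambda>x. indicator A x * p x)"
proof -
  obtain R where R: "\<forall>x. (\<forall>g\<in>set gs. 0 \<le> g x) \<longrightarrow> (\<forall>j\<in>U. \<bar>x j\<bar> \<le> R)" using ball_bounded_box[OF U b] by blast
  obtain B where B: "\<And>x. (\<forall>i\<in>U. \<bar>x i\<bar> \<le> R) \<Longrightarrow> \<bar>p x\<bar> \<le> B" using polys_bounded[OF p] by blast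
  have [measurable]: "p \<in> borel_measurable (lebV U)" "A \<in> sets (lebV U)" using polys_measurable[OF p] A by auto
  show ?thesis
  proof (rule integrableI_bounded_set[where A = A and B = B])
    show "emeasure (lebV U) A < \<infinity>"
      using emeasure_mono[OF A(2) semialg_measurable[OF gs]] semialg_finite[OF U b] by (meson le_less_trans)
    show "AE x in lebV U. x \<in> A \<longrightarrow> norm (indicator A x * p x) \<le> B"
    proof (rule AE_I2, rule impI)
      fix x assume "x \<in> A"
      then have "\<forall>i\<in>U. \<bar>x i\<bar> \<le> R" using A(2) R by (auto simp: semialg_def)
      then show "norm (indicator A x * p x) \<le> B" using B[of x] \<open>x \<in> A\<close> by simp
    qed
  qed auto
qed

text \<open>Markov's inequality: the indicators of \<open>Z\<close> and of the excess set add up to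
  at most \<open>w\<close> on the constraint set, so the surplus of the objective over the volume of
  \<open>Z\<close> pays for the excess.\<close>

lemma excess_measure_bound:
  assumes U: "finite U" and gs: "set gs \<subseteq> polys U" and b: "ball_bounded U gs" and w: "w \<in> polys U"
    and Z: "Z \<in> sets (lebV U)" "Z \<subseteq> semialg U gs"
    and w0: "\<And>x. x \<in> semialg U gs \<Longrightarrow> 0 \<le> w x" and w1: "\<And>x. x \<in> Z \<Longrightarrow> 1 \<le> w x"
  shows "{x \<in> semialg U gs - Z. 1 \<le> w x} \<in> sets (lebV U)"
    "emeasure (lebV U) {x \<in> semialg U gs - Z. 1 \<le> w x} \<le> ennreal (intg U (semialg U gs) w - measure (lebV U) Z)"
proof -
  let ?M = "lebV U" and ?X = "semialg U gs"
  let ?B = "{x \<in> ?X - Z. 1 \<le> w x}"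
  have X: "?X \<in> sets ?M" by (rule semialg_measurable[OF gs])
  have [measurable]: "w \<in> borel_measurable ?M" by (rule polys_measurable[OF w])
  have "?B = {x \<in> space ?M. 1 \<le> w x} \<inter> (?X - Z)" using sets.sets_into_space[OF X] by auto
  also have "\<dots> \<in> sets ?M" by (intro sets.Int sets.Diff X Z(1)) measurable
  finally show B: "?B \<in> sets ?M" .
  have fX: "emeasure ?M ?X < \<infinity>" by (rule semialg_finite[OF U b])
  have fin: "emeasure ?M A < \<infinity>" if "A \<subseteq> ?X" for A using emeasure_mono[OF that X] fX by (meson le_less_trans)
  have "measure ?M ?B + measure ?M Z = (\<integral>x. indicator ?B x + indicator Z x \<partial>?M)"
    using B Z fin[of ?B] fin[OF Z(2)] by (subst Bochner_Integration.integral_add) auto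
  also have "\<dots> \<le> (\<integral>x. indicator ?X x * w x \<partial>?M)"
  proof (rule integral_mono)
    show "integrable ?M (\<lambda>x. indicator ?B x + indicator Z x :: real)"
      using B Z fin[of ?B] fin[OF Z(2)] by (intro Bochner_Integration.integrable_add) auto
    show "integrable ?M (\<lambda>x. indicator ?X x * w x)"
      by (rule polys_integrable_on_semialg[OF U gs b w X]) auto
    show "indicator ?B x + indicator Z x \<le> indicator ?X x * w x" for x
      using w0[of x] w1[of x] Z(2) by (auto simp: indicator_def)
  qed
  finally have "measure ?M ?B \<le> intg U ?X w - measure ?M Z" by (simp add: intg_def)
  moreover have "emeasure ?M ?B = ennreal (measure ?M ?B)"
    using fin[of ?B] by (intro emeasure_eq_ennreal_measure) auto
  ultimately show "emeasure ?M ?B \<le> ennreal (intg U ?X w - measure ?M Z)" by (simp add: ennreal_leI)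
qed

text \<open>\<open>dec_feas\<close> for an arbitrary variable set and arbitrary constraint lists,
  without reference to the graph.\<close>

definition feasible where
  "feasible U f T GX GY k v w \<longleftrightarrow> tpoly_on U k v \<and> poly_on U k w \<and>
      tcert U k T GX (\<lambda>t x. - Lop f U v t x) \<and> cert U k GY (\<lambda>x. v T x) \<and>
      cert U k GX w \<and> cert U k GX (\<lambda>x. w x - v 0 x - 1)"

lemma reach_subset: "T \<ge> 0 \<Longrightarrow> set GX \<subseteq> polys U \<Longrightarrow> reach U f T GX GY \<subseteq> semialg U GX"
proof
  fix x assume T: "T \<ge> 0" and GX: "set GX \<subseteq> polys U" and "x \<in> reach U f T GX GY"
  then obtain y :: "real \<Rightarrow> nat \<Rightarrow> real" where y: "x \<in> PiE U (\<lambda>_. UNIV)" "\<forall>i\<in>U. y 0 i = x i" "\<forall>g\<in>set GX. 0 \<le> g (y 0)"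
    by (auto simp: reach_def admissible_def)
  have "0 \<le> g x" if g: "g \<in> set GX" for g
  proof -
    have "g x = g (y 0)" using GX g y(2) by (intro polys_cong[of g U]) auto
    then show ?thesis using y(3) g by simp
  qed
  then show "x \<in> semialg U GX" using y(1) by (simp add: semialg_def)
qed

text \<open>One pair \<open>v\<close>, \<open>w\<close> serves all large degrees because every
  constraint holds strictly; \<open>w\<close> imitates the positive part of \<open>v 0 + 1\<close>,
  the pointwise least choice for the given \<open>v\<close>.\<close>

theorem relaxation_converges:
  assumes U: "finite U" and T: "0 < T" and f: "\<And>i. i \<in> U \<Longrightarrow> f i \<in> polys U"
    and GX: "set GX \<subseteq> polys U" "ball_bounded U GX" and GY: "set GY \<subseteq> polys U" "ball_bounded U GY"
  shows "reach U f T GX GY \<in> sets (lebV U)"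
    "\<epsilon> > 0 \<Longrightarrow> \<exists>v w. (\<forall>\<^sub>F k in sequentially. feasible U f T GX GY k v w) \<and>
       intg U (semialg U GX) w < measure (lebV U) (reach U f T GX GY) + \<epsilon>"
proof -
  let ?M = "lebV U" and ?X = "semialg U GX" and ?Z = "reach U f T GX GY"
  obtain r1 where r1: "r1 \<ge> 0" "\<forall>x. (\<forall>g\<in>set GX. 0 \<le> g x) \<longrightarrow> (\<forall>j\<in>U. \<bar>x j\<bar> \<le> r1)" using ball_bounded_box[OF U GX(2)] by blast
  obtain r2 where r2: "r2 \<ge> 0" "\<forall>x. (\<forall>g\<in>set GY. 0 \<le> g x) \<longrightarrow> (\<forall>j\<in>U. \<bar>x j\<bar> \<le> r2)" using ball_bounded_box[OF U GY(2)] by blast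
  define R where "R = max r1 r2"
  have R: "R \<ge> 0" "\<forall>x. (\<forall>g\<in>set GX. 0 \<le> g x) \<longrightarrow> (\<forall>j\<in>U. \<bar>x j\<bar> \<le> R)" "\<forall>x. (\<forall>g\<in>set GY. 0 \<le> g x) \<longrightarrow> (\<forall>j\<in>U. \<bar>x j\<bar> \<le> R)"
    using r1 r2 unfolding R_def by (auto simp: le_max_iff_disj)
  obtain B Lf Df where "ode_system U f T R B Lf Df" using ode_system_exists[where f = f, OF U T f R(1)] by blast
  then interpret ode_system U f T R B Lf Df .
  obtain v where vv: "\<forall>m. v m \<in> tpolys U"
    "\<forall>m. \<forall>t\<in>{0..T}. \<forall>x. (\<forall>g\<in>set GX. 0 \<le> g x) \<longrightarrow> Lop f U (v m) t x < 0"
    "\<forall>m x. (\<forall>g\<in>set GY. 0 \<le> g x) \<longrightarrow> 0 < v m T x"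
    "\<forall>m x. (\<forall>g\<in>set GX. 0 \<le> g x) \<longrightarrow> v m 0 x \<le> 1 / (real m + 1)"
    "\<forall>x\<in>?X - ?Z. \<forall>\<^sub>F m in sequentially. v m 0 x \<le> - 1"
    using subsolution_sequence[OF GX(1) GY(1) R(2,3)] by metis
  have v: "v m \<in> tpolys U" for m using vv(1) by blast
  have v1: "Lop f U (v m) t x < 0" if "t \<in> {0..T}" "\<forall>g\<in>set GX. 0 \<le> g x" for m t x using vv(2) that by blast
  have v2: "0 < v m T x" if "\<forall>g\<in>set GY. 0 \<le> g x" for m x using vv(3) that by blast
  have v3: "v m 0 x \<le> 1 / (real m + 1)" if "\<forall>g\<in>set GX. 0 \<le> g x" for m x using vv(4) that by blast
  have v4: "\<forall>\<^sub>F m in sequentially. v m 0 x \<le> - 1" if "x \<in> ?X - ?Z" for x using vv(5) that by blast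
  have v0: "v m 0 \<in> polys U" for m by (rule tpolys_at[OF v])
  have Xsub: "?Z \<subseteq> ?X" using reach_subset[OF _ GX(1)] T by simp
  have vZ: "0 \<le> v m 0 x" if x: "x \<in> ?Z" for m x
  proof -
    obtain y where y: "\<forall>i\<in>U. y 0 i = x i" "admissible U f T GX GY y" using x by (auto simp: reach_def)
    have "0 \<le> v m 0 (y 0)"
    proof (rule value_nonneg[where y = y and f = f, OF U _ v])
      show "Lop f U (v m) s (y s) \<le> 0" if "s \<in> {0..T}" for s
        using y(2) that v1[OF that, of "y s" m] by (auto simp: admissible_def intro: less_imp_le)
      show "0 \<le> v m T (y T)" using y(2) v2[of "y T" m] by (auto simp: admissible_def intro: less_imp_le)
    qed (use y(2) T in \<open>auto simp: admissible_def\<close>)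
    also have "v m 0 (y 0) = v m 0 x" by (rule polys_cong[OF v0]) (use y(1) in auto)
    finally show ?thesis .
  qed
  have X: "?X \<in> sets ?M" by (rule semialg_measurable[OF GX(1)])
  \<comment> \<open>Each \<open>v m 0\<close> is nonnegative on the reachable region, and off it they are eventually negative.\<close>
  have "?Z = (\<Inter>m. ?X \<inter> {x \<in> space ?M. 0 \<le> v m 0 x})"
  proof (intro set_eqI iffI)
    fix x assume "x \<in> ?Z"
    then show "x \<in> (\<Inter>m. ?X \<inter> {x \<in> space ?M. 0 \<le> v m 0 x})"
      using vZ Xsub sets.sets_into_space[OF X] by blast
  next
    fix x assume x: "x \<in> (\<Inter>m. ?X \<inter> {x \<in> space ?M. 0 \<le> v m 0 x})"
    show "x \<in> ?Z"
    proof (rule ccontr)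
      assume "x \<notin> ?Z"
      then have "\<forall>\<^sub>F m in sequentially. v m 0 x \<le> - 1" using v4[of x] x by blast
      then obtain m where "v m 0 x \<le> -1" by (auto simp: eventually_sequentially)
      moreover have "0 \<le> v m 0 x" using x by blast
      ultimately show False by simp
    qed
  qed
  also have "\<dots> \<in> sets ?M"
  proof (rule sets.countable_INT'[OF countableI_type UNIV_not_empty], rule image_subsetI)
    fix m
    have [measurable]: "v m 0 \<in> borel_measurable ?M" by (rule polys_measurable[OF v0])
    have "{x \<in> space ?M. 0 \<le> v m 0 x} \<in> sets ?M" by measurable
    then show "?X \<inter> {x \<in> space ?M. 0 \<le> v m 0 x} \<in> sets ?M" by (rule sets.Int[OF X])
  qed
  finally show Z: "?Z \<in> sets ?M" .
  define d where "d m = 1 / (real m + 1)" for m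
  have d: "0 < d m" "d m \<le> 1" for m by (auto simp: d_def)
  have d0: "d \<longlonglongrightarrow> 0" unfolding d_def using LIMSEQ_inverse_real_of_nat by (simp add: inverse_eq_divide add.commute)
  \<comment> \<open>\<open>w\<close> is a univariate polynomial in \<open>v m 0\<close>. A margin
    between \<open>d m\<close> and \<open>3 * d m\<close> above \<open>max 0 (v m 0 x + 1)\<close>
    makes both constraints on \<open>w\<close> strict.\<close>
  have "\<exists>w\<in>polys U. \<forall>x. (\<forall>g\<in>set GX. 0 \<le> g x) \<longrightarrow> max 0 (v m 0 x + 1) + d m < w x \<and> w x < max 0 (v m 0 x + 1) + 3 * d m" for m
  proof -
    obtain C where C: "\<And>x. (\<forall>i\<in>U. \<bar>x i\<bar> \<le> R) \<Longrightarrow> \<bar>v m 0 x\<bar> \<le> C" using polys_bounded[OF v0] by blast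
    have "continuous_on {-C..C} (\<lambda>u. max 0 (u + 1) + 2 * d m)" by (intro continuous_intros)
    then obtain \<psi> where \<psi>: "real_polynomial_function \<psi>" "\<forall>u\<in>{-C..C}. \<bar>max 0 (u + 1) + 2 * d m - \<psi> u\<bar> < d m"
      using weierstrass_interval[OF _ d(1)[of m]] by blast
    show ?thesis
    proof (intro bexI[of _ "\<lambda>x. \<psi> (v m 0 x)"] allI impI polys_real_poly[OF \<psi>(1) v0])
      fix x assume "\<forall>g\<in>set GX. 0 \<le> g x"
      then have "v m 0 x \<in> {-C..C}" using C[of x] R(2) by (auto simp: abs_le_iff)
      from \<psi>(2)[rule_format, OF this] show "max 0 (v m 0 x + 1) + d m < \<psi> (v m 0 x) \<and> \<psi> (v m 0 x) < max 0 (v m 0 x + 1) + 3 * d m"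
        by linarith
    qed
  qed
  then obtain w where w: "\<And>m. w m \<in> polys U"
    and wl: "\<And>m x. (\<forall>g\<in>set GX. 0 \<le> g x) \<Longrightarrow> max 0 (v m 0 x + 1) + d m < w m x"
    and wu: "\<And>m x. (\<forall>g\<in>set GX. 0 \<le> g x) \<Longrightarrow> w m x < max 0 (v m 0 x + 1) + 3 * d m" by metis
  have feas: "\<forall>\<^sub>F k in sequentially. feasible U f T GX GY k (v m) (w m)" for m
  proof -
    obtain d1 where d1: "tpoly_on U d1 (v m)" using v tpolys_iff by blast
    obtain d2 where d2: "poly_on U d2 (w m)" using w polys_iff by blast
    have "\<forall>\<^sub>F k in sequentially. tpoly_on U k (v m)"
      unfolding eventually_sequentially by (rule exI[of _ d1]) (auto intro: tpoly_on_mono[OF d1])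
    moreover have "\<forall>\<^sub>F k in sequentially. poly_on U k (w m)"
      unfolding eventually_sequentially by (rule exI[of _ d2]) (auto intro: poly_on_mono[OF d2])
    moreover have "\<forall>\<^sub>F k in sequentially. tcert U k T GX (\<lambda>t x. - Lop f U (v m) t x)"
      using v1 by (intro putinar_tcert T GX tpolys_uminus Lop_closed U f v) auto
    moreover have "\<forall>\<^sub>F k in sequentially. cert U k GY (\<lambda>x. v m T x)"
      using v2 by (intro putinar_cert GY tpolys_at[OF v]) auto
    moreover have "\<forall>\<^sub>F k in sequentially. cert U k GX (w m)"
    proof (intro putinar_cert GX w)
      show "0 < w m x" if "\<forall>g\<in>set GX. 0 \<le> g x" for x using wl[OF that, of m] d(1)[of m] by linarith
    qed
    moreover have "\<forall>\<^sub>F k in sequentially. cert U k GX (\<lambda>x. w m x - v m 0 x - 1)"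
    proof (intro putinar_cert GX polys_diff w v0 polys.const)
      show "0 < w m x - v m 0 x - 1" if "\<forall>g\<in>set GX. 0 \<le> g x" for x using wl[OF that, of m] d(1)[of m] by linarith
    qed
    ultimately show ?thesis unfolding feasible_def by eventually_elim blast
  qed
  have fX: "emeasure ?M ?X < \<infinity>" by (rule semialg_finite[OF U GX(2)])
  have XZ: "?X - ?Z \<in> sets ?M" using X Z by blast
  have wX: "0 \<le> w m x" "w m x \<le> 1 + 4 * d m" if "x \<in> ?X" for m x
  proof -
    have g: "\<forall>g\<in>set GX. 0 \<le> g x" using that by (simp add: semialg_def)
    show "0 \<le> w m x" using wl[OF g, of m] d(1)[of m] by linarith
    show "w m x \<le> 1 + 4 * d m" using wu[OF g, of m] v3[OF g, of m] d(1)[of m] unfolding d_def by linarith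
  qed
  have int: "integrable ?M (\<lambda>x. indicator A x * w m x)" if "A \<in> sets ?M" "A \<subseteq> ?X" for A m
    by (rule polys_integrable_on_semialg[OF U GX w that])
  \<comment> \<open>Off the region \<open>w \<le> 3 * d m\<close> holds eventually. The dominating
    constant 5 is the bound \<open>1 + 4 * d m\<close> with \<open>d m \<le> 1\<close>.\<close>
  have out: "(\<lambda>m. \<integral>x. indicator (?X - ?Z) x * w m x \<partial>?M) \<longlonglongrightarrow> (\<integral>x. 0 \<partial>?M)"
  proof (rule integral_dominated_convergence[where w = "\<lambda>x. 5 * indicator ?X x"])
    show "(\<lambda>x. indicator (?X - ?Z) x * w m x) \<in> borel_measurable ?M" for m
      using XZ polys_measurable[OF w] by (intro borel_measurable_times borel_measurable_indicator) auto
    show "integrable ?M (\<lambda>x. 5 * indicator ?X x :: real)" using X fX by auto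
    show "AE x in ?M. (\<lambda>m. indicator (?X - ?Z) x * w m x) \<longlonglongrightarrow> 0"
    proof (rule AE_I2)
      fix x
      show "(\<lambda>m. indicator (?X - ?Z) x * w m x) \<longlonglongrightarrow> 0"
      proof (cases "x \<in> ?X - ?Z")
        case True
        then have g: "\<forall>g\<in>set GX. 0 \<le> g x" by (simp add: semialg_def)
        have "\<forall>\<^sub>F m in sequentially. w m x \<le> 3 * d m"
          using v4[OF True]
        proof eventually_elim
          case (elim m)
          then show ?case using wu[OF g, of m] by simp
        qed
        moreover have "(\<lambda>m. 3 * d m) \<longlonglongrightarrow> 0" using tendsto_mult[OF tendsto_const d0, of 3] by simp
        ultimately have "(\<lambda>m. w m x) \<longlonglongrightarrow> 0"
          using wX True by (intro tendsto_sandwich[of "\<lambda>_. 0" "\<lambda>m. w m x" sequentially "\<lambda>m. 3 * d m"]) auto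
        then show ?thesis using True by simp
      qed simp
    qed
    show "AE x in ?M. norm (indicator (?X - ?Z) x * w m x) \<le> 5 * indicator ?X x" for m
    proof (rule AE_I2)
      fix x
      show "norm (indicator (?X - ?Z) x * w m x) \<le> 5 * indicator ?X x"
        using wX[of x m] d(2)[of m] by (auto simp: indicator_def)
    qed
  qed simp
  \<comment> \<open>From \<open>v m 0 \<le> d m\<close> it follows that \<open>w\<close> exceeds 1
    by at most \<open>4 * d m\<close>, which is used on the region only.\<close>
  have bound: "intg U ?X (w m) \<le> (1 + 4 * d m) * measure ?M ?Z + (\<integral>x. indicator (?X - ?Z) x * w m x \<partial>?M)" for m
  proof -
    have "intg U ?X (w m) = (\<integral>x. indicator ?Z x * w m x + indicator (?X - ?Z) x * w m x \<partial>?M)"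
      unfolding intg_def using Xsub by (intro Bochner_Integration.integral_cong) (auto simp: indicator_def)
    also have "\<dots> = (\<integral>x. indicator ?Z x * w m x \<partial>?M) + (\<integral>x. indicator (?X - ?Z) x * w m x \<partial>?M)"
      by (intro Bochner_Integration.integral_add int Z XZ Xsub) auto
    also have "(\<integral>x. indicator ?Z x * w m x \<partial>?M) \<le> (\<integral>x. (1 + 4 * d m) * indicator ?Z x \<partial>?M)"
    proof (rule integral_mono[OF int[OF Z Xsub]])
      have "emeasure ?M ?Z < \<infinity>" using emeasure_mono[OF Xsub X] fX by (meson le_less_trans)
      then show "integrable ?M (\<lambda>x. (1 + 4 * d m) * indicator ?Z x)" using Z by auto
      show "indicator ?Z x * w m x \<le> (1 + 4 * d m) * indicator ?Z x" for x
        using wX[of x m] Xsub by (auto simp: indicator_def)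
    qed
    also have "(\<integral>x. (1 + 4 * d m) * indicator ?Z x \<partial>?M) = (1 + 4 * d m) * measure ?M ?Z"
      using Z by simp
    finally show ?thesis by simp
  qed
  show "\<exists>v w. (\<forall>\<^sub>F k in sequentially. feasible U f T GX GY k v w) \<and> intg U ?X w < measure ?M ?Z + \<epsilon>" if e: "\<epsilon> > 0"
  proof -
    have "(\<lambda>m. (1 + 4 * d m) * measure ?M ?Z + (\<integral>x. indicator (?X - ?Z) x * w m x \<partial>?M)) \<longlonglongrightarrow>
        (1 + 4 * 0) * measure ?M ?Z + (\<integral>x. 0 \<partial>?M)"
      by (intro tendsto_intros d0 out)
    then have "\<forall>\<^sub>F m in sequentially. (1 + 4 * d m) * measure ?M ?Z + (\<integral>x. indicator (?X - ?Z) x * w m x \<partial>?M) < measure ?M ?Z + \<epsilon>"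
      by (rule order_tendstoD(2)) (use e in simp)
    then obtain m where "(1 + 4 * d m) * measure ?M ?Z + (\<integral>x. indicator (?X - ?Z) x * w m x \<partial>?M) < measure ?M ?Z + \<epsilon>"
      by (auto simp: eventually_sequentially)
    then have "intg U ?X (w m) < measure ?M ?Z + \<epsilon>" using bound[of m] by linarith
    then show ?thesis using feas by blast
  qed
qed

section \<open>Certificates, independence and cylinders\<close>

lemma sos_on_nonneg: "sos_on V d s \<Longrightarrow> 0 \<le> s x"
  by (auto simp: sos_on_def intro!: sum_list_nonneg)

lemma tsos_on_nonneg: "tsos_on V d s \<Longrightarrow> 0 \<le> s t x"
  by (auto simp: tsos_on_def intro!: sum_list_nonneg)

lemma cert_nonneg:
  assumes "cert V k gs h" "\<forall>g\<in>set gs. 0 \<le> g x"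
  shows "0 \<le> h x"
proof -
  obtain s0 ss where c: "sos_on V k s0" "\<forall>i<length gs. sos_on V (k - pdeg V (gs!i)) (ss!i)"
    "\<forall>x. h x = s0 x + (\<Sum>i<length gs. (ss!i) x * (gs!i) x)" using assms(1) by (auto simp: cert_def)
  have "0 \<le> (ss!i) x * (gs!i) x" if "i < length gs" for i
    using c(2) assms(2) that sos_on_nonneg by (intro mult_nonneg_nonneg) (blast, simp)
  then show ?thesis using c(1,3) sos_on_nonneg by (auto intro!: add_nonneg_nonneg sum_nonneg)
qed

lemma tcert_nonneg:
  assumes "tcert V k T gs h" "\<forall>g\<in>set gs. 0 \<le> g x" and t: "t \<in> {0..T}"
  shows "0 \<le> h t x"
proof -
  obtain s0 s1 ss where c: "tsos_on V k s0" "tsos_on V (k - 2) s1" "\<forall>i<length gs. tsos_on V (k - pdeg V (gs!i)) (ss!i)"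
    "\<forall>t x. h t x = s0 t x + s1 t x * (t * (T - t)) + (\<Sum>i<length gs. (ss!i) t x * (gs!i) x)"
    using assms(1) by (auto simp: tcert_def)
  have "0 \<le> (ss!i) t x * (gs!i) x" if "i < length gs" for i
    using c(3) assms(2) that tsos_on_nonneg by (intro mult_nonneg_nonneg) (blast, simp)
  moreover have "0 \<le> s1 t x * (t * (T - t))" using tsos_on_nonneg[OF c(2)] t by auto
  ultimately show ?thesis using c(1,4) tsos_on_nonneg by (auto intro!: add_nonneg_nonneg sum_nonneg)
qed

lemma feasible_ge_one:
  assumes U: "finite U" and T: "0 \<le> T" and feas: "feasible U f T GX GY k v w" and x: "x \<in> reach U f T GX GY"
  shows "1 \<le> w x"
proof -
  have v: "v \<in> tpolys U" and w: "w \<in> polys U" using feas polys_iff tpolys_iff unfolding feasible_def by blast+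
  obtain y where y0: "\<forall>i\<in>U. y 0 i = x i" and y: "admissible U f T GX GY y" using x by (auto simp: reach_def)
  have "0 \<le> v 0 (y 0)"
  proof (rule value_nonneg[where y = y and f = f, OF U T v])
    show "Lop f U v s (y s) \<le> 0" if "s \<in> {0..T}" for s
      using tcert_nonneg[of U k T GX "\<lambda>t x. - Lop f U v t x" "y s" s] feas y that
      by (auto simp: feasible_def admissible_def)
    show "0 \<le> v T (y T)"
      using cert_nonneg[of U k GY "\<lambda>x. v T x" "y T"] feas y by (auto simp: feasible_def admissible_def)
  qed (use y in \<open>auto simp: admissible_def\<close>)
  moreover have "0 \<le> w (y 0) - v 0 (y 0) - 1"
    using cert_nonneg[of U k GX "\<lambda>x. w x - v 0 x - 1" "y 0"] feas y T by (auto simp: feasible_def admissible_def)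
  moreover have "w (y 0) = w x" by (rule polys_cong[OF w]) (use y0 in auto)
  ultimately show ?thesis by simp
qed

lemma feasible_nonneg:
  assumes "feasible U f T GX GY k v w" "x \<in> semialg U GX"
  shows "0 \<le> w x"
  using assms cert_nonneg[of U k GX w x] by (auto simp: feasible_def semialg_def)

text \<open>Passes from the semantic independence of the sparsity graph to a polynomial in fewer
  variables: the irrelevant coordinates are set to 0 one at a time.\<close>

lemma polys_of_independent:
  assumes V: "finite V" and p: "p \<in> polys V" and W: "W \<subseteq> V" and indep: "\<And>b. b \<in> V - W \<Longrightarrow> \<not> depends_on p b"
  shows "p \<in> polys W"
proof -
  define z where "z S x = (\<lambda>i. if i \<in> S then 0 else x i :: real)" for S and x :: "nat \<Rightarrow> real"
  have "p (z S x) = p x" if "finite S" "S \<subseteq> V - W" for S x using that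
  proof (induction S rule: finite_induct)
    case empty
    then show ?case by (simp add: z_def)
  next
    case (insert b S)
    have "z (insert b S) x = (z S x)(b := 0)" by (auto simp: z_def)
    then have "p (z (insert b S) x) = p (z S x)" using indep[of b] insert.prems by (auto simp: depends_on_def)
    then show ?case using insert by auto
  qed
  then have "p = (\<lambda>x. p (\<lambda>i. z (V - W) x i))" using V by (auto simp: fun_eq_iff)
  moreover have "(\<lambda>x. p (\<lambda>i. z (V - W) x i)) \<in> polys W"
  proof (rule polys_comp[OF p])
    show "(\<lambda>x. z (V - W) x i) \<in> polys W" if "i \<in> V" for i
      using that by (cases "i \<in> W") (auto simp: z_def intro: polys.intros)
  qed
  ultimately show ?thesis by simp
qed

text \<open>A full cylinder may have infinite measure, hence the cut-off by a box; the product
  structure then gives the volume of the base times that of a cube.\<close>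

lemma cylinder_measure:
  assumes V: "finite V" and U: "U \<subseteq> V" and A: "A \<in> sets (lebV U)" and R: "0 \<le> R"
  shows "emeasure (lebV V) {x \<in> PiE V (\<lambda>_. UNIV). restrict x U \<in> A \<and> (\<forall>j\<in>V - U. \<bar>x j\<bar> \<le> R)} =
    emeasure (lebV U) A * ennreal ((2 * R) ^ card (V - U))"
    "{x \<in> PiE V (\<lambda>_. UNIV). restrict x U \<in> A \<and> (\<forall>j\<in>V - U. \<bar>x j\<bar> \<le> R)} \<in> sets (lebV V)"
proof -
  interpret product_sigma_finite "\<lambda>_ :: nat. lborel :: real measure"
    by unfold_locales
  let ?W = "V - U"
  let ?B = "PiE ?W (\<lambda>_. {-R..R})"
  let ?C = "{x \<in> PiE V (\<lambda>_. UNIV). restrict x U \<in> A \<and> (\<forall>j\<in>V - U. \<bar>x j\<bar> \<le> R)}"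
  have fin: "finite U" "finite ?W" "U \<union> ?W = V" "U \<inter> ?W = {}" using V U finite_subset by auto
  have mes: "{x \<in> space (lebV V). restrict x U \<in> A} \<in> sets (lebV V)"
    using measurable_sets[OF measurable_restrict_subset[OF U, of "\<lambda>_. lborel"] A]
    by (simp add: vimage_def Int_def conj_commute)
  have "{x \<in> space (lebV V). \<forall>j\<in>?W. \<bar>x j\<bar> \<le> R} \<in> sets (lebV V)"
  proof (rule sets.sets_Collect_finite_All[OF _ fin(2)])
    fix j assume "j \<in> ?W"
    then have [measurable]: "(\<lambda>x. x j) \<in> borel_measurable (lebV V)" by (intro polys_measurable polys.var) auto
    show "{x \<in> space (lebV V). \<bar>x j\<bar> \<le> R} \<in> sets (lebV V)" by measurable
  qed
  from sets.Int[OF mes this] show C: "?C \<in> sets (lebV V)"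
    by (rule back_subst[of "\<lambda>S. S \<in> sets (lebV V)"]) (auto simp: space_lebV)
  have B: "?B \<in> sets (lebV ?W)" by (rule box_finite(1)[OF fin(2)])
  have Asp: "A \<subseteq> PiE U (\<lambda>_. UNIV)" using sets.sets_into_space[OF A] by (simp add: space_lebV)
  have "emeasure (lebV V) ?C = emeasure (distr (lebV U \<Otimes>\<^sub>M lebV ?W) (lebV (U \<union> ?W)) (merge U ?W)) ?C"
    using distr_merge[OF fin(4,1,2)] fin(3) by simp
  also have "\<dots> = emeasure (lebV U \<Otimes>\<^sub>M lebV ?W) (merge U ?W -` ?C \<inter> space (lebV U \<Otimes>\<^sub>M lebV ?W))"
    using C fin(3) by (intro emeasure_distr measurable_merge) simp
  also have "merge U ?W -` ?C \<inter> space (lebV U \<Otimes>\<^sub>M lebV ?W) = A \<times> ?B"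
  proof (intro set_eqI iffI)
    fix z assume z: "z \<in> merge U ?W -` ?C \<inter> space (lebV U \<Otimes>\<^sub>M lebV ?W)"
    obtain a b where ab: "z = (a, b)" by force
    have a: "a \<in> PiE U (\<lambda>_. UNIV)" and b: "b \<in> PiE ?W (\<lambda>_. UNIV)"
      using z by (auto simp: ab space_pair_measure space_lebV)
    have "restrict (merge U ?W (a, b)) U = a" using a by (auto simp: merge_def fun_eq_iff PiE_def extensional_def)
    then have "a \<in> A" using z by (simp add: ab)
    moreover have "\<bar>b j\<bar> \<le> R" if "j \<in> ?W" for j
    proof -
      have "\<bar>merge U ?W (a, b) j\<bar> \<le> R" using z that by (simp add: ab)
      then show ?thesis using that by (simp add: merge_def)
    qed
    then have "b \<in> ?B" using b by (auto simp: PiE_def Pi_def abs_le_iff minus_le_iff)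
    ultimately show "z \<in> A \<times> ?B" by (simp add: ab)
  next
    fix z assume "z \<in> A \<times> ?B"
    then obtain a b where ab: "z = (a, b)" "a \<in> A" "b \<in> ?B" by blast
    have a: "a \<in> PiE U (\<lambda>_. UNIV)" using ab Asp by blast
    have b: "b \<in> PiE ?W (\<lambda>_. UNIV)" using ab(3) by (auto simp: PiE_def)
    have "restrict (merge U ?W (a, b)) U = a" using a by (auto simp: merge_def fun_eq_iff PiE_def extensional_def)
    moreover have "merge U ?W (a, b) \<in> PiE V (\<lambda>_. UNIV)" using fin(3) by (auto simp: merge_def PiE_def extensional_def)
    moreover have "\<bar>merge U ?W (a, b) j\<bar> \<le> R" if "j \<in> ?W" for j
      using ab(3) that by (auto simp: merge_def PiE_def Pi_def abs_le_iff minus_le_iff)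
    ultimately show "z \<in> merge U ?W -` ?C \<inter> space (lebV U \<Otimes>\<^sub>M lebV ?W)"
      using a b ab by (auto simp: space_pair_measure space_lebV)
  qed
  also have "emeasure (lebV U \<Otimes>\<^sub>M lebV ?W) (A \<times> ?B) = emeasure (lebV U) A * emeasure (lebV ?W) ?B"
  proof -
    interpret W: finite_product_sigma_finite "\<lambda>_ :: nat. lborel :: real measure" ?W by unfold_locales (rule fin(2))
    show ?thesis by (rule W.emeasure_pair_measure_Times[OF A B])
  qed
  also have "emeasure (lebV ?W) ?B = ennreal ((2 * R) ^ card ?W)"
  proof -
    interpret W: finite_product_sigma_finite "\<lambda>_ :: nat. lborel :: real measure" ?W by unfold_locales (rule fin(2))
    have "emeasure (lebV ?W) ?B = (\<Prod>i\<in>?W. emeasure lborel {-R..R})" by (rule W.measure_times) auto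
    also have "\<dots> = (\<Prod>i\<in>?W. ennreal (2 * R))" using R by (intro prod.cong) (auto simp: emeasure_lborel_Icc_eq)
    also have "\<dots> = ennreal (\<Prod>i\<in>?W. 2 * R)" by (rule prod_ennreal) (use R in simp)
    finally show ?thesis by simp
  qed
  finally show "emeasure (lebV V) ?C = emeasure (lebV U) A * ennreal ((2 * R) ^ card ?W)" .
qed

section \<open>Sparse systems\<close>

locale sparse_system =
  fixes n N :: nat and J :: "nat \<Rightarrow> nat set" and f :: "nat \<Rightarrow> (nat \<Rightarrow> real) \<Rightarrow> real"
    and gX gT :: "nat \<Rightarrow> ((nat \<Rightarrow> real) \<Rightarrow> real) list" and T :: real
  assumes T_pos: "T > 0"
    and blocks_cover: "(\<Union>j<N. J j) = {..<n}"
    and blocks_disj: "\<forall>i<N. \<forall>j<N. i \<noteq> j \<longrightarrow> J i \<inter> J j = {}"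
    and f_poly: "\<forall>a<n. \<exists>d. poly_on {..<n} d (f a)"
    and gX_poly: "\<forall>j<N. \<forall>g\<in>set (gX j). \<exists>d. poly_on (J j) d g"
    and gT_poly: "\<forall>j<N. \<forall>g\<in>set (gT j). \<exists>d. poly_on (J j) d g"
    and gX_ball: "\<forall>j<N. \<exists>R>0. (\<lambda>x. R\<^sup>2 - (\<Sum>i\<in>J j. (x i)\<^sup>2)) \<in> set (gX j)"
    and gT_ball: "\<forall>j<N. \<exists>R>0. (\<lambda>x. R\<^sup>2 - (\<Sum>i\<in>J j. (x i)\<^sup>2)) \<in> set (gT j)"
    and acyc: "acyclic (sp_edges N J f)"
begin

abbreviation "P \<equiv> past N J f"
abbreviation "L \<equiv> leaves N J f"
abbreviation "U r \<equiv> vars J (P r)"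
abbreviation "GX r \<equiv> glist gX (P r)"
abbreviation "GY r \<equiv> glist gT (P r)"
abbreviation "Z r \<equiv> reach (U r) f T (GX r) (GY r)"
abbreviation "X \<equiv> semialg {..<n} (glist gX {..<N})"
abbreviation "RT \<equiv> ROA n f T X (semialg {..<n} (glist gT {..<N}))"

section \<open>Pasts as autonomous subsystems\<close>

lemma past_subset: "r < N \<Longrightarrow> P r \<subseteq> {..<N}"
proof
  fix j assume r: "r < N" and j: "j \<in> P r"
  show "j \<in> {..<N}"
  proof (cases "j = r")
    case False
    then have "(j, r) \<in> (sp_edges N J f)\<^sup>+" using j by (auto simp: past_def)
    then have "j \<in> Domain (sp_edges N J f)" by (metis DomainI tranclD)
    then show ?thesis by (auto simp: sp_edges_def)
  qed (use r in simp)
qed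

lemma J_subset: "j < N \<Longrightarrow> J j \<subseteq> {..<n}"
  using blocks_cover by auto

lemma vars_all: "vars J {..<N} = {..<n}"
  using blocks_cover by (simp add: vars_def)

lemma vars_subset: "I \<subseteq> {..<N} \<Longrightarrow> vars J I \<subseteq> {..<n}"
  using J_subset by (auto simp: vars_def)

lemma set_glist: "I \<subseteq> {..<N} \<Longrightarrow> set (glist g I) = (\<Union>j\<in>I. set (g j))"
  using finite_subset[of I "{..<N}"] by (auto simp: glist_def)

lemma glist_polys:
  assumes I: "I \<subseteq> {..<N}" and g: "\<forall>j<N. \<forall>h\<in>set (g j). \<exists>d. poly_on (J j) d h"
  shows "set (glist g I) \<subseteq> polys (vars J I)"
proof
  fix h assume "h \<in> set (glist g I)"
  then obtain j where j: "j \<in> I" "h \<in> set (g j)" using set_glist[OF I, of g] by auto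
  then have "h \<in> polys (J j)" using g I polys_iff by blast
  then show "h \<in> polys (vars J I)" by (rule polys_subset) (use j in \<open>auto simp: vars_def\<close>)
qed

lemma glist_ball:
  assumes I: "I \<subseteq> {..<N}" and g: "\<forall>j<N. \<exists>R>0. (\<lambda>x. R\<^sup>2 - (\<Sum>i\<in>J j. (x i)\<^sup>2)) \<in> set (g j)"
  shows "ball_bounded (vars J I) (glist g I)"
  unfolding ball_bounded_def
proof
  fix i assume "i \<in> vars J I"
  then obtain j where j: "j \<in> I" "i \<in> J j" by (auto simp: vars_def)
  then obtain R where "(\<lambda>x. R\<^sup>2 - (\<Sum>i\<in>J j. (x i)\<^sup>2)) \<in> set (g j)" using g I by blast
  moreover have "finite (J j)" using J_subset[of j] j I finite_subset by blast
  moreover have "J j \<subseteq> vars J I" using j by (auto simp: vars_def)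
  ultimately show "\<exists>W R. finite W \<and> i \<in> W \<and> W \<subseteq> vars J I \<and> (\<lambda>x. R\<^sup>2 - (\<Sum>i\<in>W. (x i)\<^sup>2)) \<in> set (glist g I)"
    using j set_glist[OF I, of g] by blast
qed

lemma f_polys_all: "i < n \<Longrightarrow> f i \<in> polys {..<n}"
  using f_poly polys_iff by blast

text \<open>A past is closed under predecessors, so the equations of its variables involve no other
  variables.\<close>

lemma f_local:
  assumes r: "r < N" and i: "i \<in> U r" and b: "b \<in> {..<n}" and dep: "depends_on (f i) b"
  shows "b \<in> U r"
proof -
  obtain j where j: "j \<in> P r" "i \<in> J j" using i by (auto simp: vars_def)
  have jN: "j < N" using past_subset[OF r] j by auto
  obtain k where k: "k < N" "b \<in> J k" using b blocks_cover by blast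
  show ?thesis
  proof (cases "k = j")
    case True
    then show ?thesis using j k by (auto simp: vars_def)
  next
    case False
    then have e: "(k, j) \<in> sp_edges N J f" using jN k j dep by (auto simp: sp_edges_def)
    have "(k, r) \<in> (sp_edges N J f)\<^sup>+"
    proof (cases "j = r")
      case True
      then show ?thesis using e by auto
    next
      case False
      then have "(j, r) \<in> (sp_edges N J f)\<^sup>+" using j by (auto simp: past_def)
      then show ?thesis by (rule trancl_into_trancl2[OF e])
    qed
    then show ?thesis using k by (auto simp: past_def vars_def)
  qed
qed

lemma leaf_less: "r \<in> L \<Longrightarrow> r < N"
  by (simp add: leaves_def)

lemma finite_L: "finite L"
  by (simp add: leaves_def)

context
  fixes r assumes r: "r < N"
begin

lemma U_subset: "U r \<subseteq> {..<n}"
  by (rule vars_subset[OF past_subset[OF r]])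

lemma finite_U: "finite (U r)"
  by (rule finite_subset[OF U_subset]) simp

lemma f_polys:
  assumes i: "i \<in> U r" shows "f i \<in> polys (U r)"
proof (rule polys_of_independent[OF finite_lessThan f_polys_all U_subset])
  show "i < n" using i U_subset by auto
qed (use f_local[OF r i] in blast)

lemma GX: "set (GX r) \<subseteq> polys (U r)" "ball_bounded (U r) (GX r)"
  by (intro glist_polys glist_ball past_subset r gX_poly gX_ball)+

lemma GY: "set (GY r) \<subseteq> polys (U r)" "ball_bounded (U r) (GY r)"
  by (intro glist_polys glist_ball past_subset r gT_poly gT_ball)+

lemma set_GX: "set (GX r) \<subseteq> set (glist gX {..<N})"
  using set_glist[OF past_subset[OF r], of gX] set_glist[of "{..<N}" gX] past_subset[OF r] by auto

lemma set_GY: "set (GY r) \<subseteq> set (glist gT {..<N})"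
  using set_glist[OF past_subset[OF r], of gT] set_glist[of "{..<N}" gT] past_subset[OF r] by auto

lemma dec_feas_feasible: "dec_feas N J f gX gT T k r v w \<longleftrightarrow> feasible (U r) f T (GX r) (GY r) k v w"
  by (simp add: dec_feas_def feasible_def Let_def)

lemma dec_obj_intg: "dec_obj N J f gX r w = intg (U r) (semialg (U r) (GX r)) w"
  by (simp add: dec_obj_def Let_def)

lemma restrict_X: "x \<in> X \<Longrightarrow> restrict x (U r) \<in> semialg (U r) (GX r)"
proof -
  assume x: "x \<in> X"
  have "0 \<le> g (restrict x (U r))" if g: "g \<in> set (GX r)" for g
  proof -
    have "g (restrict x (U r)) = g x" using GX(1) g by (intro polys_cong[of g "U r"]) auto
    then show ?thesis using x set_GX g by (auto simp: semialg_def)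
  qed
  then show ?thesis by (simp add: semialg_def)
qed

end

text \<open>In a finite acyclic graph the converse of the edge relation is well-founded, so
  following successors ends at a leaf, and pasts only grow on the way.\<close>

lemma leaf_above: "j < N \<Longrightarrow> \<exists>r\<in>L. P j \<subseteq> P r"
proof -
  have fin: "finite (sp_edges N J f)"
    by (rule finite_subset[of _ "{..<N} \<times> {..<N}"]) (auto simp: sp_edges_def)
  show "j < N \<Longrightarrow> \<exists>r\<in>L. P j \<subseteq> P r"
  proof (induction j rule: wf_induct_rule[OF finite_acyclic_wf_converse[OF fin acyc]])
    case (1 j)
    show ?case
    proof (cases "j \<in> L")
      case False
      then obtain i where i: "(j, i) \<in> sp_edges N J f" using 1(2) by (auto simp: leaves_def)
      then have "i < N" by (auto simp: sp_edges_def)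
      then obtain r where r: "r \<in> L" "P i \<subseteq> P r" using 1(1)[of i] i by blast
      have "P j \<subseteq> P i" using i by (auto simp: past_def intro: trancl_into_trancl)
      then show ?thesis using r by blast
    qed blast
  qed
qed

lemma coordinate_cover:
  assumes "i < n" shows "\<exists>r\<in>L. i \<in> U r"
proof -
  obtain j where j: "j < N" "i \<in> J j" using assms blocks_cover by blast
  obtain r where "r \<in> L" "P j \<subseteq> P r" using leaf_above[OF j(1)] by blast
  moreover have "j \<in> P j" by (simp add: past_def)
  ultimately show ?thesis using j(2) by (auto simp: vars_def)
qed

section \<open>Decomposition of the region of attraction\<close>

lemma all_polys:
  "set (glist gX {..<N}) \<subseteq> polys {..<n}" "set (glist gT {..<N}) \<subseteq> polys {..<n}"
  using glist_polys[OF order_refl gX_poly] glist_polys[OF order_refl gT_poly] by (simp_all add: vars_all)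

lemma all_ball:
  "ball_bounded {..<n} (glist gX {..<N})" "ball_bounded {..<n} (glist gT {..<N})"
  using glist_ball[OF order_refl gX_ball] glist_ball[OF order_refl gT_ball] by (simp_all add: vars_all)

text \<open>\<open>ROA\<close> asks for curves inside \<open>X\<close>, hence for extensional ones.
  Any admissible curve is made so by restriction, which no polynomial in these variables
  notices.\<close>

lemma RT_reach: "RT = reach {..<n} f T (glist gX {..<N}) (glist gT {..<N})" (is "_ = reach ?V f T ?GX ?GY")
proof (intro set_eqI iffI)
  fix x assume "x \<in> RT"
  then obtain y where y: "x \<in> X" "y 0 = x" "\<forall>t\<in>{0..T}. y t \<in> X" "y T \<in> semialg ?V ?GY"
    "\<forall>i<n. \<forall>t\<in>{0..T}. ((\<lambda>s. y s i) has_real_derivative f i (y t)) (at t within {0..T})"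
    unfolding ROA_def by blast
  then have "admissible ?V f T ?GX ?GY y" by (auto simp: admissible_def semialg_def)
  then show "x \<in> reach ?V f T ?GX ?GY" using y(1,2) unfolding reach_def semialg_def by blast
next
  fix x assume x: "x \<in> reach ?V f T ?GX ?GY"
  then obtain y where y: "x \<in> PiE ?V (\<lambda>_. UNIV)" "\<forall>i\<in>?V. y 0 i = x i" "admissible ?V f T ?GX ?GY y"
    by (auto simp: reach_def)
  define z where "z s = restrict (y s) ?V" for s
  have eq: "p (z s) = p (y s)" if "p \<in> polys ?V" for p s
    by (rule polys_cong[OF that]) (simp add: z_def)
  have "z 0 = x" using y(1,2) by (auto simp: z_def fun_eq_iff PiE_def extensional_def)
  moreover have zX: "z s \<in> X" if "s \<in> {0..T}" for s
  proof -
    have "0 \<le> g (z s)" if g: "g \<in> set ?GX" for g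
      using y(3) \<open>s \<in> {0..T}\<close> g eq[of g s] all_polys(1) by (auto simp: admissible_def)
    then show ?thesis by (simp add: semialg_def z_def)
  qed
  moreover have "z T \<in> semialg ?V ?GY"
  proof -
    have "0 \<le> g (z T)" if g: "g \<in> set ?GY" for g
      using y(3) g eq[of g T] all_polys(2) by (auto simp: admissible_def)
    then show ?thesis by (simp add: semialg_def z_def)
  qed
  moreover have "((\<lambda>s. z s i) has_real_derivative f i (z t)) (at t within {0..T})" if "i < n" "t \<in> {0..T}" for i t
    unfolding eq[OF f_polys_all[OF that(1)]] using y(3) that by (simp add: z_def admissible_def)
  moreover have "x \<in> X" using zX[of 0] \<open>z 0 = x\<close> T_pos by simp
  ultimately show "x \<in> RT" unfolding ROA_def by blast
qed

text \<open>The intersection of two pasts is again closed under predecessors, so the shared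
  coordinates form an autonomous system. Both curves stay in a box where its clipped field is
  \<open>f\<close>, and Gronwall applies with zero errors.\<close>

lemma solutions_agree:
  assumes r: "r \<in> L" "r' \<in> L" and i: "i \<in> U r" "i \<in> U r'" and s: "s \<in> {0..T}"
    and y: "admissible (U r) f T (GX r) (GY r) y" and z: "admissible (U r') f T (GX r') (GY r') z"
    and eq: "\<And>j. j \<in> U r \<inter> U r' \<Longrightarrow> y 0 j = z 0 j"
  shows "y s i = z s i"
proof -
  note rN = leaf_less[OF r(1)] leaf_less[OF r(2)]
  let ?W = "U r \<inter> U r'"
  have fW: "f j \<in> polys ?W" if j: "j \<in> ?W" for j
  proof (rule polys_of_independent[OF finite_lessThan f_polys_all])
    show "j < n" using j U_subset[OF rN(1)] by auto
  qed (use j U_subset[OF rN(1)] f_local[OF rN(1), of j] f_local[OF rN(2), of j] in blast)+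
  have W: "finite ?W" using finite_U[OF rN(1)] by simp
  obtain R1 where R1: "R1 \<ge> 0" "\<forall>x. (\<forall>g\<in>set (GX r). 0 \<le> g x) \<longrightarrow> (\<forall>j\<in>U r. \<bar>x j\<bar> \<le> R1)"
    using ball_bounded_box[OF finite_U[OF rN(1)] GX(2)[OF rN(1)]] by blast
  obtain R2 where R2: "R2 \<ge> 0" "\<forall>x. (\<forall>g\<in>set (GX r'). 0 \<le> g x) \<longrightarrow> (\<forall>j\<in>U r'. \<bar>x j\<bar> \<le> R2)"
    using ball_bounded_box[OF finite_U[OF rN(2)] GX(2)[OF rN(2)]] by blast
  define R where "R = max R1 R2"
  have R: "R \<ge> 0" using R1 by (auto simp: R_def)
  have yR: "\<bar>y s j\<bar> \<le> R" if "s \<in> {0..T}" "j \<in> ?W" for s j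
    using R1(2)[rule_format, of "y s" j] y that by (auto simp: admissible_def R_def)
  have zR: "\<bar>z s j\<bar> \<le> R" if "s \<in> {0..T}" "j \<in> ?W" for s j
    using R2(2)[rule_format, of "z s" j] z that by (auto simp: admissible_def R_def)
  obtain B Lf Df where "ode_system ?W f T R B Lf Df" using ode_system_exists[where f = f, OF W T_pos fW R] by blast
  then interpret S: ode_system ?W f T R B Lf Df .
  have "\<bar>y s i - z s i\<bar> \<le> (0 + 0) * (1 + T) * exp (Lf * T)"
  proof (rule S.gronwall[where y = y and z = z and y' = "\<lambda>s i. f i (y s)" and z' = "\<lambda>s i. f i (z s)" and C = "2 * R"])
    show "\<bar>f j (y s) - S.fs j (y s)\<bar> \<le> 0" if "s \<in> {0..T}" "j \<in> ?W" for s j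
      using S.fs_eq[OF that(2), of "y s"] yR[OF that(1)] by simp
    show "\<bar>f j (z s) - S.fs j (z s)\<bar> \<le> 0" if "s \<in> {0..T}" "j \<in> ?W" for s j
      using S.fs_eq[OF that(2), of "z s"] zR[OF that(1)] by simp
    show "\<bar>y s j - z s j\<bar> \<le> 2 * R" if "s \<in> {0..T}" "j \<in> ?W" for s j
      using yR[OF that] zR[OF that] by linarith
  qed (use y z eq i s in \<open>auto simp: admissible_def\<close>)
  then show ?thesis by simp
qed

lemma restrict_RT:
  assumes r: "r \<in> L" and x: "x \<in> RT"
  shows "restrict x (U r) \<in> Z r"
proof -
  note rN = leaf_less[OF r]
  obtain y where y: "\<forall>i\<in>{..<n}. y 0 i = x i" "admissible {..<n} f T (glist gX {..<N}) (glist gT {..<N}) y"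
    using x unfolding RT_reach by (auto simp: reach_def)
  have "admissible (U r) f T (GX r) (GY r) y"
    using y(2) set_GX[OF rN] set_GY[OF rN] U_subset[OF rN] unfolding admissible_def by blast
  moreover have "\<forall>i\<in>U r. y 0 i = restrict x (U r) i" using y(1) U_subset[OF rN] by auto
  ultimately show ?thesis unfolding reach_def by auto
qed

text \<open>Each coordinate is taken from the curve of some leaf whose past contains it. Agreement
  on shared coordinates makes the glued curve coincide with every leaf curve on its variables, and
  each constraint and each component of \<open>f\<close> involves the variables of one past
  only.\<close>

lemma RT_from_leaves:
  assumes x: "x \<in> X" and Z: "\<And>r. r \<in> L \<Longrightarrow> restrict x (U r) \<in> Z r"
  shows "x \<in> RT"
proof -
  have "\<forall>r\<in>L. \<exists>y. (\<forall>i\<in>U r. y 0 i = x i) \<and> admissible (U r) f T (GX r) (GY r) y"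
    using Z by (fastforce simp: reach_def)
  then obtain Y where Y: "\<And>r i. r \<in> L \<Longrightarrow> i \<in> U r \<Longrightarrow> Y r 0 i = x i"
    "\<And>r. r \<in> L \<Longrightarrow> admissible (U r) f T (GX r) (GY r) (Y r)" by metis
  obtain l where l: "\<And>i. i < n \<Longrightarrow> l i \<in> L \<and> i \<in> U (l i)" using coordinate_cover by metis
  define y where "y s i = Y (l i) s i" for s i
  have yY: "y s i = Y r s i" if r: "r \<in> L" and i: "i \<in> U r" and s: "s \<in> {0..T}" for r s i
  proof -
    have "i < n" using U_subset[OF leaf_less[OF r]] i by auto
    then have li: "l i \<in> L" "i \<in> U (l i)" using l by auto
    show ?thesis unfolding y_def
      by (rule solutions_agree[OF li(1) r li(2) i s Y(2)[OF li(1)] Y(2)[OF r]]) (use Y(1) li r in auto)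
  qed
  have yp: "p (y s) = p (Y r s)" if "r \<in> L" "p \<in> polys (U r)" "s \<in> {0..T}" for r p s
    by (rule polys_cong[OF that(2)]) (use yY that in auto)
  have block: "\<exists>r\<in>L. h \<in> set (glist g (P r)) \<and> P r \<subseteq> {..<N}" if h: "h \<in> set (glist g {..<N})" for g :: "nat \<Rightarrow> ((nat \<Rightarrow> real) \<Rightarrow> real) list" and h
  proof -
    obtain j where j: "j < N" "h \<in> set (g j)" using h set_glist[OF order_refl, of g] by auto
    obtain r where r: "r \<in> L" "P j \<subseteq> P r" using leaf_above[OF j(1)] by blast
    have "j \<in> P j" by (simp add: past_def)
    then show ?thesis using r j set_glist[OF past_subset[OF leaf_less[OF r(1)]], of g] past_subset[OF leaf_less[OF r(1)]] by blast
  qed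
  have "admissible {..<n} f T (glist gX {..<N}) (glist gT {..<N}) y"
    unfolding admissible_def
  proof (intro conjI ballI)
    fix s g assume s: "s \<in> {0..T}" and g: "g \<in> set (glist gX {..<N})"
    then obtain r where r: "r \<in> L" "g \<in> set (GX r)" using block by blast
    have "g (y s) = g (Y r s)" using yp[OF r(1) _ s] GX(1)[OF leaf_less[OF r(1)]] r(2) by blast
    then show "0 \<le> g (y s)" using Y(2)[OF r(1)] r(2) s by (simp add: admissible_def)
  next
    fix g assume g: "g \<in> set (glist gT {..<N})"
    then obtain r where r: "r \<in> L" "g \<in> set (GY r)" using block by blast
    have "g (y T) = g (Y r T)" using yp[OF r(1), of g T] GY(1)[OF leaf_less[OF r(1)]] r(2) T_pos by auto
    then show "0 \<le> g (y T)" using Y(2)[OF r(1)] r(2) by (simp add: admissible_def)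
  next
    fix i s assume i: "i \<in> {..<n}" and s: "s \<in> {0..T}"
    then have li: "l i \<in> L" "i \<in> U (l i)" using l by auto
    have "f i (y s) = f i (Y (l i) s)" by (rule yp[OF li(1) f_polys[OF leaf_less[OF li(1)] li(2)] s])
    then show "((\<lambda>s. y s i) has_real_derivative f i (y s)) (at s within {0..T})"
      using Y(2)[OF li(1)] li(2) s unfolding y_def by (simp add: admissible_def)
  qed
  moreover have "\<forall>i\<in>{..<n}. y 0 i = x i" using l Y(1) by (auto simp: y_def)
  moreover have "x \<in> PiE {..<n} (\<lambda>_. UNIV)" using x by (simp add: semialg_def)
  ultimately show ?thesis unfolding RT_reach reach_def by blast
qed

lemma dec_inclusion:
  assumes r: "r \<in> L" and feas: "dec_feas N J f gX gT T k r v w" and x: "x \<in> RT"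
  shows "1 \<le> w x"
proof -
  note rN = leaf_less[OF r]
  have F: "feasible (U r) f T (GX r) (GY r) k v w" using feas dec_feas_feasible[OF rN] by simp
  have "1 \<le> w (restrict x (U r))"
    by (rule feasible_ge_one[OF finite_U[OF rN] _ F restrict_RT[OF r x]]) (use T_pos in simp)
  moreover have "w (restrict x (U r)) = w x"
    by (rule polys_cong[of w "U r"]) (use F polys_iff in \<open>auto simp: feasible_def\<close>)
  ultimately show ?thesis by simp
qed

text \<open>Only sums over the leaves have a sign here, so one trajectory of the full system is
  followed for all leaves at once.\<close>

lemma sparse_inclusion:
  assumes feas: "sp_feas N J f gX gT T k v w" and x: "x \<in> RT"
  shows "real (card L) \<le> (\<Sum>r\<in>L. w r x)"
proof -
  have v: "\<And>r. r \<in> L \<Longrightarrow> v r \<in> tpolys (U r)" and w: "\<And>r. r \<in> L \<Longrightarrow> w r \<in> polys (U r)"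
    and c1: "stcert L U k T GX (\<lambda>t x. - (\<Sum>r\<in>L. Lop f (U r) (v r) t x))"
    and c2: "scert L U k GY (\<lambda>x. \<Sum>r\<in>L. v r T x)"
    and c3: "scert L U k GX (\<lambda>x. (\<Sum>r\<in>L. w r x - v r 0 x) - real (card L))"
    using feas polys_iff tpolys_iff unfolding sp_feas_def Let_def by auto
  obtain y where y0: "\<forall>i\<in>{..<n}. y 0 i = x i" and y: "admissible {..<n} f T (glist gX {..<N}) (glist gT {..<N}) y"
    using x unfolding RT_reach by (auto simp: reach_def)
  have yr: "admissible (U r) f T (GX r) (GY r) y" if "r \<in> L" for r
    using y set_GX[OF leaf_less[OF that]] set_GY[OF leaf_less[OF that]] U_subset[OF leaf_less[OF that]]
    unfolding admissible_def by blast
  have Ls: "(\<Sum>r\<in>L. Lop f (U r) (v r) s (y s)) \<le> 0" if s: "s \<in> {0..T}" for s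
  proof -
    obtain hs where hs: "\<forall>r\<in>L. tcert (U r) k T (GX r) (hs r)" "\<And>t x. - (\<Sum>r\<in>L. Lop f (U r) (v r) t x) = (\<Sum>r\<in>L. hs r t x)"
      using c1 unfolding stcert_def by blast
    have "0 \<le> (\<Sum>r\<in>L. hs r s (y s))"
    proof (rule sum_nonneg)
      fix r assume r: "r \<in> L"
      then show "0 \<le> hs r s (y s)" using tcert_nonneg[of "U r" k T "GX r" "hs r" "y s" s] hs(1) yr[OF r] s
        by (auto simp: admissible_def)
    qed
    then show ?thesis using hs(2)[of s "y s"] by linarith
  qed
  have VT: "0 \<le> (\<Sum>r\<in>L. v r T (y T))"
  proof -
    obtain hs where hs: "\<forall>r\<in>L. cert (U r) k (GY r) (hs r)" "\<And>x. (\<Sum>r\<in>L. v r T x) = (\<Sum>r\<in>L. hs r x)"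
      using c2 unfolding scert_def by blast
    have "0 \<le> (\<Sum>r\<in>L. hs r (y T))"
    proof (rule sum_nonneg)
      fix r assume r: "r \<in> L"
      then show "0 \<le> hs r (y T)" using cert_nonneg[of "U r" k "GY r" "hs r" "y T"] hs(1) yr[OF r]
        by (auto simp: admissible_def)
    qed
    then show ?thesis using hs(2) by simp
  qed
  have W0: "0 \<le> (\<Sum>r\<in>L. w r (y 0) - v r 0 (y 0)) - real (card L)"
  proof -
    obtain hs where hs: "\<forall>r\<in>L. cert (U r) k (GX r) (hs r)"
      "\<And>x. (\<Sum>r\<in>L. w r x - v r 0 x) - real (card L) = (\<Sum>r\<in>L. hs r x)"
      using c3 unfolding scert_def by blast
    have "0 \<le> (\<Sum>r\<in>L. hs r (y 0))"
    proof (rule sum_nonneg)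
      fix r assume r: "r \<in> L"
      then show "0 \<le> hs r (y 0)" using cert_nonneg[of "U r" k "GX r" "hs r" "y 0"] hs(1) yr[OF r] T_pos
        by (auto simp: admissible_def)
    qed
    then show ?thesis using hs(2) by simp
  qed
  have "- (\<Sum>r\<in>L. v r 0 (y 0)) \<le> - (\<Sum>r\<in>L. v r T (y T))"
  proof (rule nondecreasing_Icc[of 0 T "\<lambda>s. - (\<Sum>r\<in>L. v r s (y s))" "\<lambda>s. - (\<Sum>r\<in>L. Lop f (U r) (v r) s (y s))"])
    show "((\<lambda>s. - (\<Sum>r\<in>L. v r s (y s))) has_real_derivative - (\<Sum>r\<in>L. Lop f (U r) (v r) s (y s))) (at s within {0..T})"
      if s: "s \<in> {0..T}" for s
    proof (rule DERIV_minus[OF DERIV_sum])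
      fix r assume r: "r \<in> L"
      show "((\<lambda>s. v r s (y s)) has_real_derivative Lop f (U r) (v r) s (y s)) (at s within {0..T})"
        using yr[OF r] s
        by (intro tpolys_solution_deriv[where y = y and f = f, OF finite_U[OF leaf_less[OF r]] _ v[OF r]])
          (auto simp: admissible_def)
    qed
  qed (use Ls T_pos in auto)
  then have "real (card L) \<le> (\<Sum>r\<in>L. w r (y 0))" using VT W0 by (simp add: sum_subtractf)
  also have "(\<Sum>r\<in>L. w r (y 0)) = (\<Sum>r\<in>L. w r x)"
  proof (rule sum.cong[OF refl])
    fix r assume r: "r \<in> L"
    show "w r (y 0) = w r x"
      by (rule polys_cong[OF w[OF r]]) (use y0 U_subset[OF leaf_less[OF r]] in auto)
  qed
  finally show ?thesis .
qed

section \<open>Volume of the overestimate\<close>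

lemma RT_measurable: "RT \<in> sets (lebV {..<n})"
  unfolding RT_reach by (rule relaxation_converges(1)[OF finite_lessThan T_pos _ all_polys(1) all_ball(1) all_polys(2) all_ball(2)])
    (use f_polys_all in auto)

text \<open>The \<open>max 0\<close> makes the quantity fit for \<open>ennreal\<close> without first
  comparing the objective with the volume.\<close>

definition excess :: "nat \<Rightarrow> ((nat \<Rightarrow> real) \<Rightarrow> real) \<Rightarrow> real" where
  "excess r w = max 0 (dec_obj N J f gX r w - measure (lebV (U r)) (Z r))"

text \<open>The optimal value is at most that of a fixed near-optimal competitor, which is feasible
  from some degree on.\<close>

lemma excess_tendsto:
  assumes r: "r \<in> L" and opt: "\<forall>k\<ge>k0. dec_opt N J f gX gT T k r (wd k)"
  shows "(\<lambda>k. excess r (wd k)) \<longlonglongrightarrow> 0"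
proof (rule order_tendstoI)
  note rN = leaf_less[OF r]
  show "\<forall>\<^sub>F k in sequentially. a < excess r (wd k)" if "a < 0" for a
    using that by (simp add: excess_def less_max_iff_disj)
  fix e :: real assume e: "0 < e"
  obtain v w where vw: "\<forall>\<^sub>F k in sequentially. feasible (U r) f T (GX r) (GY r) k v w"
    "intg (U r) (semialg (U r) (GX r)) w < measure (lebV (U r)) (Z r) + e"
    using relaxation_converges(2)[where f = f, OF finite_U[OF rN] T_pos f_polys[OF rN] GX[OF rN] GY[OF rN] e] by blast
  show "\<forall>\<^sub>F k in sequentially. excess r (wd k) < e"
    using vw(1) eventually_ge_at_top[of k0]
  proof eventually_elim
    case (elim k)
    then have "dec_obj N J f gX r (wd k) \<le> dec_obj N J f gX r w"
      using opt dec_feas_feasible[OF rN] unfolding dec_opt_def by blast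
    then show ?case using vw(2) e dec_obj_intg[OF rN] by (simp add: excess_def)
  qed
qed

text \<open>A point of the approximation off the region fails at some leaf, hence lies in the
  truncated cylinder over the excess set of that leaf. The constant does not depend on the
  degree.\<close>

lemma dec_excess:
  shows "\<exists>C\<ge>0. \<forall>k w v. (\<forall>r\<in>L. dec_feas N J f gX gT T k r (v r) (w r)) \<longrightarrow>
     {x \<in> X. \<forall>r\<in>L. 1 \<le> w r x} \<in> sets (lebV {..<n}) \<and>
     emeasure (lebV {..<n}) ({x \<in> X. \<forall>r\<in>L. 1 \<le> w r x} - RT) \<le> ennreal (\<Sum>r\<in>L. C * excess r (w r))"
proof -
  let ?V = "{..<n}"
  obtain R where R: "R \<ge> 0" "\<forall>x. (\<forall>g\<in>set (glist gX {..<N}). 0 \<le> g x) \<longrightarrow> (\<forall>j\<in>?V. \<bar>x j\<bar> \<le> R)"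
    using ball_bounded_box[OF finite_lessThan all_ball(1)] by blast
  \<comment> \<open>The base is at least 1, so the exponent \<open>n\<close> dominates the box
    volumes \<open>(2 * R) ^ card ({..<n} - U r)\<close> of all leaves at once.\<close>
  define C where "C = (1 + 2 * R) ^ n"
  have C: "0 \<le> C" using R by (simp add: C_def)
  have Xm: "X \<in> sets (lebV ?V)" by (rule semialg_measurable[OF all_polys(1)])
  show ?thesis
  proof (intro exI[of _ C] conjI allI impI C)
    fix k w v assume feas: "\<forall>r\<in>L. dec_feas N J f gX gT T k r (v r) (w r)"
    let ?S = "{x \<in> X. \<forall>r\<in>L. 1 \<le> w r x}"
    have F: "feasible (U r) f T (GX r) (GY r) k (v r) (w r)" if "r \<in> L" for r
      using feas dec_feas_feasible[OF leaf_less[OF that]] that by blast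
    have w: "w r \<in> polys (U r)" if "r \<in> L" for r using F[OF that] polys_iff by (auto simp: feasible_def)
    have "{x \<in> space (lebV ?V). \<forall>r\<in>L. 1 \<le> w r x} \<in> sets (lebV ?V)"
    proof (rule sets.sets_Collect_finite_All[OF _ finite_L])
      fix r assume r: "r \<in> L"
      have [measurable]: "w r \<in> borel_measurable (lebV ?V)"
        by (rule polys_measurable[OF polys_subset[OF w[OF r] U_subset[OF leaf_less[OF r]]]])
      show "{x \<in> space (lebV ?V). 1 \<le> w r x} \<in> sets (lebV ?V)" by measurable
    qed
    from sets.Int[OF Xm this] show "?S \<in> sets (lebV ?V)"
      by (rule back_subst[of "\<lambda>S. S \<in> sets (lebV ?V)"]) (use sets.sets_into_space[OF Xm] in auto)
    define A where "A r = {x \<in> semialg (U r) (GX r) - Z r. 1 \<le> w r x}" for r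
    define D where "D r = {x \<in> PiE ?V (\<lambda>_. UNIV). restrict x (U r) \<in> A r \<and> (\<forall>j\<in>?V - U r. \<bar>x j\<bar> \<le> R)}" for r
    have A: "A r \<in> sets (lebV (U r))" "emeasure (lebV (U r)) (A r) \<le> ennreal (excess r (w r))" if r: "r \<in> L" for r
    proof -
      note rN = leaf_less[OF r]
      note Zm = relaxation_converges(1)[where f = f, OF finite_U[OF rN] T_pos f_polys[OF rN] GX[OF rN] GY[OF rN]]
      have Zs: "Z r \<subseteq> semialg (U r) (GX r)" by (rule reach_subset[OF _ GX(1)[OF rN]]) (use T_pos in simp)
      note ex = excess_measure_bound[OF finite_U[OF rN] GX[OF rN] w[OF r] Zm Zs feasible_nonneg[OF F[OF r]] feasible_ge_one[OF finite_U[OF rN] less_imp_le[OF T_pos] F[OF r]]]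
      show "A r \<in> sets (lebV (U r))" unfolding A_def by (rule ex(1))
      have "emeasure (lebV (U r)) (A r) \<le> ennreal (dec_obj N J f gX r (w r) - measure (lebV (U r)) (Z r))"
        unfolding A_def dec_obj_intg[OF rN] by (rule ex(2))
      also have "\<dots> \<le> ennreal (excess r (w r))" by (rule ennreal_leI) (simp add: excess_def)
      finally show "emeasure (lebV (U r)) (A r) \<le> ennreal (excess r (w r))" .
    qed
    have Dm: "D r \<in> sets (lebV ?V)" and De: "emeasure (lebV ?V) (D r) \<le> ennreal (C * excess r (w r))" if r: "r \<in> L" for r
    proof -
      note rN = leaf_less[OF r]
      note cyl = cylinder_measure[OF finite_lessThan U_subset[OF rN] A(1)[OF r] R(1)]
      show "D r \<in> sets (lebV ?V)" unfolding D_def by (rule cyl(2))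
      have "emeasure (lebV ?V) (D r) = emeasure (lebV (U r)) (A r) * ennreal ((2 * R) ^ card (?V - U r))"
        unfolding D_def by (rule cyl(1))
      also have "\<dots> \<le> ennreal (excess r (w r)) * ennreal C"
      proof (intro mult_mono A(2) r ennreal_leI)
        have "(2 * R) ^ card (?V - U r) \<le> (1 + 2 * R) ^ card (?V - U r)" using R by (intro power_mono) auto
        also have "\<dots> \<le> C" unfolding C_def
          using R card_mono[of ?V "?V - U r"] by (intro power_increasing) auto
        finally show "(2 * R) ^ card (?V - U r) \<le> C" .
      qed auto
      also have "\<dots> = ennreal (C * excess r (w r))"
        using C by (subst ennreal_mult[symmetric]) (auto simp: excess_def mult.commute)
      finally show "emeasure (lebV ?V) (D r) \<le> ennreal (C * excess r (w r))" .
    qed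
    have "?S - RT \<subseteq> (\<Union>r\<in>L. D r)"
    proof
      fix x assume x: "x \<in> ?S - RT"
      then obtain r where r: "r \<in> L" "restrict x (U r) \<notin> Z r" using RT_from_leaves[of x] by blast
      note rN = leaf_less[OF r(1)]
      have "w r (restrict x (U r)) = w r x" by (rule polys_cong[OF w[OF r(1)]]) simp
      then have "restrict x (U r) \<in> A r" using restrict_X[OF rN, of x] x r by (auto simp: A_def)
      moreover have "\<forall>j\<in>?V. \<bar>x j\<bar> \<le> R" using R(2) x by (auto simp: semialg_def)
      moreover have "x \<in> PiE ?V (\<lambda>_. UNIV)" using x by (auto simp: semialg_def)
      ultimately show "x \<in> (\<Union>r\<in>L. D r)" using r(1) unfolding D_def by blast
    qed
    then have "emeasure (lebV ?V) (?S - RT) \<le> emeasure (lebV ?V) (\<Union>r\<in>L. D r)"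
      using Dm finite_L by (intro emeasure_mono sets.finite_UN) auto
    also have "\<dots> \<le> (\<Sum>r\<in>L. emeasure (lebV ?V) (D r))"
      using Dm finite_L by (intro emeasure_subadditive_finite) auto
    also have "\<dots> \<le> (\<Sum>r\<in>L. ennreal (C * excess r (w r)))" by (intro sum_mono De)
    also have "\<dots> = ennreal (\<Sum>r\<in>L. C * excess r (w r))"
      using C by (intro sum_ennreal) (auto simp: excess_def)
    finally show "emeasure (lebV ?V) (?S - RT) \<le> ennreal (\<Sum>r\<in>L. C * excess r (w r))" .
  qed
qed

lemma card_vars_past:
  assumes r: "r < N" shows "card (U r) = (\<Sum>j\<in>P r. card (J j))"
  unfolding vars_def
proof (rule card_UN_disjoint)
  show "finite (P r)" using past_subset[OF r] finite_subset by blast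
  show "\<forall>j\<in>P r. finite (J j)" using past_subset[OF r] J_subset finite_subset[OF _ finite_lessThan] by blast
  show "\<forall>i\<in>P r. \<forall>j\<in>P r. i \<noteq> j \<longrightarrow> J i \<inter> J j = {}" using past_subset[OF r] blocks_disj by blast
qed

text \<open>The multipliers for leaf \<open>r\<close> act on the variables \<open>U r\<close>. Pasts
  grow along edges, so the maximum over all nodes is attained at a leaf.\<close>

lemma max_clique: "Max ((\<lambda>r. card (U r)) ` L) = Max ((\<lambda>i. \<Sum>j\<in>P i. card (J j)) ` {..<N})"
proof (cases "N = 0")
  case True
  \<comment> \<open>Without blocks there are no leaves, and both sides are
    \<open>Max {}\<close>.\<close>
  then show ?thesis by (simp add: leaves_def)
next
  case False
  let ?h = "\<lambda>i. \<Sum>j\<in>P i. card (J j)"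
  have eq: "(\<lambda>r. card (U r)) ` L = ?h ` L" using card_vars_past leaf_less by (intro image_cong) auto
  have ne: "L \<noteq> {}" using leaf_above[of 0] False by blast
  show ?thesis unfolding eq
  proof (rule antisym)
    show "Max (?h ` L) \<le> Max (?h ` {..<N})"
      using ne leaf_less by (intro Max_mono) auto
    show "Max (?h ` {..<N}) \<le> Max (?h ` L)"
    proof (rule Max.boundedI)
      fix a assume "a \<in> ?h ` {..<N}"
      then obtain i where i: "i < N" "a = ?h i" by auto
      obtain r where r: "r \<in> L" "P i \<subseteq> P r" using leaf_above[OF i(1)] by blast
      have "finite (P r)" using past_subset[OF leaf_less[OF r(1)]] finite_subset by blast
      then have "a \<le> ?h r" unfolding i(2) using r(2) by (intro sum_mono2) auto
      also have "\<dots> \<le> Max (?h ` L)" using r(1) finite_L by (intro Max_ge) auto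
      finally show "a \<le> Max (?h ` L)" .
    qed (use False in auto)
  qed
qed

text \<open>Measurability of \<open>D k\<close> accompanies the limit because
  \<open>emeasure\<close> is 0 by default on nonmeasurable sets, where the limit would say
  nothing.\<close>

lemma convergence:
  assumes dec: "\<forall>k\<ge>k0. \<forall>r\<in>L. dec_opt N J f gX gT T k r (wd k r)"
    and sp: "\<forall>k\<ge>k0. sp_opt N J f gX gT T k (vs k) (ws k)"
  defines "S \<equiv> \<lambda>k. {x \<in> X. \<forall>r\<in>L. 1 \<le> wd k r x}"
    and "Y \<equiv> \<lambda>k. {x \<in> X. real (card L) \<le> (\<Sum>r\<in>L. ws k r x)}"
  defines "D \<equiv> \<lambda>k. ((S k \<inter> Y k) - RT) \<union> (RT - (S k \<inter> Y k))"
  shows "\<forall>k\<ge>k0. RT \<subseteq> S k \<inter> Y k" "\<forall>k\<ge>k0. D k \<in> sets (lebV {..<n})"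
    "(\<lambda>k. emeasure (lebV {..<n}) (D k)) \<longlonglongrightarrow> 0"
proof -
  let ?M = "lebV {..<n}"
  have "\<forall>k. \<exists>v. k \<ge> k0 \<longrightarrow> (\<forall>r\<in>L. dec_feas N J f gX gT T k r (v r) (wd k r))"
    using dec unfolding dec_opt_def by metis
  then obtain vd where vd: "\<And>k r. k \<ge> k0 \<Longrightarrow> r \<in> L \<Longrightarrow> dec_feas N J f gX gT T k r (vd k r) (wd k r)" by metis
  have RTX: "RT \<subseteq> X" by (auto simp: ROA_def)
  have sub: "RT \<subseteq> S k \<inter> Y k" if k: "k \<ge> k0" for k
  proof
    fix x assume x: "x \<in> RT"
    have "1 \<le> wd k r x" if "r \<in> L" for r by (rule dec_inclusion[OF that vd[OF k that] x])
    moreover have "real (card L) \<le> (\<Sum>r\<in>L. ws k r x)"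
      using sp k sparse_inclusion[OF _ x] unfolding sp_opt_def by blast
    ultimately show "x \<in> S k \<inter> Y k" using x RTX by (auto simp: S_def Y_def)
  qed
  then show "\<forall>k\<ge>k0. RT \<subseteq> S k \<inter> Y k" by blast
  have D_eq: "D k = (S k \<inter> Y k) - RT" if "k \<ge> k0" for k using sub[OF that] by (auto simp: D_def)
  obtain C where C: "0 \<le> C" and dx: "\<forall>k w v. (\<forall>r\<in>L. dec_feas N J f gX gT T k r (v r) (w r)) \<longrightarrow>
     {x \<in> X. \<forall>r\<in>L. 1 \<le> w r x} \<in> sets ?M \<and>
     emeasure ?M ({x \<in> X. \<forall>r\<in>L. 1 \<le> w r x} - RT) \<le> ennreal (\<Sum>r\<in>L. C * excess r (w r))"
    using dec_excess by (elim exE conjE) (rule that)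
  have Sm: "S k \<in> sets ?M" and Se: "emeasure ?M (S k - RT) \<le> ennreal (\<Sum>r\<in>L. C * excess r (wd k r))"
    if "k \<ge> k0" for k
    using dx[rule_format, of k "vd k" "wd k", OF vd[OF that]] unfolding S_def by blast+
  have Ym: "Y k \<in> sets ?M" if k: "k \<ge> k0" for k
  proof -
    have "ws k r \<in> polys (U r)" if "r \<in> L" for r
      using sp k that polys_iff unfolding sp_opt_def sp_feas_def Let_def by blast
    then have "(\<lambda>x. \<Sum>r\<in>L. ws k r x) \<in> polys {..<n}"
      using U_subset leaf_less by (intro polys_sum finite_L) (blast intro: polys_subset)
    then have [measurable]: "(\<lambda>x. \<Sum>r\<in>L. ws k r x) \<in> borel_measurable ?M" by (rule polys_measurable)
    have Xm: "X \<in> sets ?M" by (rule semialg_measurable[OF all_polys(1)])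
    have "{x \<in> space ?M. real (card L) \<le> (\<Sum>r\<in>L. ws k r x)} \<in> sets ?M" by measurable
    from sets.Int[OF Xm this] show ?thesis
      unfolding Y_def by (rule back_subst[of "\<lambda>S. S \<in> sets ?M"]) (use sets.sets_into_space[OF Xm] in auto)
  qed
  show "\<forall>k\<ge>k0. D k \<in> sets ?M"
    using D_eq Sm Ym RT_measurable by (auto intro!: sets.Diff sets.Int)
  have lim: "(\<lambda>k. ennreal (\<Sum>r\<in>L. C * excess r (wd k r))) \<longlonglongrightarrow> ennreal (\<Sum>r\<in>L. C * 0)"
    using dec by (intro tendsto_ennrealI tendsto_sum tendsto_mult tendsto_const excess_tendsto[where ?k0.0 = k0]) auto
  show "(\<lambda>k. emeasure ?M (D k)) \<longlonglongrightarrow> 0"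
  proof (rule tendsto_sandwich[OF _ _ tendsto_const])
    show "\<forall>\<^sub>F k in sequentially. emeasure ?M (D k) \<le> ennreal (\<Sum>r\<in>L. C * excess r (wd k r))"
      using eventually_ge_at_top[of k0]
    proof eventually_elim
      case (elim k)
      have "emeasure ?M (D k) \<le> emeasure ?M (S k - RT)"
        unfolding D_eq[OF elim] using Sm[OF elim] RT_measurable by (intro emeasure_mono sets.Diff) auto
      then show ?case using Se[OF elim] by (rule order_trans)
    qed
    show "(\<lambda>k. ennreal (\<Sum>r\<in>L. C * excess r (wd k r))) \<longlonglongrightarrow> 0" using lim by simp
  qed simp
qed

end

theorem theorem5:
  fixes n N k0 :: nat and J :: "nat \<Rightarrow> nat set"
    and f :: "nat \<Rightarrow> (nat \<Rightarrow> real) \<Rightarrow> real"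
    and gX gT :: "nat \<Rightarrow> ((nat \<Rightarrow> real) \<Rightarrow> real) list"
    and T :: real
    and wd :: "nat \<Rightarrow> nat \<Rightarrow> (nat \<Rightarrow> real) \<Rightarrow> real"
    and vs :: "nat \<Rightarrow> nat \<Rightarrow> real \<Rightarrow> (nat \<Rightarrow> real) \<Rightarrow> real"
    and ws :: "nat \<Rightarrow> nat \<Rightarrow> (nat \<Rightarrow> real) \<Rightarrow> real"
  assumes T_pos: "T > 0"
    and blocks_ne: "\<forall>j<N. J j \<noteq> {}"
    and blocks_cover: "(\<Union>j<N. J j) = {..<n}"
    and blocks_disj: "\<forall>i<N. \<forall>j<N. i \<noteq> j \<longrightarrow> J i \<inter> J j = {}"
    and f_poly: "\<forall>a<n. \<exists>d. poly_on {..<n} d (f a)"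
    and gX_poly: "\<forall>j<N. \<forall>g\<in>set (gX j). \<exists>d. poly_on (J j) d g"
    and gT_poly: "\<forall>j<N. \<forall>g\<in>set (gT j). \<exists>d. poly_on (J j) d g"
    and gX_ball: "\<forall>j<N. \<exists>R>0. (\<lambda>x. R\<^sup>2 - (\<Sum>i\<in>J j. (x i)\<^sup>2)) \<in> set (gX j)"
    and gT_ball: "\<forall>j<N. \<exists>R>0. (\<lambda>x. R\<^sup>2 - (\<Sum>i\<in>J j. (x i)\<^sup>2)) \<in> set (gT j)"
    and acyc: "acyclic (sp_edges N J f)"
    and dec_optimal: "\<forall>k\<ge>k0. \<forall>r\<in>leaves N J f. dec_opt N J f gX gT T k r (wd k r)"
    and sp_optimal: "\<forall>k\<ge>k0. sp_opt N J f gX gT T k (vs k) (ws k)"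
  shows
    "(let X = semialg {..<n} (glist gX {..<N});
          XT = semialg {..<n} (glist gT {..<N});
          RT = ROA n f T X XT;
          L = leaves N J f;
          S = (\<lambda>k. {x \<in> X. \<forall>r\<in>L. 1 \<le> wd k r x});
          Y = (\<lambda>k. {x \<in> X. real (card L) \<le> (\<Sum>r\<in>L. ws k r x)});
          D = (\<lambda>k. ((S k \<inter> Y k) - RT) \<union> (RT - (S k \<inter> Y k)))
      in (\<forall>k\<ge>k0. RT \<subseteq> S k \<inter> Y k) \<and>
         (\<forall>k\<ge>k0. D k \<in> sets (lebV {..<n})) \<and>
         ((\<lambda>k. emeasure (lebV {..<n}) (D k)) \<longlonglongrightarrow> 0) \<and>
         Max ((\<lambda>r. card (vars J (past N J f r))) ` L) =
           Max ((\<lambda>i. \<Sum>j\<in>past N J f i. card (J j)) ` {..<N}))"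
proof -
  interpret sparse_system n N J f gX gT T
    by unfold_locales (fact T_pos blocks_cover blocks_disj f_poly gX_poly gT_poly gX_ball gT_ball acyc)+
  show ?thesis
    unfolding Let_def using convergence[OF dec_optimal sp_optimal] max_clique by (intro conjI)
qed

end
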